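(* Let $\sigma$ be a connected skew Young diagram whose topmost row is row $1$, and fix eventually-zero nonnegative integer sequences $\mathbf{c}$ and $\mathbf{e}$. Then $$|\mathrm{SS}_{\mathbf{c},\mathbf{e}}(\sigma)| \;=\; \sum_{\mu\supseteq\sigma} (-1)^{|A(\mu/\sigma)|}\, a_{\sigma,\mu,\mathbf{e}}\, |\mathrm{SS}_{\mathbf{c},\mathbf{0}}(\mu)|,$$ where $a_{\sigma,\mu,\mathbf{e}}$ is the number of pairs $(T',T'')$ such that $T'$ is a row-weakly-bounded semistandard tableau on $A(\mu/\sigma)$, $T''$ is a reverse row-strict, row-bounded tableau on $B(\mu/\sigma)$, and $c(T')+c(T'')=\mathbf{e}$.
   Context: Boxes are pairs $(i,j)$ of positive integers, $i$ the row index (increasing downward), $j$ the column index (increasing to the right); $(i,j)\preceq(i',j')$ iff $i\le i'$, $j\le j'$. A skew Young diagram (skew shape) is a finite set of boxes closed under intervals; connected means its Hasse diagram under $\preceq$ is connected. Rows are numbered so that the top row of $\sigma$ is row 1. Containment convention: $\mu\supseteq\sigma$ means every box of $\sigma$ is in $\mu$ and every box of $\mu$ is in the same column as some box of $\sigma$. Then $\mu\setminus\sigma$ splits into $A(\mu/\sigma)$ (boxes above boxes of $\sigma$ in their column) and $B(\mu/\sigma)$ (boxes below). A tableau assigns a positive integer to each box; semistandard: rows weakly increasing left to right, columns strictly increasing top to bottom; reverse row-strict: rows strictly decreasing left to right, columns weakly decreasing top to bottom; row-bounded: $T(i,j)<i$; row-weakly-bounded: $T(i,j)\le i$. Content $c(T)=(c_1,c_2,\ldots)$,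 $c_i$ = number of occurrences of label $i$. A set-valued tableau assigns a nonempty finite set of positive integers to each box; it is semistandard if along rows $\max$ of each box $\le\min$ of the next box to the right, and down columns $\max$ of each box $<\min$ of the box below. Its excess $e(T)$ has $i$-th entry equal to the number of labels in row $i$ minus the number of boxes in row $i$. $\mathrm{SS}_{\mathbf{c},\mathbf{e}}(\sigma)$ is the set of semistandard set-valued tableaux of shape $\sigma$ with content $\mathbf{c}$ and excess $\mathbf{e}$ (so $\mathrm{SS}_{\mathbf{c},\mathbf{0}}(\mu)$ is in bijection with ordinary semistandard tableaux of shape $\mu$ and content $\mathbf{c}$). *)

theory Defs
  imports Complex_Main "HOL-Library.FuncSet" "HOL-Library.Product_Order"
begin

text \<open>
  A box is a pair (row, column). The order \<open>\<le>\<close> on boxes is the componentwise order of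
  \<^theory>\<open>HOL-Library.Product_Order\<close>, so \<open>{b..b'}\<close> is an interval of that order.
\<close>

type_synonym box = "nat \<times> nat"

definition skew_shape :: "box set \<Rightarrow> bool" where
  "skew_shape \<sigma> \<longleftrightarrow> finite \<sigma> \<and> \<sigma> \<subseteq> {1..} \<times> {1..} \<and> (\<forall>b\<in>\<sigma>. \<forall>b'\<in>\<sigma>. {b..b'} \<subseteq> \<sigma>)"

definition hasse :: "box set \<Rightarrow> (box \<times> box) set" where
  "hasse \<sigma> = {(b, b'). b \<in> \<sigma> \<and> b' \<in> \<sigma> \<and> b < b' \<and> \<not> (\<exists>x\<in>\<sigma>. b < x \<and> x < b')}"

definition connected_shape :: "box set \<Rightarrow> bool" where
  "connected_shape \<sigma> \<longleftrightarrow> (\<forall>b\<in>\<sigma>. \<forall>b'\<in>\<sigma>. (b, b') \<in> (hasse \<sigma> \<union> (hasse \<sigma>)\<inverse>)\<^sup>*)"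

text \<open>
  The containment convention for \<open>\<mu> \<supseteq> \<sigma>\<close>: every box of \<open>\<mu>\<close> also lies in a column of \<open>\<sigma>\<close>.
\<close>

definition shape_contains :: "box set \<Rightarrow> box set \<Rightarrow> bool" where
  "shape_contains \<mu> \<sigma> \<longleftrightarrow> \<sigma> \<subseteq> \<mu> \<and> snd ` \<mu> \<subseteq> snd ` \<sigma>"

definition boxes_above :: "box set \<Rightarrow> box set \<Rightarrow> box set" where
  "boxes_above \<mu> \<sigma> = {(i, j) \<in> \<mu> - \<sigma>. \<exists>i'. (i', j) \<in> \<sigma> \<and> i < i'}"

definition boxes_below :: "box set \<Rightarrow> box set \<Rightarrow> box set" where
  "boxes_below \<mu> \<sigma> = {(i, j) \<in> \<mu> - \<sigma>. \<exists>i'. (i', j) \<in> \<sigma> \<and> i' < i}"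

text \<open>
  A sequence \<open>(c\<^sub>1, c\<^sub>2, \<dots>)\<close> indexed by the positive integers is a function on \<^typ>\<open>nat\<close>
  with value 0 at the unused index 0.
\<close>

definition eventually_zero_seq :: "(nat \<Rightarrow> nat) \<Rightarrow> bool" where
  "eventually_zero_seq c \<longleftrightarrow> c 0 = 0 \<and> (\<forall>\<^sub>F i in sequentially. c i = 0)"

text \<open>
  Tableaux are extensional functions (\<open>undefined\<close> off the shape), so that each tableau is
  counted once.
\<close>

definition tableaux :: "box set \<Rightarrow> (box \<Rightarrow> nat) set" where
  "tableaux S = S \<rightarrow>\<^sub>E {1..}"

definition content :: "box set \<Rightarrow> (box \<Rightarrow> nat) \<Rightarrow> nat \<Rightarrow> nat" where
  "content S T k = card {b \<in> S. T b = k}"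

definition semistandard :: "box set \<Rightarrow> (box \<Rightarrow> nat) \<Rightarrow> bool" where
  "semistandard S T \<longleftrightarrow>
     (\<forall>i j j'. (i, j) \<in> S \<and> (i, j') \<in> S \<and> j < j' \<longrightarrow> T (i, j) \<le> T (i, j')) \<and>
     (\<forall>i i' j. (i, j) \<in> S \<and> (i', j) \<in> S \<and> i < i' \<longrightarrow> T (i, j) < T (i', j))"

definition reverse_row_strict :: "box set \<Rightarrow> (box \<Rightarrow> nat) \<Rightarrow> bool" where
  "reverse_row_strict S T \<longleftrightarrow>
     (\<forall>i j j'. (i, j) \<in> S \<and> (i, j') \<in> S \<and> j < j' \<longrightarrow> T (i, j) > T (i, j')) \<and>
     (\<forall>i i' j. (i, j) \<in> S \<and> (i', j) \<in> S \<and> i < i' \<longrightarrow> T (i, j) \<ge> T (i', j))"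

definition row_bounded :: "box set \<Rightarrow> (box \<Rightarrow> nat) \<Rightarrow> bool" where
  "row_bounded S T \<longleftrightarrow> (\<forall>(i, j)\<in>S. T (i, j) < i)"

definition row_weakly_bounded :: "box set \<Rightarrow> (box \<Rightarrow> nat) \<Rightarrow> bool" where
  "row_weakly_bounded S T \<longleftrightarrow> (\<forall>(i, j)\<in>S. T (i, j) \<le> i)"

definition sv_tableaux :: "box set \<Rightarrow> (box \<Rightarrow> nat set) set" where
  "sv_tableaux S = S \<rightarrow>\<^sub>E {X. X \<noteq> {} \<and> finite X \<and> X \<subseteq> {1..}}"

definition sv_semistandard :: "box set \<Rightarrow> (box \<Rightarrow> nat set) \<Rightarrow> bool" where
  "sv_semistandard S T \<longleftrightarrow>
     (\<forall>i j. (i, j) \<in> S \<and> (i, Suc j) \<in> S \<longrightarrow> Max (T (i, j)) \<le> Min (T (i, Suc j))) \<and>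
     (\<forall>i j. (i, j) \<in> S \<and> (Suc i, j) \<in> S \<longrightarrow> Max (T (i, j)) < Min (T (Suc i, j)))"

definition sv_content :: "box set \<Rightarrow> (box \<Rightarrow> nat set) \<Rightarrow> nat \<Rightarrow> nat" where
  "sv_content S T k = card {b \<in> S. k \<in> T b}"

text \<open>
  The subtraction on \<^typ>\<open>nat\<close> does not truncate, since the boxes of a set-valued tableau
  have nonempty labels.
\<close>

definition excess :: "box set \<Rightarrow> (box \<Rightarrow> nat set) \<Rightarrow> nat \<Rightarrow> nat" where
  "excess S T i = (\<Sum>b\<in>{b \<in> S. fst b = i}. card (T b)) - card {b \<in> S. fst b = i}"

definition SS :: "(nat \<Rightarrow> nat) \<Rightarrow> (nat \<Rightarrow> nat) \<Rightarrow> box set \<Rightarrow> (box \<Rightarrow> nat set) set" where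
  "SS c e S = {T \<in> sv_tableaux S. sv_semistandard S T \<and> sv_content S T = c \<and> excess S T = e}"

definition coeff_pairs ::
  "box set \<Rightarrow> box set \<Rightarrow> (nat \<Rightarrow> nat) \<Rightarrow> ((box \<Rightarrow> nat) \<times> (box \<Rightarrow> nat)) set" where
  "coeff_pairs \<sigma> \<mu> e =
     {(T', T'').
        T' \<in> tableaux (boxes_above \<mu> \<sigma>) \<and> semistandard (boxes_above \<mu> \<sigma>) T' \<and>
        row_weakly_bounded (boxes_above \<mu> \<sigma>) T' \<and>
        T'' \<in> tableaux (boxes_below \<mu> \<sigma>) \<and> reverse_row_strict (boxes_below \<mu> \<sigma>) T'' \<and>
        row_bounded (boxes_below \<mu> \<sigma>) T'' \<and>
        (\<lambda>k. content (boxes_above \<mu> \<sigma>) T' k + content (boxes_below \<mu> \<sigma>) T'' k) = e}"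

definition a_coeff :: "box set \<Rightarrow> box set \<Rightarrow> (nat \<Rightarrow> nat) \<Rightarrow> nat" where
  "a_coeff \<sigma> \<mu> e = card (coeff_pairs \<sigma> \<mu> e)"

text \<open>
  Infinitely many \<open>\<mu>\<close> contain a given nonempty \<open>\<sigma>\<close>. The sum over \<open>\<mu> \<supseteq> \<sigma>\<close> is taken over those
  with nonzero coefficient; the lemmas below show that these are finitely many and that
  the cardinalities involved are those of finite sets.
\<close>

definition supp_shapes :: "box set \<Rightarrow> (nat \<Rightarrow> nat) \<Rightarrow> box set set" where
  "supp_shapes \<sigma> e = {\<mu>. skew_shape \<mu> \<and> shape_contains \<mu> \<sigma> \<and> a_coeff \<sigma> \<mu> e \<noteq> 0}"

lemma finite_SS:
  assumes "finite S" "eventually_zero_seq c"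
  shows "finite (SS c e S)"
proof -
  obtain N where N: "\<And>i. i \<ge> N \<Longrightarrow> c i = 0"
    using assms(2) by (auto simp: eventually_zero_seq_def eventually_sequentially)
  have "SS c e S \<subseteq> S \<rightarrow>\<^sub>E Pow {..<N}"
  proof
    fix T assume T: "T \<in> SS c e S"
    have "k < N" if "b \<in> S" "k \<in> T b" for b k
    proof (rule ccontr)
      assume "\<not> k < N"
      then have "card {b \<in> S. k \<in> T b} = 0"
        using N[of k] T by (auto simp: SS_def sv_content_def fun_eq_iff)
      then have "{b \<in> S. k \<in> T b} = {}" using assms(1) by simp
      then show False using that by blast
    qed
    then show "T \<in> S \<rightarrow>\<^sub>E Pow {..<N}"
      using T by (auto simp: SS_def sv_tableaux_def PiE_iff)
  qed
  moreover have "finite (S \<rightarrow>\<^sub>E Pow {..<N})"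
    using assms(1) by (intro finite_PiE) auto
  ultimately show ?thesis by (rule finite_subset)
qed

lemma finite_coeff_pairs:
  assumes "finite \<mu>"
  shows "finite (coeff_pairs \<sigma> \<mu> e)"
proof -
  have fin: "finite (boxes_above \<mu> \<sigma>)" "finite (boxes_below \<mu> \<sigma>)"
    by (rule finite_subset[OF _ assms], auto simp: boxes_above_def boxes_below_def)+
  have "coeff_pairs \<sigma> \<mu> e \<subseteq>
      (PiE (boxes_above \<mu> \<sigma>) (\<lambda>b. {..fst b})) \<times> (PiE (boxes_below \<mu> \<sigma>) (\<lambda>b. {..fst b}))"
  proof (rule subsetI)
    fix p assume p: "p \<in> coeff_pairs \<sigma> \<mu> e"
    obtain T' T'' where [simp]: "p = (T', T'')" by (cases p)
    have "T' x \<le> fst x" if "x \<in> boxes_above \<mu> \<sigma>" for x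
      using p that by (auto simp: coeff_pairs_def row_weakly_bounded_def case_prod_unfold)
    moreover have "T'' x \<le> fst x" if "x \<in> boxes_below \<mu> \<sigma>" for x
      using p that
      by (auto simp: coeff_pairs_def row_bounded_def case_prod_unfold intro: less_imp_le)
    moreover have "T' \<in> extensional (boxes_above \<mu> \<sigma>)" "T'' \<in> extensional (boxes_below \<mu> \<sigma>)"
      using p by (auto simp: coeff_pairs_def tableaux_def PiE_def)
    ultimately show "p \<in> (PiE (boxes_above \<mu> \<sigma>) (\<lambda>b. {..fst b})) \<times>
        (PiE (boxes_below \<mu> \<sigma>) (\<lambda>b. {..fst b}))"
      by (simp add: PiE_iff del: split_paired_All)
  qed
  moreover have "finite ((PiE (boxes_above \<mu> \<sigma>) (\<lambda>b. {..fst b})) \<times> (PiE (boxes_below \<mu> \<sigma>) (\<lambda>b. {..fst b})))"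
    using fin by (intro finite_cartesian_product finite_PiE) auto
  ultimately show ?thesis by (rule finite_subset)
qed

lemma card_eq_sum_content:
  assumes "finite S" "\<And>b. b \<in> S \<Longrightarrow> T b < N"
  shows "card S = (\<Sum>k<N. content S T k)"
proof -
  have "card S = card (\<Union>k\<in>{..<N}. {b \<in> S. T b = k})"
    using assms(2) by (intro arg_cong[where f = card]) auto
  also have "\<dots> = (\<Sum>k<N. content S T k)"
    unfolding content_def using assms(1) by (intro card_UN_disjoint) auto
  finally show ?thesis .
qed

lemma finite_supp_shapes:
  assumes "skew_shape \<sigma>" "eventually_zero_seq e"
  shows "finite (supp_shapes \<sigma> e)"
proof -
  obtain N where N: "\<And>i. i \<ge> N \<Longrightarrow> e i = 0"
    using assms(2) by (auto simp: eventually_zero_seq_def eventually_sequentially)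
  define E where "E = (\<Sum>k<N. e k)"
  have fs: "finite \<sigma>" using assms(1) by (simp add: skew_shape_def)
  obtain R where R: "\<And>i j. (i, j) \<in> \<sigma> \<Longrightarrow> i \<le> R"
    using finite_nat_set_iff_bounded_le[of "fst ` \<sigma>"] fs by fastforce
  have "supp_shapes \<sigma> e \<subseteq> Pow ({..R + E} \<times> snd ` \<sigma>)"
  proof (rule subsetI, rule PowI, rule subsetI)
    fix \<mu> b assume \<mu>: "\<mu> \<in> supp_shapes \<sigma> e" and b: "b \<in> \<mu>"
    have sk: "skew_shape \<mu>" and co: "shape_contains \<mu> \<sigma>" and nz: "a_coeff \<sigma> \<mu> e \<noteq> 0"
      using \<mu> by (auto simp: supp_shapes_def)
    have fm: "finite \<mu>" using sk by (simp add: skew_shape_def)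
    have "coeff_pairs \<sigma> \<mu> e \<noteq> {}" using nz by (auto simp: a_coeff_def)
    then obtain T' T'' where
      ce: "\<And>k. content (boxes_above \<mu> \<sigma>) T' k + content (boxes_below \<mu> \<sigma>) T'' k = e k"
      by (auto simp: coeff_pairs_def fun_eq_iff)
    have fb: "finite (boxes_below \<mu> \<sigma>)"
      by (rule finite_subset[OF _ fm]) (auto simp: boxes_below_def)
    have lt: "T'' x < N" if "x \<in> boxes_below \<mu> \<sigma>" for x
    proof (rule ccontr)
      assume "\<not> T'' x < N"
      then have "content (boxes_below \<mu> \<sigma>) T'' (T'' x) = 0"
        using N[of "T'' x"] ce[of "T'' x"] by simp
      then have "{y \<in> boxes_below \<mu> \<sigma>. T'' y = T'' x} = {}"
        using fb by (simp add: content_def)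
      then show False using that by blast
    qed
    have "card (boxes_below \<mu> \<sigma>) = (\<Sum>k<N. content (boxes_below \<mu> \<sigma>) T'' k)"
      using card_eq_sum_content[OF fb] lt by blast
    also have "\<dots> \<le> E"
      unfolding E_def by (intro sum_mono) (metis ce le_add2)
    finally have cb: "card (boxes_below \<mu> \<sigma>) \<le> E" .
    obtain i j where ij: "b = (i, j)" by (cases b)
    have js: "j \<in> snd ` \<sigma>" using co b ij by (force simp: shape_contains_def)
    then obtain i' where i': "(i', j) \<in> \<sigma>" by auto
    have "(\<lambda>x. (x, j)) ` {R<..i} \<subseteq> boxes_below \<mu> \<sigma>"
    proof
      fix y assume "y \<in> (\<lambda>x. (x, j)) ` {R<..i}"
      then obtain x where x: "y = (x, j)" "R < x" "x \<le> i" by auto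
      have "(x, j) \<in> {(i', j)..(i, j)}" using x R[OF i'] by (auto simp: less_eq_prod_def)
      moreover have "(i', j) \<in> \<mu>" using i' co by (auto simp: shape_contains_def)
      ultimately have "(x, j) \<in> \<mu>" using sk b ij unfolding skew_shape_def by blast
      moreover have "(x, j) \<notin> \<sigma>" using R[of x j] x by auto
      moreover have "i' < x" using R[OF i'] x by auto
      ultimately show "y \<in> boxes_below \<mu> \<sigma>" using x i' by (auto simp: boxes_below_def)
    qed
    then have "card ((\<lambda>x. (x, j)) ` {R<..i}) \<le> E"
      using cb card_mono[OF fb] by (meson order_trans)
    then have "i \<le> R + E" by (simp add: card_image inj_on_def)
    then show "b \<in> {..R + E} \<times> snd ` \<sigma>" using ij js by auto
  qed
  moreover have "finite (Pow ({..R + E} \<times> snd ` \<sigma>))" using fs by auto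
  ultimately show ?thesis by (rule finite_subset)
qed

end

theory Submission
  imports Defs "HOL-Library.Poly_Mapping" "HOL-Library.Function_Algebras"
begin

text \<open>
  Mark the label \<open>k\<close> by a variable \<open>x\<^sub>k\<close> and an excess label in row \<open>i\<close> by \<open>t\<^sub>i\<close>. Reading a
  tableau label by label turns every generating function of the theorem into a product of
  operators on sequences of row ends: \<open>U(x)\<close> adds a horizontal strip, \<open>H\<^sub>k\<close> removes a horizontal
  strip in rows \<open>\<ge> k\<close> with weight \<open>-t\<^sub>k\<close> per box (the tableaux \<open>T'\<close> with their sign), \<open>V\<^sub>k\<close> removes
  a vertical strip in rows \<open>> k\<close> with weight \<open>t\<^sub>k\<close> per box (the tableaux \<open>T''\<close>), and a set-valued
  tableau adds horizontal strips with an extra factor \<open>1 + x t\<^sub>i\<close> for each corner of row \<open>i\<close> that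
  can absorb the new label. Let \<open>G\<^sub>k(x)\<close> be \<open>U(x)\<close> with such factors for rows \<open>\<le> k\<close>, where row ends
  on the inner boundary count as corners as well. Three identities, each of which factors over
  the rows, give the theorem:
  \<^item> \<open>G\<^sub>k\<^sub>-\<^sub>1(x) V\<^sub>k = V\<^sub>k G\<^sub>k(x)\<close>;
  \<^item> \<open>H\<^sub>k \<cdots> H\<^sub>1 V\<^sub>1 \<cdots> V\<^sub>k\<close> removes boxes from rows \<open>1, \<dots>, k\<close> in all possible ways, with weight
    \<open>-t\<^sub>i\<close> for a box in row \<open>i\<close>;
  \<^item> summing over all these removals cancels, by telescoping in each row, the factors of the
    \<open>G\<^sub>L(x)\<close> at corners that lie on the inner boundary.
\<close>

section \<open>Strips and their exchange\<close>

text \<open>Why passing \<open>V_k\<close> produces one corner factor and no more: the contributions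
  of a row to the two sides agree once the factor of the gap below the row is swapped for that of
  the gap above it. Over the rows \<open>> k\<close> these swaps telescope, and what survives is the
  gap between the rows \<open>k\<close> and \<open>k + 1\<close>, whose factor is the corner factor
  of row \<open>k\<close>. For this the factors may depend on the two row sequences only. Whether a
  corner holds a box depends on the inner boundary, so \<open>G_k\<close> has to ignore it, and the
  signed removals have to repair the excess afterwards. The gap below the last row of the frame is
  harmless only if the strip starts from a shape with nothing in that row. A label opens at most one
  new row, so \<open>n\<close> rows beyond those of \<sigma> suffice for \<open>n\<close> labels,
  and a shape that leaves such a frame has columns too long for these labels. Connectedness acts
  through the columns: they form an interval \<open>{p<..W}\<close>, and each shape containing
  \<sigma> becomes a pair of row sequences with values in \<open>{p..W}\<close>.\<close>

lemma sum_prod_pointwise: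
  fixes g :: "'i \<Rightarrow> 'b \<Rightarrow> 'c::comm_semiring_1"
  assumes "finite A" and fin: "\<And>i. i \<in> A \<Longrightarrow> finite (I i)"
  shows "(\<Sum>f\<in>{f. \<forall>i. if i \<in> A then f i \<in> I i else f i = d i}. \<Prod>i\<in>A. g i (f i)) =
    (\<Prod>i\<in>A. \<Sum>r\<in>I i. g i r)"
proof -
  have "(\<Prod>i\<in>A. \<Sum>r\<in>I i. g i r) = (\<Sum>f\<in>PiE A I. \<Prod>i\<in>A. g i (f i))"
    by (rule prod_sum_PiE) (use assms in auto)
  \<comment> \<open>Off \<open>A\<close> the functions take prescribed values instead of
    \<open>undefined\<close>, because a row sequence keeps its values in the rows that do not
    vary.\<close>
  also have "\<dots> = (\<Sum>f\<in>{f. \<forall>i. if i \<in> A then f i \<in> I i else f i = d i}. \<Prod>i\<in>A. g i (f i))"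
    by (rule sum.reindex_bij_witness[where
          i = "\<lambda>f. restrict f A" and j = "\<lambda>f i. if i \<in> A then f i else d i"])
       (auto simp: fun_eq_iff PiE_iff extensional_def intro!: prod.cong split: if_splits)
  finally show ?thesis ..
qed

text \<open>
  The factor \<open>d\<close> sits between two adjacent rows, so that the products of both sides over an
  interval of rows differ by a telescoping product.
\<close>

lemma row_commutation:
  fixes x t :: "'a::comm_ring_1"
  defines "d \<equiv> \<lambda>a b::nat. if b \<le> a then if b < a then 1 + x * t else 1 else 0"
  assumes "b' \<le> b" "a \<le> a0"
  shows "(\<Sum>r\<in>{max a b..min a0 (Suc b)}. x ^ (r - a) * t ^ (r - b)) * d a b' =
    d a0 b * (\<Sum>r\<in>{max (a - 1) b'..min a b}. t ^ (a - r) * x ^ (b - r))"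
proof -
  consider "a \<le> b" | "a = Suc b" | "Suc b < a" by linarith
  then show ?thesis
  proof cases
    \<comment> \<open>Each sum has at most two terms here, and the second term turns a factor
      \<open>1\<close> into \<open>1 + x * t\<close>. For \<open>a = Suc b\<close> both sums are
      \<open>t\<close> and both factors \<open>d\<close> are \<open>1 + x * t\<close>; for larger
      \<open>a\<close> both sums are empty.\<close>
    case 1
    have u: "(\<Sum>r\<in>{max a b..min a0 (Suc b)}. x ^ (r - a) * t ^ (r - b)) = x ^ (b - a) * d a0 b"
    proof -
      consider "a0 < b" | "a0 = b" | "b < a0" by linarith
      then show ?thesis
      proof cases
        case 3
        then have "{max a b..min a0 (Suc b)} = {b, Suc b}" using 1 by auto
        then show ?thesis using 3 1 by (simp add: d_def Suc_diff_le algebra_simps)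
      qed (use 1 in \<open>auto simp: d_def max_def\<close>)
    qed
    have l: "(\<Sum>r\<in>{max (a - 1) b'..min a b}. t ^ (a - r) * x ^ (b - r)) = x ^ (b - a) * d a b'"
    proof -
      consider "a < b'" | "a = b'" | "b' < a" by linarith
      then show ?thesis
      proof cases
        case 3
        then have "{max (a - 1) b'..min a b} = {a - 1, a}" "Suc (b - a) = b - (a - 1)" "a - (a - 1) = 1"
          "a - 1 \<noteq> a" using 1 by auto
        then have "(\<Sum>r\<in>{max (a - 1) b'..min a b}. t ^ (a - r) * x ^ (b - r)) =
            t * x ^ Suc (b - a) + x ^ (b - a)" by (simp only: ) simp
        then show ?thesis using 3 by (simp add: d_def algebra_simps)
      qed (use 1 in \<open>auto simp: d_def max_def\<close>)
    qed
    show ?thesis unfolding u l by (simp add: ac_simps)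
  next
    case 2
    then have "{max a b..min a0 (Suc b)} = {a}" "{max (a - 1) b'..min a b} = {b}"
      using assms by auto
    then show ?thesis using 2 assms by (simp add: d_def)
  qed (auto simp: max_def)
qed

lemma prod_split_rows:
  fixes g :: "nat \<Rightarrow> 'b::comm_monoid_mult"
  shows "K \<le> L \<Longrightarrow> (\<Prod>i\<le>L. g i) = (\<Prod>i\<le>K. g i) * (\<Prod>i\<in>{K<..L}. g i)"
  by (subst prod.union_disjoint[symmetric]) (auto intro: prod.cong simp: ivl_disj_un)

lemma sum_if_filter:
  fixes f :: "'b \<Rightarrow> 'c::comm_monoid_add"
  shows "finite A \<Longrightarrow> (\<Sum>x\<in>A. if P x then f x else 0) = (\<Sum>x\<in>{x\<in>A. P x}. f x)"
  by (simp add: sum.If_cases Int_def)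

text \<open>
  A shape is encoded by the columns in which its rows end. Row 0 is a dummy that makes the
  condition \<open>\<beta> (Suc i) \<le> \<alpha> i\<close> for horizontal strips vacuous for the topmost row.
\<close>

type_synonym rows = "nat \<Rightarrow> nat"

definition hs :: "rows \<Rightarrow> rows \<Rightarrow> bool" where
  "hs \<alpha> \<beta> \<longleftrightarrow> (\<forall>i. \<alpha> i \<le> \<beta> i \<and> \<beta> (Suc i) \<le> \<alpha> i)"

definition vs :: "rows \<Rightarrow> rows \<Rightarrow> bool" where
  "vs \<alpha> \<beta> \<longleftrightarrow> (\<forall>i. \<alpha> i \<le> \<beta> i \<and> \<beta> i \<le> Suc (\<alpha> i))"

locale frame =
  fixes p W L :: nat
begin

text \<open>\<open>l\<close> bounds the rows that can carry boxes, while the frame has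
  \<open>L\<close> rows throughout; the difference \<open>L - l\<close> tells how many further
  strips fit.\<close>

definition Par :: "nat \<Rightarrow> rows set" where
  "Par l = {f. f 0 = W \<and> (\<forall>i. f (Suc i) \<le> f i) \<and> (\<forall>i>l. f i = p)}"

definition up :: "'a::comm_ring_1 \<Rightarrow> rows \<Rightarrow> rows \<Rightarrow> 'a" where
  "up x \<alpha> \<beta> = (if hs \<alpha> \<beta> then \<Prod>i\<le>L. x ^ (\<beta> i - \<alpha> i) else 0)"

text \<open>\<open>\<beta> (Suc i) < \<alpha> i\<close> says that \<open>\<beta>\<close> has nothing
  below the end of row \<open>i\<close> of \<open>\<alpha>\<close>, so that a box at this end could
  hold the new label too. Whether there is such a box is the extra test
  \<open>\<mu> i < \<alpha> i\<close> of \<open>up_sv\<close>.\<close>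

definition up_ex :: "(nat \<Rightarrow> 'a::comm_ring_1) \<Rightarrow> nat \<Rightarrow> 'a \<Rightarrow> rows \<Rightarrow> rows \<Rightarrow> 'a" where
  "up_ex t k x \<alpha> \<beta> = up x \<alpha> \<beta> * (\<Prod>i\<in>{1..k}. if \<beta> (Suc i) < \<alpha> i then 1 + x * t i else 1)"

definition up_sv :: "(nat \<Rightarrow> 'a::comm_ring_1) \<Rightarrow> rows \<Rightarrow> 'a \<Rightarrow> rows \<Rightarrow> rows \<Rightarrow> 'a" where
  "up_sv t \<mu> x \<alpha> \<beta> =
     up x \<alpha> \<beta> * (\<Prod>i\<in>{1..L}. if \<beta> (Suc i) < \<alpha> i \<and> \<mu> i < \<alpha> i then 1 + x * t i else 1)"

definition vstep :: "nat \<Rightarrow> 'a::comm_ring_1 \<Rightarrow> rows \<Rightarrow> rows \<Rightarrow> 'a" where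
  "vstep k y \<alpha> \<beta> =
     (if vs \<alpha> \<beta> \<and> (\<forall>i\<le>k. \<beta> i = \<alpha> i) then \<Prod>i\<le>L. y ^ (\<beta> i - \<alpha> i) else 0)"

definition hstep :: "nat \<Rightarrow> 'a::comm_ring_1 \<Rightarrow> rows \<Rightarrow> rows \<Rightarrow> 'a" where
  "hstep k y \<alpha> \<beta> =
     (if hs \<alpha> \<beta> \<and> (\<forall>i<k. \<beta> i = \<alpha> i) then \<Prod>i\<le>L. y ^ (\<beta> i - \<alpha> i) else 0)"

lemma Par_antimono: "f \<in> Par l \<Longrightarrow> i \<le> j \<Longrightarrow> f j \<le> f i"
  by (rule lift_Suc_antimono_le[of f]) (auto simp: Par_def)

lemma Par_ge: "f \<in> Par l \<Longrightarrow> p \<le> f i"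
proof -
  assume f: "f \<in> Par l"
  have "f (max i (Suc l)) = p" using f by (auto simp: Par_def)
  then show ?thesis using Par_antimono[OF f, of i "max i (Suc l)"] by simp
qed

lemma Par_le: "f \<in> Par l \<Longrightarrow> f i \<le> W"
  using Par_antimono[of f l 0 i] by (auto simp: Par_def)

lemma Par_0: "f \<in> Par l \<Longrightarrow> f 0 = W"
  and Par_Suc: "f \<in> Par l \<Longrightarrow> f (Suc i) \<le> f i"
  and Par_out: "f \<in> Par l \<Longrightarrow> l < i \<Longrightarrow> f i = p"
  by (auto simp: Par_def)

lemma Par_mono: "l \<le> l' \<Longrightarrow> Par l \<subseteq> Par l'"
  by (auto simp: Par_def)

lemma finite_Par [simp, intro]: "finite (Par l)"
proof (rule finite_subset)
  show "Par l \<subseteq> {f. \<forall>i. (i \<in> {..l} \<longrightarrow> f i \<in> {..W}) \<and> (i \<notin> {..l} \<longrightarrow> f i = p)}"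
    using Par_le by (auto simp: Par_out)
  show "finite {f. \<forall>i. (i \<in> {..l} \<longrightarrow> f i \<in> {..W}) \<and> (i \<notin> {..l} \<longrightarrow> f i = p)}"
    by (rule finite_set_of_finite_funs) auto
qed

text \<open>For fixed \<open>\<alpha>\<close> and \<open>\<beta>\<close> the rows of
  \<open>\<kappa>\<close> vary independently: monotonicity of \<open>\<kappa>\<close> is implied by
  the interlacing \<open>\<kappa> (Suc i) \<le> \<alpha> i \<le> \<kappa> i\<close>. Therefore the
  sum over \<open>\<kappa>\<close> becomes a product over rows.\<close>

lemma upper_set:
  assumes a: "\<alpha> \<in> Par L" "\<alpha> L = p" and b: "\<beta> \<in> Par L" and K: "K \<le> L"
  shows "{\<kappa> \<in> Par L. hs \<alpha> \<kappa> \<and> vs \<beta> \<kappa> \<and> (\<forall>i\<le>K. \<kappa> i = \<beta> i)} =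
    (if (\<forall>i\<le>K. \<alpha> i \<le> \<beta> i) \<and> (\<forall>i<K. \<beta> (Suc i) \<le> \<alpha> i)
     then {\<kappa>. \<forall>i. if i \<in> {K<..L} then \<kappa> i \<in> {max (\<alpha> i) (\<beta> i)..min (\<alpha> (i-1)) (Suc (\<beta> i))} else \<kappa> i = \<beta> i}
     else {})" (is "?L = (if ?C then ?R else {})")
proof (cases ?C)
  case True
  have "\<kappa> \<in> ?R" if l: "\<kappa> \<in> ?L" for \<kappa>
  proof -
    have "\<kappa> i \<in> {max (\<alpha> i) (\<beta> i)..min (\<alpha> (i-1)) (Suc (\<beta> i))}" if "K < i" for i
      using l that by (cases i) (auto simp: hs_def vs_def)
    moreover have "\<kappa> i = \<beta> i" if "i \<notin> {K<..L}" for i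
      using l b that by (cases "i \<le> K") (auto simp: Par_out)
    ultimately show ?thesis by auto
  qed
  moreover have "\<kappa> \<in> ?L" if l: "\<kappa> \<in> ?R" for \<kappa>
  proof -
    have l1: "\<alpha> i \<le> \<kappa> i" "\<beta> i \<le> \<kappa> i" "\<kappa> i \<le> \<alpha> (i-1)" "\<kappa> i \<le> Suc (\<beta> i)" if "K < i" "i \<le> L" for i
      using l that by (auto dest: spec[of _ i])
    have l2: "\<kappa> i = \<beta> i" if "\<not> (K < i \<and> i \<le> L)" for i
      using l that by (auto dest!: spec[of _ i])
    have A: "\<alpha> i \<le> \<kappa> i" for i
      using True l1(1)[of i] l2[of i] Par_out[OF a(1), of i] Par_ge[OF b, of i]
      by (cases "K < i"; cases "i \<le> L") auto
    have B: "\<kappa> (Suc i) \<le> \<alpha> i" for i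
      using True l1(3)[of "Suc i"] l2[of "Suc i"] Par_out[OF b, of "Suc i"] Par_ge[OF a(1), of i]
      by (cases "i < K"; cases "Suc i \<le> L") auto
    have "\<beta> i \<le> \<kappa> i \<and> \<kappa> i \<le> Suc (\<beta> i)" for i
      using l1[of i] l2[of i] by (cases "K < i \<and> i \<le> L") auto
    moreover have "\<kappa> \<in> Par L"
      using l2[of 0] b A B le_trans[OF B A] l2 by (auto simp: Par_def)
    ultimately show ?thesis using A B l2 by (auto simp: hs_def vs_def)
  qed
  ultimately have "?L = ?R" by blast
  then show ?thesis unfolding if_P[OF True] .
next
  case False
  have "?C" if l: "\<kappa> \<in> ?L" for \<kappa>
  proof -
    have "\<alpha> i \<le> \<beta> i" if "i \<le> K" for i
      using l that by (auto simp: hs_def dest!: spec[of _ i])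
    moreover have "\<beta> (Suc i) \<le> \<alpha> i" if "i < K" for i
    proof -
      have "\<kappa> (Suc i) = \<beta> (Suc i)" using l that by simp
      moreover have "\<kappa> (Suc i) \<le> \<alpha> i" using l by (simp add: hs_def)
      ultimately show ?thesis by simp
    qed
    ultimately show ?thesis by blast
  qed
  then have "?L = {}" using False by blast
  then show ?thesis unfolding if_not_P[OF False] .
qed

text \<open>The rows decouple as in \<open>upper_set\<close>, but row \<open>K\<close> of
  \<open>\<nu>\<close> is frozen at \<open>\<alpha> K\<close>, and its interlacing with
  \<open>\<beta>\<close> leaves the additional condition
  \<open>\<beta> (Suc K) \<le> \<alpha> K\<close>.\<close>

lemma lower_set:
  assumes a: "\<alpha> \<in> Par L" and b: "\<beta> \<in> Par L" and K: "K \<le> L"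
  shows "{\<nu> \<in> Par L. vs \<nu> \<alpha> \<and> (\<forall>i\<le>K. \<alpha> i = \<nu> i) \<and> hs \<nu> \<beta>} =
    (if (\<forall>i\<le>K. \<alpha> i \<le> \<beta> i) \<and> (\<forall>i<K. \<beta> (Suc i) \<le> \<alpha> i) \<and> \<beta> (Suc K) \<le> \<alpha> K
     then {\<nu>. \<forall>i. if i \<in> {K<..L} then \<nu> i \<in> {max (\<alpha> i - 1) (\<beta> (Suc i))..min (\<alpha> i) (\<beta> i)} else \<nu> i = \<alpha> i}
     else {})" (is "?L = (if ?C then ?R else {})")
proof (cases ?C)
  case True
  have "\<nu> \<in> ?R" if l: "\<nu> \<in> ?L" for \<nu>
  proof -
    have "\<nu> i \<in> {max (\<alpha> i - 1) (\<beta> (Suc i))..min (\<alpha> i) (\<beta> i)}" for i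
    proof -
      have "\<alpha> i \<le> Suc (\<nu> i)" "\<beta> (Suc i) \<le> \<nu> i" "\<nu> i \<le> \<alpha> i" "\<nu> i \<le> \<beta> i"
        using l by (auto simp: hs_def vs_def)
      then show ?thesis by auto
    qed
    moreover have "\<nu> i = \<alpha> i" if "i \<notin> {K<..L}" for i
      using l a that by (cases "i \<le> K") (auto simp: Par_out)
    ultimately show ?thesis by auto
  qed
  moreover have "\<nu> \<in> ?L" if l: "\<nu> \<in> ?R" for \<nu>
  proof -
    have l1: "\<alpha> i \<le> Suc (\<nu> i)" "\<beta> (Suc i) \<le> \<nu> i" "\<nu> i \<le> \<alpha> i" "\<nu> i \<le> \<beta> i" if "K < i" "i \<le> L" for i
      using l that by (auto dest!: spec[of _ i])
    have l2: "\<nu> i = \<alpha> i" if "\<not> (K < i \<and> i \<le> L)" for i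
      using l that by (auto dest!: spec[of _ i])
    have A: "\<nu> i \<le> \<beta> i" for i
      using True l1(4)[of i] l2[of i] Par_out[OF a(1), of i] Par_ge[OF b, of i]
      by (cases "K < i"; cases "i \<le> L") auto
    have B: "\<beta> (Suc i) \<le> \<nu> i" for i
    proof -
      consider "i < K" | "i = K" | "K < i" "i \<le> L" | "L < i" "K < i" using K by linarith
      then show ?thesis
        using True l1(2)[of i] l2[of i] Par_out[OF b, of "Suc i"] Par_ge[OF a(1), of i]
        by cases auto
    qed
    have "\<nu> i \<le> \<alpha> i \<and> \<alpha> i \<le> Suc (\<nu> i)" for i
      using l1[of i] l2[of i] by (cases "K < i \<and> i \<le> L") auto
    moreover have "\<nu> \<in> Par L"
      using l2[of 0] a A B le_trans[OF A B] l2 by (auto simp: Par_def)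
    ultimately show ?thesis using A B l2 by (auto simp: hs_def vs_def)
  qed
  ultimately have "?L = ?R" by blast
  then show ?thesis unfolding if_P[OF True] .
next
  case False
  have "?C" if l: "\<nu> \<in> ?L" for \<nu>
  proof -
    have "\<nu> i = \<alpha> i" "\<nu> i \<le> \<beta> i" "\<beta> (Suc i) \<le> \<nu> i" if "i \<le> K" for i
      using l that by (auto simp: hs_def)
    then show ?thesis by (metis less_imp_le order_refl)
  qed
  then have "?L = {}" using False by blast
  then show ?thesis unfolding if_not_P[OF False] .
qed

lemma exchange:
  fixes x :: "'a::comm_ring_1"
  assumes a: "\<alpha> \<in> Par L" "\<alpha> L = p" and b: "\<beta> \<in> Par L" and K: "Suc k \<le> L"
  shows "(\<Sum>\<kappa>\<in>Par L. up_ex t k x \<alpha> \<kappa> * vstep (Suc k) (t (Suc k)) \<beta> \<kappa>) =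
    (\<Sum>\<nu>\<in>Par L. vstep (Suc k) (t (Suc k)) \<nu> \<alpha> * up_ex t (Suc k) x \<nu> \<beta>)"
proof -
  define K where "K = Suc k"
  define y where "y = t K"
  define C where "C \<longleftrightarrow> (\<forall>i\<le>K. \<alpha> i \<le> \<beta> i) \<and> (\<forall>i<K. \<beta> (Suc i) \<le> \<alpha> i)"
  \<comment> \<open>The part common to both sides: the vertical strip avoids the rows up to
    \<open>K\<close>, so there the horizontal strip leads from \<open>\<alpha>\<close> to
    \<open>\<beta>\<close> in either order.\<close>
  define E where "E = (\<Prod>i\<in>{1..k}. if \<beta> (Suc i) < \<alpha> i then 1 + x * t i else 1) * (\<Prod>i\<le>K. x ^ (\<beta> i - \<alpha> i))"
  \<comment> \<open>The factor of the gap between two rows. Its value \<open>0\<close> for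
    \<open>a < b\<close> takes over the additional condition of \<open>lower_set\<close>.\<close>
  define d where "d = (\<lambda>a b::nat. if b \<le> a then if b < a then 1 + x * y else 1 else 0)"
  define P where "P = (\<lambda>i. \<Sum>r\<in>{max (\<alpha> i) (\<beta> i)..min (\<alpha> (i-1)) (Suc (\<beta> i))}. x ^ (r - \<alpha> i) * y ^ (r - \<beta> i))"
  define Q where "Q = (\<lambda>i. \<Sum>r\<in>{max (\<alpha> i - 1) (\<beta> (Suc i))..min (\<alpha> i) (\<beta> i)}. y ^ (\<alpha> i - r) * x ^ (\<beta> i - r))"
  have KL: "K \<le> L" using K by (simp add: K_def)
  have "(\<Sum>\<kappa>\<in>Par L. up_ex t k x \<alpha> \<kappa> * vstep (Suc k) (t (Suc k)) \<beta> \<kappa>) =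
    (\<Sum>\<kappa>\<in>Par L. if hs \<alpha> \<kappa> \<and> vs \<beta> \<kappa> \<and> (\<forall>i\<le>K. \<kappa> i = \<beta> i) then
      (\<Prod>i\<in>{1..k}. if \<kappa> (Suc i) < \<alpha> i then 1 + x * t i else 1) *
      (\<Prod>i\<le>L. x ^ (\<kappa> i - \<alpha> i)) * (\<Prod>i\<le>L. y ^ (\<kappa> i - \<beta> i)) else 0)"
    unfolding up_ex_def up_def vstep_def K_def[symmetric] y_def[symmetric]
    by (intro sum.cong refl) auto
  also have "\<dots> = (\<Sum>\<kappa>\<in>{\<kappa> \<in> Par L. hs \<alpha> \<kappa> \<and> vs \<beta> \<kappa> \<and> (\<forall>i\<le>K. \<kappa> i = \<beta> i)}.
      (\<Prod>i\<in>{1..k}. if \<kappa> (Suc i) < \<alpha> i then 1 + x * t i else 1) *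
      (\<Prod>i\<le>L. x ^ (\<kappa> i - \<alpha> i)) * (\<Prod>i\<le>L. y ^ (\<kappa> i - \<beta> i)))"
    by (rule sum_if_filter) simp
  also have "\<dots> = (\<Sum>\<kappa>\<in>{\<kappa> \<in> Par L. hs \<alpha> \<kappa> \<and> vs \<beta> \<kappa> \<and> (\<forall>i\<le>K. \<kappa> i = \<beta> i)}.
      E * (\<Prod>i\<in>{K<..L}. x ^ (\<kappa> i - \<alpha> i) * y ^ (\<kappa> i - \<beta> i)))"
  proof (intro sum.cong refl)
    fix \<kappa> assume "\<kappa> \<in> {\<kappa> \<in> Par L. hs \<alpha> \<kappa> \<and> vs \<beta> \<kappa> \<and> (\<forall>i\<le>K. \<kappa> i = \<beta> i)}"
    then have l: "\<kappa> i = \<beta> i" if "i \<le> K" for i using that by auto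
    have "(\<Prod>i\<in>{1..k}. if \<kappa> (Suc i) < \<alpha> i then 1 + x * t i else 1) =
        (\<Prod>i\<in>{1..k}. if \<beta> (Suc i) < \<alpha> i then 1 + x * t i else 1)"
      by (intro prod.cong refl) (simp add: l K_def)
    moreover have "(\<Prod>i\<le>K. x ^ (\<kappa> i - \<alpha> i)) = (\<Prod>i\<le>K. x ^ (\<beta> i - \<alpha> i))"
      "(\<Prod>i\<le>K. y ^ (\<kappa> i - \<beta> i)) = 1"
      by (simp_all add: l)
    ultimately show "(\<Prod>i\<in>{1..k}. if \<kappa> (Suc i) < \<alpha> i then 1 + x * t i else 1) *
      (\<Prod>i\<le>L. x ^ (\<kappa> i - \<alpha> i)) * (\<Prod>i\<le>L. y ^ (\<kappa> i - \<beta> i)) =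
      E * (\<Prod>i\<in>{K<..L}. x ^ (\<kappa> i - \<alpha> i) * y ^ (\<kappa> i - \<beta> i))"
      unfolding prod_split_rows[OF KL] by (simp add: E_def prod.distrib ac_simps)
  qed
  also have "\<dots> = (if C then E * (\<Prod>i\<in>{K<..L}. P i) else 0)"
    unfolding sum_distrib_left[symmetric] upper_set[OF a b KL] C_def[symmetric] P_def
    using sum_prod_pointwise[of "{K<..L}" "\<lambda>i. {max (\<alpha> i) (\<beta> i)..min (\<alpha> (i-1)) (Suc (\<beta> i))}"
        "\<lambda>i r. x ^ (r - \<alpha> i) * y ^ (r - \<beta> i)" \<beta>]
    by (cases C) (simp_all only: if_True if_False sum.empty mult_zero_right
       finite_greaterThanAtMost finite_atLeastAtMost simp_thms)
  finally have lhs: "(\<Sum>\<kappa>\<in>Par L. up_ex t k x \<alpha> \<kappa> * vstep (Suc k) (t (Suc k)) \<beta> \<kappa>) =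
    (if C then E * (\<Prod>i\<in>{K<..L}. P i) else 0)" .

  have "(\<Sum>\<nu>\<in>Par L. vstep (Suc k) (t (Suc k)) \<nu> \<alpha> * up_ex t (Suc k) x \<nu> \<beta>) =
    (\<Sum>\<nu>\<in>Par L. if vs \<nu> \<alpha> \<and> (\<forall>i\<le>K. \<alpha> i = \<nu> i) \<and> hs \<nu> \<beta> then
      (\<Prod>i\<in>{1..K}. if \<beta> (Suc i) < \<nu> i then 1 + x * t i else 1) *
      (\<Prod>i\<le>L. x ^ (\<beta> i - \<nu> i)) * (\<Prod>i\<le>L. y ^ (\<alpha> i - \<nu> i)) else 0)"
    unfolding up_ex_def up_def vstep_def K_def[symmetric] y_def[symmetric]
    by (intro sum.cong refl) auto
  also have "\<dots> = (\<Sum>\<nu>\<in>{\<nu> \<in> Par L. vs \<nu> \<alpha> \<and> (\<forall>i\<le>K. \<alpha> i = \<nu> i) \<and> hs \<nu> \<beta>}.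
      (\<Prod>i\<in>{1..K}. if \<beta> (Suc i) < \<nu> i then 1 + x * t i else 1) *
      (\<Prod>i\<le>L. x ^ (\<beta> i - \<nu> i)) * (\<Prod>i\<le>L. y ^ (\<alpha> i - \<nu> i)))"
    by (rule sum_if_filter) simp
  also have "\<dots> = (\<Sum>\<nu>\<in>{\<nu> \<in> Par L. vs \<nu> \<alpha> \<and> (\<forall>i\<le>K. \<alpha> i = \<nu> i) \<and> hs \<nu> \<beta>}.
      E * d (\<alpha> K) (\<beta> (Suc K)) * (\<Prod>i\<in>{K<..L}. y ^ (\<alpha> i - \<nu> i) * x ^ (\<beta> i - \<nu> i)))"
  proof (intro sum.cong refl)
    fix \<nu> assume n: "\<nu> \<in> {\<nu> \<in> Par L. vs \<nu> \<alpha> \<and> (\<forall>i\<le>K. \<alpha> i = \<nu> i) \<and> hs \<nu> \<beta>}"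
    then have l: "\<nu> i = \<alpha> i" if "i \<le> K" for i using that by auto
    have "(\<Prod>i\<in>{1..K}. if \<beta> (Suc i) < \<nu> i then 1 + x * t i else 1) =
        (\<Prod>i\<in>{1..K}. if \<beta> (Suc i) < \<alpha> i then 1 + x * t i else 1)"
      by (intro prod.cong refl) (simp add: l)
    also have "\<dots> = (\<Prod>i\<in>{1..k}. if \<beta> (Suc i) < \<alpha> i then 1 + x * t i else 1) * d (\<alpha> K) (\<beta> (Suc K))"
    proof -
      have "\<beta> (Suc K) \<le> \<alpha> K" using n l[of K] by (auto simp: hs_def)
      then show ?thesis by (simp add: K_def d_def y_def)
    qed
    finally have "(\<Prod>i\<in>{1..K}. if \<beta> (Suc i) < \<nu> i then 1 + x * t i else 1) =
       (\<Prod>i\<in>{1..k}. if \<beta> (Suc i) < \<alpha> i then 1 + x * t i else 1) * d (\<alpha> K) (\<beta> (Suc K))" .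
    moreover have "(\<Prod>i\<le>K. x ^ (\<beta> i - \<nu> i)) = (\<Prod>i\<le>K. x ^ (\<beta> i - \<alpha> i))"
      "(\<Prod>i\<le>K. y ^ (\<alpha> i - \<nu> i)) = 1"
      by (simp_all add: l)
    ultimately show "(\<Prod>i\<in>{1..K}. if \<beta> (Suc i) < \<nu> i then 1 + x * t i else 1) *
      (\<Prod>i\<le>L. x ^ (\<beta> i - \<nu> i)) * (\<Prod>i\<le>L. y ^ (\<alpha> i - \<nu> i)) =
      E * d (\<alpha> K) (\<beta> (Suc K)) * (\<Prod>i\<in>{K<..L}. y ^ (\<alpha> i - \<nu> i) * x ^ (\<beta> i - \<nu> i))"
      unfolding prod_split_rows[OF KL] by (simp add: E_def prod.distrib ac_simps)
  qed
  also have "\<dots> = (if C then E * (d (\<alpha> K) (\<beta> (Suc K)) * (\<Prod>i\<in>{K<..L}. Q i)) else 0)"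
  proof (cases "C \<and> \<beta> (Suc K) \<le> \<alpha> K")
    case True
    then have T: "(\<forall>i\<le>K. \<alpha> i \<le> \<beta> i) \<and> (\<forall>i<K. \<beta> (Suc i) \<le> \<alpha> i) \<and> \<beta> (Suc K) \<le> \<alpha> K" "C"
      by (auto simp: C_def)
    show ?thesis unfolding sum_distrib_left[symmetric] lower_set[OF a(1) b KL] Q_def if_P[OF T(1)] if_P[OF T(2)]
      using sum_prod_pointwise[of "{K<..L}" "\<lambda>i. {max (\<alpha> i - 1) (\<beta> (Suc i))..min (\<alpha> i) (\<beta> i)}"
        "\<lambda>i r. y ^ (\<alpha> i - r) * x ^ (\<beta> i - r)" \<alpha>]
      by (simp only: simp_thms mult.assoc finite_greaterThanAtMost finite_atLeastAtMost)
  next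
    case False
    then have "\<not> ((\<forall>i\<le>K. \<alpha> i \<le> \<beta> i) \<and> (\<forall>i<K. \<beta> (Suc i) \<le> \<alpha> i) \<and> \<beta> (Suc K) \<le> \<alpha> K)"
      by (auto simp: C_def)
    moreover have "(if C then E * (d (\<alpha> K) (\<beta> (Suc K)) * (\<Prod>i\<in>{K<..L}. Q i)) else 0) = 0"
      using False by (auto simp: d_def)
    ultimately show ?thesis
      unfolding sum_distrib_left[symmetric] lower_set[OF a(1) b KL] by (simp only: if_False sum.empty mult_zero_right)
  qed
  finally have rhs: "(\<Sum>\<nu>\<in>Par L. vstep (Suc k) (t (Suc k)) \<nu> \<alpha> * up_ex t (Suc k) x \<nu> \<beta>) =
    (if C then E * (d (\<alpha> K) (\<beta> (Suc K)) * (\<Prod>i\<in>{K<..L}. Q i)) else 0)" .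

  \<comment> \<open>By \<open>row_commutation\<close>, \<open>P i * d (\<alpha> i) (\<beta> (Suc i))
    = d (\<alpha> (i - 1)) (\<beta> i) * Q i\<close>.\<close>
  have tel: "(\<Prod>i\<in>{K<..m}. P i) * d (\<alpha> m) (\<beta> (Suc m)) = d (\<alpha> K) (\<beta> (Suc K)) * (\<Prod>i\<in>{K<..m}. Q i)"
    if "K \<le> m" for m using that
  proof (induction m rule: dec_induct)
    case (step m)
    have "P (Suc m) * d (\<alpha> (Suc m)) (\<beta> (Suc (Suc m))) = d (\<alpha> m) (\<beta> (Suc m)) * Q (Suc m)"
      using row_commutation[OF Par_Suc[OF b, of "Suc m"] Par_Suc[OF a(1), of m], of x y]
      unfolding P_def Q_def d_def by simp
    moreover have "{K<..Suc m} = insert (Suc m) {K<..m}" using step by auto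
    ultimately show ?case using step.IH
      by (simp) (metis (no_types, lifting) mult.assoc mult.commute)
  qed simp
  \<comment> \<open>If the strip started from a shape with boxes in row \<open>L\<close>, a factor
    \<open>1 + x * y\<close> would remain here.\<close>
  have "d (\<alpha> L) (\<beta> (Suc L)) = 1" using a(2) b by (simp add: d_def Par_out)
  then have "(\<Prod>i\<in>{K<..L}. P i) = d (\<alpha> K) (\<beta> (Suc K)) * (\<Prod>i\<in>{K<..L}. Q i)"
    using tel[OF KL] by simp
  then show ?thesis unfolding lhs rhs by simp
qed

end

section \<open>Operators on row sequences\<close>

lemma prod_if_zero:
  fixes f :: "'i \<Rightarrow> 'a::comm_semiring_1"
  shows "finite A \<Longrightarrow> (\<Prod>i\<in>A. if P i then f i else 0) = (if \<forall>i\<in>A. P i then \<Prod>i\<in>A. f i else 0)"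
  by (induction A rule: finite_induct) auto

text \<open>With \<open>S r = (- t) ^ (m - r) * x ^ (b - r)\<close> one has
  \<open>S (r - 1) = - t * x * S r\<close>. So a term with \<open>b' < r\<close> is
  \<open>S r - S (r - 1)\<close>, and the first term is \<open>S b'\<close>.\<close>

lemma telescoping_row:
  fixes x t :: "'a::comm_ring_1"
  assumes "b' \<le> k" "k \<le> m" "k \<le> b"
  shows "(\<Sum>r\<in>{b'..k}. (- t) ^ (m - r) * x ^ (b - r) * (if b' < r then 1 + x * t else 1)) =
    (- t) ^ (m - k) * x ^ (b - k)"
  using assms
proof (induction k rule: dec_induct)
  case (step k)
  have e: "m - k = Suc (m - Suc k)" "b - k = Suc (b - Suc k)" using step by auto
  have "{b'..Suc k} = insert (Suc k) {b'..k}" using step by auto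
  then have "(\<Sum>r\<in>{b'..Suc k}. (- t) ^ (m - r) * x ^ (b - r) * (if b' < r then 1 + x * t else 1)) =
      (- t) ^ (m - Suc k) * x ^ (b - Suc k) * (1 + x * t) + (- t) ^ (m - k) * x ^ (b - k)"
    using step by simp
  also have "\<dots> = (- t) ^ (m - Suc k) * x ^ (b - Suc k)"
    unfolding e by (simp add: algebra_simps)
  finally show ?case .
qed simp

text \<open>The contribution of one row to \<open>straighten\<close>: \<open>m\<close>,
  \<open>a\<close>, \<open>b\<close> are the ends of the row in \<open>\<mu>\<close>,
  \<open>\<alpha>\<close>, \<open>\<beta>\<close>, and \<open>m'\<close>, \<open>b'\<close> those of
  the next row. If \<open>m < a\<close>, the intermediate row must end at \<open>a\<close> and keeps
  its corner factor. If \<open>a = m\<close>, it may end anywhere inside \<open>\<mu>\<close>, and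
  the sum telescopes to a term without corner factor.\<close>

lemma row_straightening:
  fixes x t :: "'a::comm_ring_1"
  assumes "b' \<le> b" "m' \<le> m" "m \<le> a"
  shows "(\<Sum>r\<in>{r. max r m = a \<and> b' \<le> r \<and> r \<le> b}.
      (- t) ^ (m - r) * x ^ (b - r) * (if b' < r then 1 + x * t else 1)) =
    (if a \<le> max b m \<and> max b' m' \<le> a
     then x ^ (max b m - a) * (if max b' m' < a \<and> m < a then 1 + x * t else 1) else 0) *
    (- t) ^ (m - b)"
proof (cases "m < a")
  case True
  then have "{r. max r m = a \<and> b' \<le> r \<and> r \<le> b} = (if b' \<le> a \<and> a \<le> b then {a} else {})"
    by (auto simp: max_def)
  then show ?thesis using True assms by (auto simp: max_def)
next
  case False
  then have [simp]: "a = m" using assms by simp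
  have s: "{r. max r m = a \<and> b' \<le> r \<and> r \<le> b} = {b'..min m b}" by (auto simp: max_def)
  show ?thesis
  proof (cases "b' \<le> m")
    case True
    then show ?thesis unfolding s using telescoping_row[of b' "min m b" m b t x] assms
      by (auto simp: max_def min_def)
  next
    case False
    then show ?thesis unfolding s by (auto simp: max_def)
  qed
qed

lemma sum_sum_assoc:
  fixes A :: "rows \<Rightarrow> 'a::comm_ring_1"
  shows "(\<Sum>i\<in>X. A i * (\<Sum>j\<in>Y. B i j * F j)) = (\<Sum>j\<in>Y. (\<Sum>i\<in>X. A i * B i j) * F j)"
proof -
  have "(\<Sum>i\<in>X. A i * (\<Sum>j\<in>Y. B i j * F j)) = (\<Sum>i\<in>X. \<Sum>j\<in>Y. A i * B i j * F j)"
    by (simp add: sum_distrib_left mult.assoc)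
  also have "\<dots> = (\<Sum>j\<in>Y. (\<Sum>i\<in>X. A i * B i j) * F j)"
    by (subst sum.swap) (simp add: sum_distrib_right)
  finally show ?thesis .
qed

lemma hs_imp_le: "hs \<alpha> \<beta> \<Longrightarrow> \<alpha> \<le> \<beta>" and vs_imp_le: "vs \<alpha> \<beta> \<Longrightarrow> \<alpha> \<le> \<beta>"
  by (auto simp: hs_def vs_def le_fun_def)

context frame
begin

text \<open>The first index of a matrix is the smaller shape. \<open>act\<close> sums over the
  larger shape and thus adds boxes; the transposed action \<open>dact\<close> removes them.\<close>

definition act :: "(rows \<Rightarrow> rows \<Rightarrow> 'a::comm_ring_1) \<Rightarrow> (rows \<Rightarrow> 'a) \<Rightarrow> rows \<Rightarrow> 'a" where
  "act M F \<alpha> = (\<Sum>\<beta>\<in>Par L. M \<alpha> \<beta> * F \<beta>)"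

definition dact :: "(rows \<Rightarrow> rows \<Rightarrow> 'a::comm_ring_1) \<Rightarrow> (rows \<Rightarrow> 'a) \<Rightarrow> rows \<Rightarrow> 'a" where
  "dact M F \<beta> = (\<Sum>\<alpha>\<in>Par L. M \<alpha> \<beta> * F \<alpha>)"

primrec chain :: "(nat \<Rightarrow> rows \<Rightarrow> rows \<Rightarrow> 'a::comm_ring_1) \<Rightarrow> nat \<Rightarrow> (rows \<Rightarrow> 'a) \<Rightarrow> rows \<Rightarrow> 'a" where
  "chain M 0 F = F"
| "chain M (Suc n) F = chain M n (act (M (Suc n)) F)"

primrec dchain :: "(nat \<Rightarrow> rows \<Rightarrow> rows \<Rightarrow> 'a::comm_ring_1) \<Rightarrow> nat \<Rightarrow> (rows \<Rightarrow> 'a) \<Rightarrow> rows \<Rightarrow> 'a" where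
  "dchain M 0 F = F"
| "dchain M (Suc n) F = dact (M (Suc n)) (dchain M n F)"

text \<open>\<open>vchain\<close> is \<open>V_1 ... V_n\<close> and \<open>dchain\<close> is
  \<open>H_n ... H_1\<close>. They grow at opposite ends, so one more step encloses
  \<open>H_n ... H_1 V_1 ... V_n\<close> between \<open>H_(n+1)\<close> and \<open>V_(n+1)\<close>,
  the form needed for induction.\<close>

primrec vchain :: "(nat \<Rightarrow> rows \<Rightarrow> rows \<Rightarrow> 'a::comm_ring_1) \<Rightarrow> nat \<Rightarrow> (rows \<Rightarrow> 'a) \<Rightarrow> rows \<Rightarrow> 'a" where
  "vchain M 0 F = F"
| "vchain M (Suc n) F = vchain M n (dact (M (Suc n)) F)"

lemma sum_single:
  fixes f :: "rows \<Rightarrow> 'a::comm_ring_1"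
  assumes "a \<in> Par l" "\<And>b. b \<in> Par l \<Longrightarrow> b \<noteq> a \<Longrightarrow> f b = 0"
  shows "(\<Sum>b\<in>Par l. f b) = f a"
  using sum.mono_neutral_right[of "Par l" "{a}" f] assms by auto

text \<open>Removing boxes does not lead out of \<open>Par l\<close>: below \<open>\<alpha>\<close>
  the rows beyond \<open>l\<close> are squeezed to \<open>p\<close>.\<close>

lemma dact_cong:
  assumes "\<alpha> \<in> Par l" "\<And>\<nu>. \<not> \<nu> \<le> \<alpha> \<Longrightarrow> M \<nu> \<alpha> = 0" "\<And>\<nu>. \<nu> \<in> Par l \<Longrightarrow> F \<nu> = F' \<nu>"
  shows "dact M F \<alpha> = dact M F' \<alpha>"
  unfolding dact_def
proof (intro sum.cong refl)
  fix \<nu> assume n: "\<nu> \<in> Par L"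
  show "M \<nu> \<alpha> * F \<nu> = M \<nu> \<alpha> * F' \<nu>"
  proof (cases "\<nu> \<le> \<alpha>")
    case True
    then have "\<nu> i = p" if "l < i" for i
      using that Par_out[OF assms(1)] Par_ge[OF n, of i] le_funD[OF True, of i] by force
    then have "\<nu> \<in> Par l" using n by (auto simp: Par_def)
    then show ?thesis using assms by simp
  qed (use assms in simp)
qed

lemma vchain_cong:
  assumes "\<And>k \<alpha> \<nu>. \<not> \<nu> \<le> \<alpha> \<Longrightarrow> M k \<nu> \<alpha> = 0"
  shows "\<alpha> \<in> Par l \<Longrightarrow> (\<And>\<nu>. \<nu> \<in> Par l \<Longrightarrow> F \<nu> = F' \<nu>) \<Longrightarrow> vchain M n F \<alpha> = vchain M n F' \<alpha>"
proof (induction n arbitrary: F F' \<alpha>)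
  case (Suc n)
  have e: "dact (M (Suc n)) F \<nu> = dact (M (Suc n)) F' \<nu>" if "\<nu> \<in> Par l" for \<nu>
    using that assms Suc.prems(2) by (rule dact_cong)
  show ?case unfolding vchain.simps by (rule Suc.IH[OF Suc.prems(1) e])
qed simp

text \<open>A horizontal strip opens at most one new row, since each row of the larger shape is
  bounded by the preceding row of the smaller one.\<close>

lemma hs_Par: "hs \<alpha> \<beta> \<Longrightarrow> \<alpha> \<in> Par l \<Longrightarrow> \<beta> \<in> Par L \<Longrightarrow> \<beta> \<in> Par (Suc l)"
proof -
  assume h: "hs \<alpha> \<beta>" and a: "\<alpha> \<in> Par l" and b: "\<beta> \<in> Par L"
  have "\<beta> i = p" if "Suc l < i" for i
  proof -
    obtain j where "i = Suc j" "l < j" using \<open>Suc l < i\<close> by (cases i) auto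
    then have "\<beta> i \<le> p" using h Par_out[OF a, of j] by (auto simp: hs_def dest!: spec[of _ j])
    then show ?thesis using Par_ge[OF b, of i] by simp
  qed
  then show ?thesis using b by (auto simp: Par_def)
qed

text \<open>After \<open>n\<close> strips only shapes in \<open>Par (l + n)\<close> are reached.
  This is what makes identities usable inside a chain when they require an empty last row of the
  frame.\<close>

lemma chain_cong:
  assumes M: "\<And>k \<alpha> \<beta>. \<not> hs \<alpha> \<beta> \<Longrightarrow> M k \<alpha> \<beta> = 0" and a: "\<alpha> \<in> Par l"
  shows "(\<And>\<beta>. \<beta> \<in> Par (l + n) \<Longrightarrow> F \<beta> = F' \<beta>) \<Longrightarrow> chain M n F \<alpha> = chain M n F' \<alpha>"
proof (induction n arbitrary: F F')
  case 0
  then show ?case using a by simp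
next
  case (Suc n)
  have e: "act (M (Suc n)) F \<beta> = act (M (Suc n)) F' \<beta>" if b: "\<beta> \<in> Par (l + n)" for \<beta>
    unfolding act_def
  proof (intro sum.cong refl)
    fix \<gamma> assume "\<gamma> \<in> Par L"
    then show "M (Suc n) \<beta> \<gamma> * F \<gamma> = M (Suc n) \<beta> \<gamma> * F' \<gamma>"
      using hs_Par[OF _ b, of \<gamma>] Suc.prems[of \<gamma>] M[of \<beta> \<gamma> "Suc n"]
      by (cases "hs \<beta> \<gamma>") auto
  qed
  show ?case unfolding chain.simps by (rule Suc.IH[OF e])
qed

section \<open>Commutation of whole chains of strips\<close>

lemma exchange_act:
  assumes "\<alpha> \<in> Par L" "\<alpha> L = p" "Suc k \<le> L"
  shows "act (up_ex t k x) (dact (vstep (Suc k) (t (Suc k))) F) \<alpha> =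
    dact (vstep (Suc k) (t (Suc k))) (act (up_ex t (Suc k) x) F) \<alpha>"
  unfolding act_def dact_def sum_sum_assoc
  by (intro sum.cong refl) (simp add: exchange[OF assms(1,2) _ assms(3)])

lemma up_ex_eq_0: "\<not> hs \<alpha> \<beta> \<Longrightarrow> up_ex t k x \<alpha> \<beta> = 0"
  by (simp add: up_ex_def up_def)

lemma exchange_chain:
  assumes a: "\<alpha> \<in> Par l" and k: "Suc k \<le> L"
  shows "l + n \<le> L \<Longrightarrow> chain (\<lambda>j. up_ex t k (x j)) n (dact (vstep (Suc k) (t (Suc k))) F) \<alpha> =
    dact (vstep (Suc k) (t (Suc k))) (chain (\<lambda>j. up_ex t (Suc k) (x j)) n F) \<alpha>"
proof (induction n arbitrary: F)
  case (Suc n)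
  have "chain (\<lambda>j. up_ex t k (x j)) (Suc n) (dact (vstep (Suc k) (t (Suc k))) F) \<alpha> =
    chain (\<lambda>j. up_ex t k (x j)) n (dact (vstep (Suc k) (t (Suc k))) (act (up_ex t (Suc k) (x (Suc n))) F)) \<alpha>"
    unfolding chain.simps
  proof (rule chain_cong[OF up_ex_eq_0 a])
    \<comment> \<open>Of the \<open>Suc n\<close> strips only \<open>n\<close> have been added
      before this one, so \<open>l + n < L\<close>, and row \<open>L\<close> of
      \<open>\<beta>\<close> still ends at \<open>p\<close>.\<close>
    fix \<beta> assume b: "\<beta> \<in> Par (l + n)"
    then have "\<beta> \<in> Par L" "\<beta> L = p" using Suc.prems Par_mono[of "l + n" L] by (auto simp: Par_out)
    then show "act (up_ex t k (x (Suc n))) (dact (vstep (Suc k) (t (Suc k))) F) \<beta> =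
       dact (vstep (Suc k) (t (Suc k))) (act (up_ex t (Suc k) (x (Suc n))) F) \<beta>"
      using k by (rule exchange_act)
  qed
  also have "\<dots> = dact (vstep (Suc k) (t (Suc k))) (chain (\<lambda>j. up_ex t (Suc k) (x j)) (Suc n) F) \<alpha>"
    using Suc by simp
  finally show ?case .
qed simp

lemma vstep_eq_0: "\<not> \<nu> \<le> \<alpha> \<Longrightarrow> vstep k y \<nu> \<alpha> = 0"
  using vs_imp_le by (auto simp: vstep_def)

lemma hstep_eq_0: "\<not> \<nu> \<le> \<alpha> \<Longrightarrow> hstep k y \<nu> \<alpha> = 0"
  using hs_imp_le by (auto simp: hstep_def)

text \<open>The strips meet \<open>V_1\<close> first, which turns \<open>U = G_0\<close> into
  \<open>G_1\<close>; these meet \<open>V_2\<close>, and so on. The order of the factors in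
  \<open>vchain\<close> is the one in which the corner factors can be collected.\<close>

lemma exchange_vchain:
  assumes a: "\<alpha> \<in> Par l" and l: "l + n \<le> L"
  shows "k \<le> L \<Longrightarrow> chain (\<lambda>j. up (x j)) n (vchain (\<lambda>i. vstep i (t i)) k F) \<alpha> =
    vchain (\<lambda>i. vstep i (t i)) k (chain (\<lambda>j. up_ex t k (x j)) n F) \<alpha>"
proof (induction k arbitrary: F)
  case 0
  have "up_ex t 0 y = up y" for y :: 'a by (simp add: up_ex_def fun_eq_iff)
  then show ?case by simp
next
  case (Suc k)
  show ?case
    using Suc.prems l vchain_cong[OF vstep_eq_0 a exchange_chain]
    by (simp add: Suc.IH)
qed

section \<open>Signed removal of boxes from the first rows\<close>

definition ymat :: "(nat \<Rightarrow> 'a::comm_ring_1) \<Rightarrow> nat \<Rightarrow> rows \<Rightarrow> rows \<Rightarrow> 'a" where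
  "ymat t k \<rho> \<mu> = (if \<forall>i. if i \<in> {1..k} then \<rho> i \<le> \<mu> i else \<rho> i = \<mu> i
     then \<Prod>i\<in>{1..k}. (- t i) ^ (\<mu> i - \<rho> i) else 0)"

text \<open>The intermediate shape is unique: \<open>vstep\<close> preserves the rows up to
  \<open>Suc k\<close> and \<open>ymat\<close> the rows beyond \<open>k\<close>. Row
  \<open>Suc k\<close> is moved by neither.\<close>

lemma ymat_vstep:
  fixes y :: "'a::comm_ring_1"
  assumes n: "\<nu> \<in> Par L" and r: "\<rho> \<in> Par L" and K: "Suc k \<le> L"
  shows "(\<Sum>\<tau>\<in>Par L. ymat t k \<tau> \<nu> * vstep (Suc k) y \<rho> \<tau>) =
    (if (\<forall>i\<in>{1..k}. \<rho> i \<le> \<nu> i) \<and> \<rho> (Suc k) = \<nu> (Suc k) \<and> (\<forall>i\<in>{Suc k<..L}. \<rho> i \<le> \<nu> i \<and> \<nu> i \<le> Suc (\<rho> i))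
     then (\<Prod>i\<in>{1..k}. (- t i) ^ (\<nu> i - \<rho> i)) * (\<Prod>i\<in>{Suc k<..L}. y ^ (\<nu> i - \<rho> i)) else 0)"
    (is "_ = (if ?C then _ else 0)")
proof -
  define \<tau>0 where "\<tau>0 = (\<lambda>i. if i \<le> Suc k then \<rho> i else \<nu> i)"
  have uniq: "\<tau> = \<tau>0 \<and> ?C" if t: "ymat t k \<tau> \<nu> * vstep (Suc k) y \<rho> \<tau> \<noteq> 0" for \<tau>
  proof -
    have y: "\<And>i. if i \<in> {1..k} then \<tau> i \<le> \<nu> i else \<tau> i = \<nu> i"
      and v: "vs \<rho> \<tau>" "\<And>i. i \<le> Suc k \<Longrightarrow> \<tau> i = \<rho> i"
      using t by (auto simp: ymat_def vstep_def split: if_splits)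
    have e: "\<tau> i = \<nu> i" if "Suc k \<le> i" for i using y[of i] that by auto
    have "\<rho> i \<le> \<nu> i" if "i \<in> {1..k}" for i using y[of i] v(2)[of i] that by auto
    moreover have "\<rho> i \<le> \<nu> i \<and> \<nu> i \<le> Suc (\<rho> i)" if "i \<in> {Suc k<..L}" for i
      using v(1) e[of i] that by (auto simp: vs_def dest!: spec[of _ i])
    moreover have "\<rho> (Suc k) = \<nu> (Suc k)" using v(2)[of "Suc k"] e[of "Suc k"] by simp
    moreover have "\<tau> = \<tau>0" using v(2) e by (auto simp: \<tau>0_def fun_eq_iff)
    ultimately show ?thesis by blast
  qed
  show ?thesis
  proof (cases ?C)
    case True
    \<comment> \<open>\<open>\<tau>0\<close> decreases across the seam because \<open>\<rho>\<close>
      and \<open>\<nu>\<close> agree in row \<open>Suc k\<close>.\<close>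
    have P: "\<tau>0 \<in> Par L"
      unfolding Par_def \<tau>0_def using Par_Suc[OF n] Par_Suc[OF r] Par_0[OF r] K Par_out[OF n]
        True Par_Suc[OF n, of "Suc k"] by (auto simp: not_less_eq_eq le_Suc_eq)
    have "(\<Sum>\<tau>\<in>Par L. ymat t k \<tau> \<nu> * vstep (Suc k) y \<rho> \<tau>) = ymat t k \<tau>0 \<nu> * vstep (Suc k) y \<rho> \<tau>0"
      using P uniq by (intro sum_single) blast+
    also have "ymat t k \<tau>0 \<nu> = (\<Prod>i\<in>{1..k}. (- t i) ^ (\<nu> i - \<rho> i))"
    proof -
      have "if i \<in> {1..k} then \<tau>0 i \<le> \<nu> i else \<tau>0 i = \<nu> i" for i
        using True Par_0[OF n] Par_0[OF r] by (auto simp: \<tau>0_def le_Suc_eq not_less_eq_eq)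
      then have c: "\<forall>i. if i \<in> {1..k} then \<tau>0 i \<le> \<nu> i else \<tau>0 i = \<nu> i" ..
      have "(\<Prod>i\<in>{1..k}. (- t i) ^ (\<nu> i - \<tau>0 i)) = (\<Prod>i\<in>{1..k}. (- t i) ^ (\<nu> i - \<rho> i))"
        by (intro prod.cong) (auto simp: \<tau>0_def)
      then show ?thesis unfolding ymat_def if_P[OF c] .
    qed
    also have "vstep (Suc k) y \<rho> \<tau>0 = (\<Prod>i\<in>{Suc k<..L}. y ^ (\<nu> i - \<rho> i))"
    proof -
      have "\<rho> i \<le> \<tau>0 i \<and> \<tau>0 i \<le> Suc (\<rho> i)" for i
        using True Par_out[OF n, of i] Par_out[OF r, of i] by (cases "i \<le> L") (auto simp: \<tau>0_def)
      then have "vs \<rho> \<tau>0" by (simp add: vs_def)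
      moreover have "(\<Prod>i\<le>L. y ^ (\<tau>0 i - \<rho> i)) = (\<Prod>i\<in>{Suc k<..L}. y ^ (\<nu> i - \<rho> i))"
        unfolding prod_split_rows[OF K] by (simp add: \<tau>0_def)
      ultimately show ?thesis by (simp add: vstep_def \<tau>0_def)
    qed
    finally show ?thesis unfolding if_P[OF True] .
  next
    case False
    then show ?thesis unfolding if_not_P[OF False] using uniq by (intro sum.neutral) blast
  qed
qed

text \<open>The skew-shape form of \<open>H(- y) E(y) = 1\<close> for the complete and elementary
  generating functions. In the lowest row where \<open>\<rho>\<close> and \<open>\<mu>\<close>
  differ, the row below agrees; so if \<open>\<rho> i < \<mu> i\<close>, exactly
  \<open>r = \<rho> i\<close> and \<open>r = Suc (\<rho> i)\<close> occur, with opposite terms, and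
  if \<open>\<mu> i < \<rho> i\<close>, nothing occurs.\<close>

lemma cancel_rows:
  fixes y :: "'a::comm_ring_1"
  assumes m: "\<mu> \<in> Par L" and r: "\<rho> \<in> Par L"
  shows "(\<Prod>i\<in>{K<..L}. \<Sum>r\<in>{max (\<mu> (Suc i)) (\<rho> i)..min (\<mu> i) (Suc (\<rho> i))}.
      (- y) ^ (\<mu> i - r) * y ^ (r - \<rho> i)) = (if \<forall>i\<in>{K<..L}. \<rho> i = \<mu> i then 1 else 0)"
    (is "(\<Prod>i\<in>_. ?Q i) = _")
proof (cases "\<forall>i\<in>{K<..L}. \<rho> i = \<mu> i")
  case True
  have "?Q i = 1" if i: "i \<in> {K<..L}" for i
  proof -
    have "{max (\<mu> (Suc i)) (\<rho> i)..min (\<mu> i) (Suc (\<rho> i))} = {\<mu> i}"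
      using True i Par_Suc[OF m, of i] by auto
    then show ?thesis using True i by simp
  qed
  then show ?thesis using True by simp
next
  case False
  define i where "i = Max {i \<in> {K<..L}. \<rho> i \<noteq> \<mu> i}"
  have "i \<in> {i \<in> {K<..L}. \<rho> i \<noteq> \<mu> i}" unfolding i_def using False by (intro Max_in) auto
  then have i: "i \<in> {K<..L}" "\<rho> i \<noteq> \<mu> i" by auto
  have up: "\<rho> j = \<mu> j" if j: "i < j" for j
  proof (rule ccontr)
    assume "\<rho> j \<noteq> \<mu> j"
    moreover from this have "j \<le> L" using Par_out[OF m, of j] Par_out[OF r, of j] by (cases "j \<le> L") auto
    ultimately have "j \<le> i" unfolding i_def using j i(1) by (intro Max_ge) (auto simp: i_def)
    then show False using j by simp
  qed
  have "?Q i = 0"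
  proof (cases "\<rho> i < \<mu> i")
    case True
    have "{max (\<mu> (Suc i)) (\<rho> i)..min (\<mu> i) (Suc (\<rho> i))} = {\<rho> i, Suc (\<rho> i)}"
      using True Par_Suc[OF r, of i] up[of "Suc i"] by auto
    moreover have "\<mu> i - \<rho> i = Suc (\<mu> i - Suc (\<rho> i))" using True by auto
    ultimately show ?thesis by simp
  qed (use i in auto)
  then show ?thesis using i False by (auto simp: prod_zero_iff intro!: prod_zero)
qed

lemma middle_set:
  assumes m: "\<mu> \<in> Par L" and r: "\<rho> \<in> Par L" and K: "Suc k \<le> L"
  shows "{\<nu> \<in> Par L. (hs \<nu> \<mu> \<and> (\<forall>i<Suc k. \<mu> i = \<nu> i)) \<and> (\<forall>i\<in>{1..k}. \<rho> i \<le> \<nu> i) \<and>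
      \<rho> (Suc k) = \<nu> (Suc k) \<and> (\<forall>i\<in>{Suc k<..L}. \<rho> i \<le> \<nu> i \<and> \<nu> i \<le> Suc (\<rho> i))} =
    (if (\<forall>i\<in>{1..k}. \<rho> i \<le> \<mu> i) \<and> \<mu> (Suc (Suc k)) \<le> \<rho> (Suc k) \<and> \<rho> (Suc k) \<le> \<mu> (Suc k)
     then {\<nu>. \<forall>i. if i \<in> {Suc k<..L} then \<nu> i \<in> {max (\<mu> (Suc i)) (\<rho> i)..min (\<mu> i) (Suc (\<rho> i))}
       else \<nu> i = (if i = Suc k then \<rho> i else \<mu> i)} else {})" (is "?L = (if ?C then ?R else {})")
proof (cases ?C)
  case True
  have "\<nu> \<in> ?R" if n: "\<nu> \<in> ?L" for \<nu>
  proof -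
    have n1: "\<nu> \<in> Par L" "hs \<nu> \<mu>" "\<nu> (Suc k) = \<rho> (Suc k)"
      and n2: "\<And>i. i < Suc k \<Longrightarrow> \<nu> i = \<mu> i"
      and n3: "\<And>i. i \<in> {Suc k<..L} \<Longrightarrow> \<rho> i \<le> \<nu> i \<and> \<nu> i \<le> Suc (\<rho> i)"
      using n by simp_all
    have "\<nu> i = (if i = Suc k then \<rho> i else \<mu> i)" if i: "i \<notin> {Suc k<..L}" for i
    proof -
      consider "i < Suc k" | "i = Suc k" | "Suc k < i" "L < i"
        using i by (metis greaterThanAtMost_iff linorder_neqE_nat not_le)
      then show ?thesis using n1 n2[of i] Par_out[OF m, of i] Par_out[OF n1(1), of i] by cases auto
    qed
    moreover have "\<nu> i \<in> {max (\<mu> (Suc i)) (\<rho> i)..min (\<mu> i) (Suc (\<rho> i))}" if "i \<in> {Suc k<..L}" for i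
      using n3[OF that] n1(2) by (simp add: hs_def)
    ultimately show ?thesis by auto
  qed
  moreover have "\<nu> \<in> ?L" if n: "\<nu> \<in> ?R" for \<nu>
  proof -
    have l1: "\<mu> (Suc i) \<le> \<nu> i" "\<rho> i \<le> \<nu> i" "\<nu> i \<le> \<mu> i" "\<nu> i \<le> Suc (\<rho> i)" if "i \<in> {Suc k<..L}" for i
      using n that by (auto dest!: spec[of _ i])
    have l2: "\<nu> i = (if i = Suc k then \<rho> i else \<mu> i)" if "i \<notin> {Suc k<..L}" for i
      using n that by (auto dest!: spec[of _ i])
    have A: "\<nu> i \<le> \<mu> i" "\<mu> (Suc i) \<le> \<nu> i" for i
      using l1(1,3)[of i] l2[of i] True Par_Suc[OF m, of i] by (cases "i \<in> {Suc k<..L}"; cases "i = Suc k"; simp)+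
    then have "hs \<nu> \<mu>" by (simp add: hs_def)
    moreover have "\<nu> \<in> Par L"
      using l2[of 0] Par_0[OF m] le_trans[OF A] l2 Par_out[OF m] K by (auto simp: Par_def)
    moreover have "\<mu> i = \<nu> i" if "i < Suc k" for i using l2[of i] that by simp
    moreover have "\<rho> (Suc k) = \<nu> (Suc k)" using l2[of "Suc k"] by simp
    moreover have "\<rho> i \<le> \<nu> i" if "i \<in> {1..k}" for i using l2[of i] that True by simp
    ultimately show ?thesis using l1(2,4) by simp
  qed
  ultimately have "?L = ?R" by blast
  then show ?thesis unfolding if_P[OF True] .
next
  case False
  have "?C" if n: "\<nu> \<in> ?L" for \<nu>
  proof -
    have n1: "hs \<nu> \<mu>" "\<rho> (Suc k) = \<nu> (Suc k)"
      and n2: "\<And>i. i \<in> {1..k} \<Longrightarrow> \<rho> i \<le> \<nu> i"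
      using n by simp_all
    have h: "\<nu> i \<le> \<mu> i \<and> \<mu> (Suc i) \<le> \<nu> i" for i using n1(1) by (simp add: hs_def)
    show ?thesis using h[of "Suc k"] n1(2) h n2 by (metis le_trans)
  qed
  then have "?L = {}" using False by blast
  then show ?thesis unfolding if_not_P[OF False] .
qed

text \<open>Rows up to \<open>k\<close> are shortened by \<open>ymat t k\<close> alone. Row
  \<open>Suc k\<close> is shortened by \<open>hstep\<close> alone, which supplies its weight
  \<open>- t (Suc k)\<close> per box. In the rows below, \<open>hstep\<close> and
  \<open>vstep\<close> carry opposite weights and cancel by \<open>cancel_rows\<close>.\<close>

lemma ymat_Suc:
  assumes m: "\<mu> \<in> Par L" and r: "\<rho> \<in> Par L" and K: "Suc k \<le> L"
  shows "(\<Sum>\<nu>\<in>Par L. hstep (Suc k) (- t (Suc k)) \<nu> \<mu> *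
      (\<Sum>\<tau>\<in>Par L. ymat t k \<tau> \<nu> * vstep (Suc k) (t (Suc k)) \<rho> \<tau>)) = ymat t (Suc k) \<rho> \<mu>"
proof -
  define y where "y = t (Suc k)"
  define A where "A = (\<Prod>i\<in>{1..Suc k}. (- t i) ^ (\<mu> i - \<rho> i))"
  define Q where "Q = (\<lambda>i. \<Sum>r\<in>{max (\<mu> (Suc i)) (\<rho> i)..min (\<mu> i) (Suc (\<rho> i))}. (- y) ^ (\<mu> i - r) * y ^ (r - \<rho> i))"
  define C where "C \<longleftrightarrow> (\<forall>i\<in>{1..k}. \<rho> i \<le> \<mu> i) \<and> \<mu> (Suc (Suc k)) \<le> \<rho> (Suc k) \<and> \<rho> (Suc k) \<le> \<mu> (Suc k)"
  define S where "S = {\<nu> \<in> Par L. (hs \<nu> \<mu> \<and> (\<forall>i<Suc k. \<mu> i = \<nu> i)) \<and> (\<forall>i\<in>{1..k}. \<rho> i \<le> \<nu> i) \<and>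
      \<rho> (Suc k) = \<nu> (Suc k) \<and> (\<forall>i\<in>{Suc k<..L}. \<rho> i \<le> \<nu> i \<and> \<nu> i \<le> Suc (\<rho> i))}"
  have "(\<Sum>\<nu>\<in>Par L. hstep (Suc k) (- t (Suc k)) \<nu> \<mu> *
      (\<Sum>\<tau>\<in>Par L. ymat t k \<tau> \<nu> * vstep (Suc k) (t (Suc k)) \<rho> \<tau>)) =
    (\<Sum>\<nu>\<in>Par L. if (hs \<nu> \<mu> \<and> (\<forall>i<Suc k. \<mu> i = \<nu> i)) \<and> (\<forall>i\<in>{1..k}. \<rho> i \<le> \<nu> i) \<and>
      \<rho> (Suc k) = \<nu> (Suc k) \<and> (\<forall>i\<in>{Suc k<..L}. \<rho> i \<le> \<nu> i \<and> \<nu> i \<le> Suc (\<rho> i)) then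
      (\<Prod>i\<le>L. (- y) ^ (\<mu> i - \<nu> i)) * ((\<Prod>i\<in>{1..k}. (- t i) ^ (\<nu> i - \<rho> i)) * (\<Prod>i\<in>{Suc k<..L}. y ^ (\<nu> i - \<rho> i))) else 0)"
  proof (intro sum.cong refl, goal_cases)
    case (1 \<nu>)
    show ?case unfolding ymat_vstep[OF 1 r K] hstep_def y_def if_distrib[of "\<lambda>z. _ * z"]
      by (simp only: if_distrib[of "\<lambda>z. z * _"] mult_zero_left mult_zero_right) (simp only: if_distrib if_cancel split: if_split, blast)
  qed
  also have "\<dots> = (\<Sum>\<nu>\<in>S. (\<Prod>i\<le>L. (- y) ^ (\<mu> i - \<nu> i)) *
      ((\<Prod>i\<in>{1..k}. (- t i) ^ (\<nu> i - \<rho> i)) * (\<Prod>i\<in>{Suc k<..L}. y ^ (\<nu> i - \<rho> i))))"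
    unfolding S_def by (rule sum_if_filter) simp
  also have "\<dots> = (\<Sum>\<nu>\<in>S. A * (\<Prod>i\<in>{Suc k<..L}. (- y) ^ (\<mu> i - \<nu> i) * y ^ (\<nu> i - \<rho> i)))"
  proof (intro sum.cong refl)
    fix \<nu> assume n: "\<nu> \<in> S"
    then have n: "\<nu> i = \<mu> i" if "i \<le> k" for i using that by (auto simp: S_def)
    have n2: "\<nu> (Suc k) = \<rho> (Suc k)" using \<open>\<nu> \<in> S\<close> by (auto simp: S_def)
    have "(\<Prod>i\<le>Suc k. (- y) ^ (\<mu> i - \<nu> i)) = (- y) ^ (\<mu> (Suc k) - \<rho> (Suc k))"
      by (simp add: n n2)
    moreover have "(\<Prod>i\<in>{1..k}. (- t i) ^ (\<nu> i - \<rho> i)) = (\<Prod>i\<in>{1..k}. (- t i) ^ (\<mu> i - \<rho> i))"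
      by (intro prod.cong) (auto simp: n)
    ultimately show "(\<Prod>i\<le>L. (- y) ^ (\<mu> i - \<nu> i)) *
      ((\<Prod>i\<in>{1..k}. (- t i) ^ (\<nu> i - \<rho> i)) * (\<Prod>i\<in>{Suc k<..L}. y ^ (\<nu> i - \<rho> i))) =
      A * (\<Prod>i\<in>{Suc k<..L}. (- y) ^ (\<mu> i - \<nu> i) * y ^ (\<nu> i - \<rho> i))"
      unfolding prod_split_rows[OF K] by (simp add: A_def y_def prod.distrib ac_simps)
  qed
  also have "\<dots> = (if C then A * (\<Prod>i\<in>{Suc k<..L}. Q i) else 0)"
    unfolding sum_distrib_left[symmetric] S_def middle_set[OF m r K] C_def[symmetric] Q_def
    using sum_prod_pointwise[of "{Suc k<..L}" "\<lambda>i. {max (\<mu> (Suc i)) (\<rho> i)..min (\<mu> i) (Suc (\<rho> i))}"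
        "\<lambda>i r. (- y) ^ (\<mu> i - r) * y ^ (r - \<rho> i)" "\<lambda>i. if i = Suc k then \<rho> i else \<mu> i"]
    by (cases C) (simp_all only: if_True if_False sum.empty mult_zero_right
       finite_greaterThanAtMost finite_atLeastAtMost simp_thms)
  also have "\<dots> = (if C \<and> (\<forall>i\<in>{Suc k<..L}. \<rho> i = \<mu> i) then A else 0)"
    unfolding Q_def cancel_rows[OF m r] by simp
  also have "C \<and> (\<forall>i\<in>{Suc k<..L}. \<rho> i = \<mu> i) \<longleftrightarrow>
      (\<forall>i. if i \<in> {1..Suc k} then \<rho> i \<le> \<mu> i else \<rho> i = \<mu> i)" (is "?l \<longleftrightarrow> ?r")
  proof
    assume l: ?l
    have "if i \<in> {1..Suc k} then \<rho> i \<le> \<mu> i else \<rho> i = \<mu> i" for i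
    proof -
      consider "i = 0" | "i \<in> {1..k}" | "i = Suc k" | "i \<in> {Suc k<..L}" | "L < i" by force
      then show ?thesis
        using l Par_0[OF m] Par_0[OF r] Par_out[OF m, of i] Par_out[OF r, of i] K
        by cases (auto simp: C_def)
    qed
    then show ?r by blast
  next
    assume r': ?r
    \<comment> \<open>The interlacing demanded by \<open>C\<close> in row \<open>Suc k\<close>
      follows from monotonicity of \<open>\<rho>\<close>, since row \<open>Suc (Suc k)\<close> is
      unchanged.\<close>
    have "\<rho> (Suc (Suc k)) = \<mu> (Suc (Suc k))" using r'[rule_format, of "Suc (Suc k)"] by simp
    then have "\<mu> (Suc (Suc k)) \<le> \<rho> (Suc k)" using Par_Suc[OF r, of "Suc k"] by simp
    moreover have "\<rho> i \<le> \<mu> i" if "i \<in> {1..Suc k}" for i using r'[rule_format, of i] that by simp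
    moreover have "\<rho> i = \<mu> i" if "i \<in> {Suc k<..L}" for i using r'[rule_format, of i] that by simp
    ultimately show ?l by (auto simp: C_def)
  qed
  also have "(if \<forall>i. if i \<in> {1..Suc k} then \<rho> i \<le> \<mu> i else \<rho> i = \<mu> i then A else 0) = ymat t (Suc k) \<rho> \<mu>"
    unfolding ymat_def A_def ..
  finally show ?thesis .
qed

lemma dact_ymat_Suc:
  assumes m: "\<mu> \<in> Par L" and K: "Suc k \<le> L"
  shows "dact (hstep (Suc k) (- t (Suc k))) (dact (ymat t k) (dact (vstep (Suc k) (t (Suc k))) F)) \<mu> =
    dact (ymat t (Suc k)) F \<mu>"
proof -
  have "dact (ymat t k) (dact (vstep (Suc k) (t (Suc k))) F) =
     (\<lambda>\<nu>. \<Sum>\<rho>\<in>Par L. (\<Sum>\<tau>\<in>Par L. ymat t k \<tau> \<nu> * vstep (Suc k) (t (Suc k)) \<rho> \<tau>) * F \<rho>)"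
    unfolding dact_def sum_sum_assoc ..
  then have "dact (hstep (Suc k) (- t (Suc k))) (dact (ymat t k) (dact (vstep (Suc k) (t (Suc k))) F)) \<mu> =
     (\<Sum>\<rho>\<in>Par L. (\<Sum>\<nu>\<in>Par L. hstep (Suc k) (- t (Suc k)) \<nu> \<mu> *
      (\<Sum>\<tau>\<in>Par L. ymat t k \<tau> \<nu> * vstep (Suc k) (t (Suc k)) \<rho> \<tau>)) * F \<rho>)"
    unfolding dact_def[of "hstep _ _"] by (simp only: sum_sum_assoc[where Y = "Par L" and X = "Par L" and F = F])
  also have "\<dots> = dact (ymat t (Suc k)) F \<mu>"
    unfolding dact_def by (intro sum.cong refl) (simp add: ymat_Suc[OF m _ K])
  finally show ?thesis .
qed

lemma dchain_vchain:
  assumes m: "\<mu> \<in> Par L"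
  shows "k \<le> L \<Longrightarrow> dchain (\<lambda>i. hstep i (- t i)) k (vchain (\<lambda>i. vstep i (t i)) k F) \<mu> = dact (ymat t k) F \<mu>"
  using m
proof (induction k arbitrary: F \<mu>)
  case 0
  have "ymat t 0 \<rho> \<mu> = (if \<rho> = \<mu> then 1 else 0)" for \<rho> by (auto simp: ymat_def fun_eq_iff)
  then show ?case using 0 by (simp add: dact_def if_distrib[of "\<lambda>x. x * _"] cong: if_cong)
next
  case (Suc k)
  have "dact (hstep (Suc k) (- t (Suc k))) (dchain (\<lambda>i. hstep i (- t i)) k
     (vchain (\<lambda>i. vstep i (t i)) k (dact (vstep (Suc k) (t (Suc k))) F))) \<mu> =
     dact (hstep (Suc k) (- t (Suc k))) (dact (ymat t k) (dact (vstep (Suc k) (t (Suc k))) F)) \<mu>"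
    using Suc by (intro dact_cong hstep_eq_0) auto
  also have "\<dots> = dact (ymat t (Suc k)) F \<mu>" using Suc.prems by (intro dact_ymat_Suc)
  finally show ?case by simp
qed

text \<open>The condition says that \<open>\<alpha>\<close> is the union of \<open>\<beta>\<close>
  and \<open>\<mu>\<close>; the truncated difference \<open>\<mu> i - \<beta> i\<close> counts the
  boxes of \<open>\<mu>\<close> that \<open>\<beta>\<close> lacks in row \<open>i\<close>. For
  \<open>\<alpha> = \<mu>\<close> this is \<open>ymat t L\<close>; larger \<open>\<alpha>\<close>
  arise when the operator moves past strips.\<close>

definition xmat :: "(nat \<Rightarrow> 'a::comm_ring_1) \<Rightarrow> rows \<Rightarrow> rows \<Rightarrow> rows \<Rightarrow> 'a" where
  "xmat t \<mu> \<alpha> \<beta> = (if \<forall>i. max (\<beta> i) (\<mu> i) = \<alpha> i then \<Prod>i\<in>{1..L}. (- t i) ^ (\<mu> i - \<beta> i) else 0)"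

lemma straighten:
  fixes x :: "'a::comm_ring_1"
  assumes a: "\<alpha> \<in> Par L" and m: "\<mu> \<in> Par L" "\<mu> \<le> \<alpha>" and b: "\<beta> \<in> Par L"
  shows "(\<Sum>\<gamma>\<in>Par L. xmat t \<mu> \<alpha> \<gamma> * up_ex t L x \<gamma> \<beta>) = (\<Sum>\<gamma>\<in>Par L. up_sv t \<mu> x \<alpha> \<gamma> * xmat t \<mu> \<gamma> \<beta>)"
proof -
  \<comment> \<open>\<open>xmat t \<mu> \<gamma> \<beta>\<close> vanishes unless
    \<open>\<gamma>\<close> is this union, so the right-hand sum has a single term and the claim
    splits into one instance of \<open>row_straightening\<close> per row.\<close>
  define \<gamma>0 where "\<gamma>0 = (\<lambda>i. max (\<beta> i) (\<mu> i))"
  have g0: "\<gamma>0 \<in> Par L"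
    unfolding Par_def \<gamma>0_def using Par_0[OF b] Par_0[OF m(1)] Par_out[OF b] Par_out[OF m(1)]
      max.mono[OF Par_Suc[OF b] Par_Suc[OF m(1)]] by simp
  have L1: "(\<Prod>i\<le>L. f i) = f 0 * (\<Prod>i\<in>{1..L}. f i)" for f :: "nat \<Rightarrow> 'a"
  proof -
    have "{..L} = insert 0 {1..L}" by auto
    then show ?thesis by simp
  qed
  have g: "\<gamma> = \<gamma>0" if "xmat t \<mu> \<gamma> \<beta> \<noteq> 0" for \<gamma>
    using that by (auto simp: xmat_def \<gamma>0_def fun_eq_iff split: if_splits)
  have "(\<Sum>\<gamma>\<in>Par L. up_sv t \<mu> x \<alpha> \<gamma> * xmat t \<mu> \<gamma> \<beta>) = up_sv t \<mu> x \<alpha> \<gamma>0 * xmat t \<mu> \<gamma>0 \<beta>"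
    using g by (intro sum_single[OF g0]) (metis mult_zero_right)
  also have "xmat t \<mu> \<gamma>0 \<beta> = (\<Prod>i\<in>{1..L}. (- t i) ^ (\<mu> i - \<beta> i))"
    by (simp add: xmat_def \<gamma>0_def)
  also have "up_sv t \<mu> x \<alpha> \<gamma>0 = (\<Prod>i\<in>{1..L}. if \<alpha> i \<le> \<gamma>0 i \<and> \<gamma>0 (Suc i) \<le> \<alpha> i then
     x ^ (\<gamma>0 i - \<alpha> i) * (if \<gamma>0 (Suc i) < \<alpha> i \<and> \<mu> i < \<alpha> i then 1 + x * t i else 1) else 0)"
  proof -
    \<comment> \<open>In row 0 and beyond the frame the interlacing is automatic, so only the rows
      of the product need to be tested.\<close>
    have "hs \<alpha> \<gamma>0 \<longleftrightarrow> (\<forall>i\<in>{1..L}. \<alpha> i \<le> \<gamma>0 i \<and> \<gamma>0 (Suc i) \<le> \<alpha> i)"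
    proof
      assume r: "\<forall>i\<in>{1..L}. \<alpha> i \<le> \<gamma>0 i \<and> \<gamma>0 (Suc i) \<le> \<alpha> i"
      have "\<alpha> i \<le> \<gamma>0 i \<and> \<gamma>0 (Suc i) \<le> \<alpha> i" for i
      proof -
        consider "i = 0" | "i \<in> {1..L}" | "L < i" by force
        then show ?thesis
          using r Par_0[OF a] Par_0[OF g0] Par_le[OF g0] Par_out[OF a, of i] Par_out[OF g0, of i]
            Par_out[OF g0, of "Suc i"] by cases auto
      qed
      then show "hs \<alpha> \<gamma>0" by (simp add: hs_def)
    qed (simp add: hs_def)
    moreover have "x ^ (\<gamma>0 0 - \<alpha> 0) = 1" using Par_0[OF a] Par_0[OF g0] by simp
    ultimately show ?thesis
      by (simp add: up_sv_def up_def prod_if_zero L1 prod.distrib)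
  qed
  finally have rhs: "(\<Sum>\<gamma>\<in>Par L. up_sv t \<mu> x \<alpha> \<gamma> * xmat t \<mu> \<gamma> \<beta>) =
     (\<Prod>i\<in>{1..L}. (if \<alpha> i \<le> \<gamma>0 i \<and> \<gamma>0 (Suc i) \<le> \<alpha> i then
     x ^ (\<gamma>0 i - \<alpha> i) * (if \<gamma>0 (Suc i) < \<alpha> i \<and> \<mu> i < \<alpha> i then 1 + x * t i else 1) else 0) *
     (- t i) ^ (\<mu> i - \<beta> i))"
    by (simp add: prod.distrib)
  define I where "I = (\<lambda>i. {r. max r (\<mu> i) = \<alpha> i \<and> \<beta> (Suc i) \<le> r \<and> r \<le> \<beta> i})"
  have set: "{\<gamma> \<in> Par L. (\<forall>i. max (\<gamma> i) (\<mu> i) = \<alpha> i) \<and> hs \<gamma> \<beta>} =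
    {\<gamma>. \<forall>i. if i \<in> {1..L} then \<gamma> i \<in> I i else \<gamma> i = (if i = 0 then W else p)}" (is "?L = ?R")
  proof
    show "?L \<subseteq> ?R" by (auto simp: I_def hs_def Par_def)
    show "?R \<subseteq> ?L"
    proof
      fix \<gamma> assume r: "\<gamma> \<in> ?R"
      have A: "max (\<gamma> i) (\<mu> i) = \<alpha> i \<and> \<beta> (Suc i) \<le> \<gamma> i \<and> \<gamma> i \<le> \<beta> i" for i
      proof -
        consider "i = 0" | "i \<in> {1..L}" | "L < i" by force
        then show ?thesis
        proof cases
          case 1
          then show ?thesis using r Par_0[OF m(1)] Par_0[OF a] Par_le[OF b, of 1] Par_0[OF b] by auto
        next
          case 2
          then show ?thesis using r by (auto simp: I_def dest!: spec[of _ i])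
        next
          case 3
          then show ?thesis using r Par_out[OF m(1), of i] Par_out[OF a, of i] Par_out[OF b, of i] Par_out[OF b, of "Suc i"]
            by (auto dest!: spec[of _ i])
        qed
      qed
      have "\<gamma> (Suc i) \<le> \<gamma> i" for i using A[of i] A[of "Suc i"] by linarith
      moreover have "\<gamma> 0 = W" using r by (auto dest: spec[of _ 0])
      moreover have "\<gamma> i = p" if "L < i" for i using r that by (auto dest!: spec[of _ i])
      ultimately show "\<gamma> \<in> ?L" using A by (auto simp: Par_def hs_def)
    qed
  qed
  have fin: "finite (I i)" for i unfolding I_def by (rule finite_subset[of _ "{..\<beta> i}"]) auto
  have "(\<Sum>\<gamma>\<in>Par L. xmat t \<mu> \<alpha> \<gamma> * up_ex t L x \<gamma> \<beta>) =
    (\<Sum>\<gamma>\<in>Par L. if (\<forall>i. max (\<gamma> i) (\<mu> i) = \<alpha> i) \<and> hs \<gamma> \<beta> then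
      (\<Prod>i\<in>{1..L}. (- t i) ^ (\<mu> i - \<gamma> i)) * (\<Prod>i\<le>L. x ^ (\<beta> i - \<gamma> i)) *
      (\<Prod>i\<in>{1..L}. if \<beta> (Suc i) < \<gamma> i then 1 + x * t i else 1) else 0)"
    by (intro sum.cong refl) (simp add: xmat_def up_ex_def up_def)
  also have "\<dots> = (\<Sum>\<gamma>\<in>{\<gamma> \<in> Par L. (\<forall>i. max (\<gamma> i) (\<mu> i) = \<alpha> i) \<and> hs \<gamma> \<beta>}.
      (\<Prod>i\<in>{1..L}. (- t i) ^ (\<mu> i - \<gamma> i)) * (\<Prod>i\<le>L. x ^ (\<beta> i - \<gamma> i)) *
      (\<Prod>i\<in>{1..L}. if \<beta> (Suc i) < \<gamma> i then 1 + x * t i else 1))"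
    by (rule sum_if_filter) simp
  also have "\<dots> = (\<Sum>\<gamma>\<in>{\<gamma> \<in> Par L. (\<forall>i. max (\<gamma> i) (\<mu> i) = \<alpha> i) \<and> hs \<gamma> \<beta>}.
      \<Prod>i\<in>{1..L}. (- t i) ^ (\<mu> i - \<gamma> i) * x ^ (\<beta> i - \<gamma> i) * (if \<beta> (Suc i) < \<gamma> i then 1 + x * t i else 1))"
  proof (intro sum.cong refl, goal_cases)
    case (1 \<gamma>)
    then have "\<gamma> \<in> Par L" by simp
    then have "\<beta> 0 - \<gamma> 0 = 0" using Par_0[OF b] Par_0[of \<gamma> L] by simp
    then show ?case by (simp add: L1 prod.distrib)
  qed
  also have "\<dots> = (\<Prod>i\<in>{1..L}. \<Sum>r\<in>I i.
      (- t i) ^ (\<mu> i - r) * x ^ (\<beta> i - r) * (if \<beta> (Suc i) < r then 1 + x * t i else 1))"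
    unfolding set by (rule sum_prod_pointwise) (auto simp: fin)
  also have "\<dots> = (\<Prod>i\<in>{1..L}. (if \<alpha> i \<le> \<gamma>0 i \<and> \<gamma>0 (Suc i) \<le> \<alpha> i then
     x ^ (\<gamma>0 i - \<alpha> i) * (if \<gamma>0 (Suc i) < \<alpha> i \<and> \<mu> i < \<alpha> i then 1 + x * t i else 1) else 0) *
     (- t i) ^ (\<mu> i - \<beta> i))"
    unfolding I_def \<gamma>0_def
    by (intro prod.cong refl row_straightening Par_Suc[OF b] Par_Suc[OF m(1)] le_funD[OF m(2)])
  finally show ?thesis unfolding rhs .
qed

lemma up_sv_eq_0: "\<not> hs \<alpha> \<beta> \<Longrightarrow> up_sv t \<mu> x \<alpha> \<beta> = 0"
  by (simp add: up_sv_def up_def)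

lemma straighten_act:
  assumes a: "\<alpha> \<in> Par L" and m: "\<mu> \<in> Par L" "\<mu> \<le> \<alpha>"
  shows "act (xmat t \<mu>) (act (up_ex t L x) F) \<alpha> = act (up_sv t \<mu> x) (act (xmat t \<mu>) F) \<alpha>"
  unfolding act_def sum_sum_assoc
  by (intro sum.cong refl) (simp add: straighten[OF a m])

text \<open>Strips only enlarge a shape, hence all shapes reached from \<open>\<alpha>\<close>
  contain \<open>\<mu>\<close>, as \<open>straighten\<close> requires.\<close>

lemma chain_cong_ge:
  assumes M: "\<And>k \<alpha> \<beta>. \<not> hs \<alpha> \<beta> \<Longrightarrow> M k \<alpha> \<beta> = 0" and a: "\<alpha> \<in> Par L" "\<mu> \<le> \<alpha>"
  shows "(\<And>\<beta>. \<beta> \<in> Par L \<Longrightarrow> \<mu> \<le> \<beta> \<Longrightarrow> F \<beta> = F' \<beta>) \<Longrightarrow> chain M n F \<alpha> = chain M n F' \<alpha>"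
proof (induction n arbitrary: F F')
  case 0
  then show ?case using a by simp
next
  case (Suc n)
  have e: "act (M (Suc n)) F \<beta> = act (M (Suc n)) F' \<beta>" if b: "\<beta> \<in> Par L" "\<mu> \<le> \<beta>" for \<beta>
    unfolding act_def
  proof (intro sum.cong refl)
    fix \<gamma> assume "\<gamma> \<in> Par L"
    then show "M (Suc n) \<beta> \<gamma> * F \<gamma> = M (Suc n) \<beta> \<gamma> * F' \<gamma>"
      using hs_imp_le[of \<beta> \<gamma>] order_trans[OF b(2), of \<gamma>] Suc.prems[of \<gamma>] M[of \<beta> \<gamma> "Suc n"]
      by (cases "hs \<beta> \<gamma>") auto
  qed
  show ?case unfolding chain.simps by (rule Suc.IH[OF e])
qed

lemma straighten_chain:
  assumes a: "\<alpha> \<in> Par L" and m: "\<mu> \<in> Par L" "\<mu> \<le> \<alpha>"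
  shows "act (xmat t \<mu>) (chain (\<lambda>j. up_ex t L (x j)) n F) \<alpha> =
    chain (\<lambda>j. up_sv t \<mu> (x j)) n (act (xmat t \<mu>) F) \<alpha>"
proof (induction n arbitrary: F)
  case (Suc n)
  have "chain (\<lambda>j. up_sv t \<mu> (x j)) n (act (xmat t \<mu>) (act (up_ex t L (x (Suc n))) F)) \<alpha> =
     chain (\<lambda>j. up_sv t \<mu> (x j)) n (act (up_sv t \<mu> (x (Suc n))) (act (xmat t \<mu>) F)) \<alpha>"
    by (rule chain_cong_ge[OF up_sv_eq_0 a m(2)]) (simp_all add: straighten_act m(1))
  then show ?case using Suc by simp
qed simp

text \<open>The \<open>V\<close> operators move left through the strips, merge with the
  \<open>H\<close> operators into \<open>ymat t L\<close>, and this, read as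
  \<open>xmat t \<mu>\<close>, moves right through the strips again. It disappears at
  \<open>\<delta>\<close>, because \<open>\<mu> \<le> \<kappa>\<close> leaves no box of
  \<open>\<mu>\<close> outside \<open>\<kappa>\<close>.\<close>

theorem operator_identity:
  assumes m: "\<mu> \<in> Par l" and lam: "\<kappa> \<in> Par L" "\<mu> \<le> \<kappa>" and l: "l + n \<le> L"
  defines "\<delta> \<equiv> \<lambda>\<beta>. if \<beta> = \<kappa> then 1 else (0::'a::comm_ring_1)"
  shows "dchain (\<lambda>i. hstep i (- t i)) L (chain (\<lambda>j. up (x j)) n (vchain (\<lambda>i. vstep i (t i)) L \<delta>)) \<mu> =
    chain (\<lambda>j. up_sv t \<mu> (x j)) n \<delta> \<mu>"
proof -
  have mL: "\<mu> \<in> Par L" by (rule subsetD[OF Par_mono m]) (use l in linarith)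
  \<comment> \<open>\<open>exchange_vchain\<close> is available on \<open>Par l\<close> only; the
    removals by \<open>hstep\<close> start at \<open>\<mu>\<close> in \<open>Par l\<close> and stay
    there.\<close>
  have dc: "dchain (\<lambda>i. hstep i (- t i)) k F \<alpha> = dchain (\<lambda>i. hstep i (- t i)) k F' \<alpha>"
    if "\<alpha> \<in> Par l" "\<And>\<nu>. \<nu> \<in> Par l \<Longrightarrow> F \<nu> = F' \<nu>" for k \<alpha> F F'
    using that
  proof (induction k arbitrary: \<alpha>)
    case (Suc k)
    then show ?case by (simp, intro dact_cong[where l = l]) (auto simp: hstep_eq_0)
  qed simp
  have "dchain (\<lambda>i. hstep i (- t i)) L (chain (\<lambda>j. up (x j)) n (vchain (\<lambda>i. vstep i (t i)) L \<delta>)) \<mu> =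
    dchain (\<lambda>i. hstep i (- t i)) L (vchain (\<lambda>i. vstep i (t i)) L (chain (\<lambda>j. up_ex t L (x j)) n \<delta>)) \<mu>"
    by (rule dc[OF m]) (rule exchange_vchain[OF _ l order_refl])
  also have "\<dots> = dact (ymat t L) (chain (\<lambda>j. up_ex t L (x j)) n \<delta>) \<mu>"
    using mL by (intro dchain_vchain) auto
  also have "\<dots> = act (xmat t \<mu>) (chain (\<lambda>j. up_ex t L (x j)) n \<delta>) \<mu>"
  proof -
    have "ymat t L \<rho> \<mu> = xmat t \<mu> \<mu> \<rho>" if r: "\<rho> \<in> Par L" for \<rho>
    proof -
      have "(\<forall>i. if i \<in> {1..L} then \<rho> i \<le> \<mu> i else \<rho> i = \<mu> i) \<longleftrightarrow> (\<forall>i. max (\<rho> i) (\<mu> i) = \<mu> i)"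
      proof -
        have "(if i \<in> {1..L} then \<rho> i \<le> \<mu> i else \<rho> i = \<mu> i) \<longleftrightarrow> max (\<rho> i) (\<mu> i) = \<mu> i" for i
          using Par_0[OF mL] Par_0[OF r] Par_out[OF mL, of i] Par_out[OF r, of i]
          by (cases "i = 0"; cases "i \<le> L") (auto simp: max_def)
        then show ?thesis by simp
      qed
      then show ?thesis by (simp add: ymat_def xmat_def)
    qed
    then show ?thesis by (simp add: act_def dact_def)
  qed
  also have "\<dots> = chain (\<lambda>j. up_sv t \<mu> (x j)) n (act (xmat t \<mu>) \<delta>) \<mu>"
    by (rule straighten_chain[OF mL mL order_refl])
  also have "\<dots> = chain (\<lambda>j. up_sv t \<mu> (x j)) n \<delta> \<mu>"
  proof (rule chain_cong_ge[OF up_sv_eq_0 mL order_refl])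
    fix \<beta> assume b: "\<beta> \<in> Par L" "\<mu> \<le> \<beta>"
    have "act (xmat t \<mu>) \<delta> \<beta> = xmat t \<mu> \<beta> \<kappa>"
      using lam(1) by (simp add: act_def \<delta>_def if_distrib[of "\<lambda>x. _ * x"] cong: if_cong)
    also have "\<dots> = \<delta> \<beta>"
    proof -
      have "max (\<kappa> i) (\<mu> i) = \<kappa> i" "\<mu> i - \<kappa> i = 0" for i
        using le_funD[OF lam(2), of i] by auto
      then show ?thesis by (auto simp: xmat_def \<delta>_def fun_eq_iff)
    qed
    finally show "act (xmat t \<mu>) \<delta> \<beta> = \<delta> \<beta>" .
  qed
  finally show ?thesis .
qed

end

section \<open>Tableaux as chains of shapes\<close>

definition skew :: "rows \<Rightarrow> rows \<Rightarrow> box set" where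
  "skew \<alpha> \<beta> = {(i, j). \<alpha> i < j \<and> j \<le> \<beta> i}"

text \<open>Weak monotonicity in both directions is just what makes the boxes with labels up to
  \<open>k\<close> form a shape. Strictness and row bounds are left to the weights of the
  steps.\<close>

definition fill :: "nat \<Rightarrow> rows \<Rightarrow> rows \<Rightarrow> (box \<Rightarrow> nat) set" where
  "fill n \<alpha> \<beta> = {T \<in> skew \<alpha> \<beta> \<rightarrow>\<^sub>E {1..n}.
     (\<forall>i j j'. (i, j) \<in> skew \<alpha> \<beta> \<and> (i, j') \<in> skew \<alpha> \<beta> \<and> j \<le> j' \<longrightarrow> T (i, j) \<le> T (i, j')) \<and>
     (\<forall>i i' j. (i, j) \<in> skew \<alpha> \<beta> \<and> (i', j) \<in> skew \<alpha> \<beta> \<and> i \<le> i' \<longrightarrow> T (i, j) \<le> T (i', j))}"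

definition level :: "rows \<Rightarrow> rows \<Rightarrow> (box \<Rightarrow> nat) \<Rightarrow> nat \<Rightarrow> rows" where
  "level \<alpha> \<beta> T k i = \<alpha> i + card {j. (i, j) \<in> skew \<alpha> \<beta> \<and> T (i, j) \<le> k}"

text \<open>\<open>skew\<close> does not see rows with \<open>\<beta> i < \<alpha> i\<close>;
  without the test \<open>\<alpha> \<le> \<beta>\<close> such a pair could still have
  fillings.\<close>

definition wt :: "(nat \<Rightarrow> rows \<Rightarrow> rows \<Rightarrow> 'a::comm_ring_1) \<Rightarrow> nat \<Rightarrow> rows \<Rightarrow> rows \<Rightarrow> 'a" where
  "wt M n \<alpha> \<beta> = (if \<alpha> \<le> \<beta> then
     \<Sum>T\<in>fill n \<alpha> \<beta>. \<Prod>k\<in>{1..n}. M k (level \<alpha> \<beta> T (k - 1)) (level \<alpha> \<beta> T k) else 0)"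

lemma fillD:
  assumes "T \<in> fill n \<alpha> \<beta>"
  shows "T \<in> skew \<alpha> \<beta> \<rightarrow>\<^sub>E {1..n}"
    and "(i, j) \<in> skew \<alpha> \<beta> \<Longrightarrow> 1 \<le> T (i, j) \<and> T (i, j) \<le> n"
    and "(i, j) \<in> skew \<alpha> \<beta> \<Longrightarrow> (i, j') \<in> skew \<alpha> \<beta> \<Longrightarrow> j \<le> j' \<Longrightarrow> T (i, j) \<le> T (i, j')"
    and "(i, j) \<in> skew \<alpha> \<beta> \<Longrightarrow> (i', j) \<in> skew \<alpha> \<beta> \<Longrightarrow> i \<le> i' \<Longrightarrow> T (i, j) \<le> T (i', j)"
  using assms by (auto simp: fill_def PiE_iff)

lemma initial_interval:
  assumes "finite D" "\<And>j. j \<in> D \<Longrightarrow> m < j" "\<And>j j'. j \<in> D \<Longrightarrow> m < j' \<Longrightarrow> j' \<le> j \<Longrightarrow> j' \<in> D"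
  shows "D = {m<..m + card D}"
proof (cases "D = {}")
  case False
  then have M: "Max D \<in> D" using assms(1) by simp
  have "D = {m<..Max D}"
  proof
    show "D \<subseteq> {m<..Max D}" using assms(2) Max_ge[OF assms(1)] by auto
    show "{m<..Max D} \<subseteq> D" using assms(3)[OF M] by auto
  qed
  moreover have "card {m<..Max D} = Max D - m" by simp
  ultimately have "card D = Max D - m" by simp
  then show ?thesis using \<open>D = {m<..Max D}\<close> assms(2)[OF M] by simp
qed simp

lemma finite_skew_row: "finite {j. (i, j) \<in> skew \<alpha> \<beta>}"
  by (rule finite_subset[of _ "{..\<beta> i}"]) (auto simp: skew_def)

lemma level_iff:
  assumes "T \<in> fill n \<alpha> \<beta>" "(i, j) \<in> skew \<alpha> \<beta>"
  shows "T (i, j) \<le> k \<longleftrightarrow> j \<le> level \<alpha> \<beta> T k i"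
proof -
  define D where "D = {j. (i, j) \<in> skew \<alpha> \<beta> \<and> T (i, j) \<le> k}"
  have "D = {\<alpha> i<..\<alpha> i + card D}"
  proof (rule initial_interval)
    show "finite D" unfolding D_def by (rule finite_subset[OF _ finite_skew_row]) auto
    fix j assume j: "j \<in> D"
    then show "\<alpha> i < j" by (auto simp: D_def skew_def)
    fix j' assume j': "\<alpha> i < j'" "j' \<le> j"
    then have "(i, j') \<in> skew \<alpha> \<beta>" using j by (auto simp: D_def skew_def)
    then show "j' \<in> D" using fillD(3)[OF assms(1), of i j' j] j j' by (auto simp: D_def)
  qed
  then have "j \<in> D \<longleftrightarrow> \<alpha> i < j \<and> j \<le> \<alpha> i + card D" by (metis greaterThanAtMost_iff)
  then show ?thesis using assms(2) by (auto simp: D_def level_def skew_def)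
qed

lemma level_ge: "\<alpha> i \<le> level \<alpha> \<beta> T k i"
  by (simp add: level_def)

lemma level_le: "\<alpha> i \<le> \<beta> i \<Longrightarrow> level \<alpha> \<beta> T k i \<le> \<beta> i"
proof -
  assume "\<alpha> i \<le> \<beta> i"
  moreover have "card {j. (i, j) \<in> skew \<alpha> \<beta> \<and> T (i, j) \<le> k} \<le> card {\<alpha> i<..\<beta> i}"
    by (rule card_mono) (auto simp: skew_def)
  ultimately show ?thesis by (simp add: level_def)
qed

lemma level_le_outer: "\<alpha> \<le> \<beta> \<Longrightarrow> level \<alpha> \<beta> T k i \<le> \<beta> i"
  by (simp add: level_le le_fun_def)

lemma level_mono: "k \<le> k' \<Longrightarrow> level \<alpha> \<beta> T k i \<le> level \<alpha> \<beta> T k' i"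
  unfolding level_def by (intro add_left_mono card_mono finite_subset[OF _ finite_skew_row[of i \<alpha> \<beta>]]) auto

lemma level_last:
  assumes "T \<in> fill n \<alpha> \<beta>" "\<alpha> \<le> \<beta>" "n \<le> k"
  shows "level \<alpha> \<beta> T k = \<beta>"
proof
  fix i
  have "{j. (i, j) \<in> skew \<alpha> \<beta> \<and> T (i, j) \<le> k} = {\<alpha> i<..\<beta> i}"
    using fillD(2)[OF assms(1)] assms(3) by (force simp: skew_def)
  then show "level \<alpha> \<beta> T k i = \<beta> i" using le_funD[OF assms(2), of i] by (simp add: level_def)
qed

text \<open>One box decides, the last one of level \<open>k\<close> in row \<open>i'\<close>: if its
  column lies beyond \<open>\<alpha> i\<close>, the column meets both rows, and the final assumption
  carries it over to level \<open>k'\<close> of row \<open>i\<close>.\<close>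

lemma level_le_level:
  assumes "T \<in> fill n \<alpha> \<beta>" "\<alpha> i' \<le> \<alpha> i" "\<beta> i' \<le> \<beta> i" "\<alpha> i' \<le> \<beta> i'"
    and "\<And>j. (i, j) \<in> skew \<alpha> \<beta> \<Longrightarrow> (i', j) \<in> skew \<alpha> \<beta> \<Longrightarrow> T (i', j) \<le> k \<Longrightarrow> T (i, j) \<le> k'"
  shows "level \<alpha> \<beta> T k i' \<le> level \<alpha> \<beta> T k' i"
proof -
  define j where "j = level \<alpha> \<beta> T k i'"
  have jb: "j \<le> \<beta> i'" unfolding j_def using assms(4) by (rule level_le)
  show ?thesis
  proof (cases "j \<le> \<alpha> i")
    case True
    then show ?thesis using level_ge[of \<alpha> i \<beta> T k'] by (simp add: j_def)
  next
    case False
    then have "(i, j) \<in> skew \<alpha> \<beta>" "(i', j) \<in> skew \<alpha> \<beta>" using jb assms by (auto simp: skew_def)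
    moreover from this have "T (i', j) \<le> k" using level_iff[OF assms(1)] by (simp add: j_def)
    ultimately show ?thesis using assms(5) level_iff[OF assms(1)] by (simp add: j_def[symmetric])
  qed
qed

lemma level_diff:
  assumes "0 < k"
  shows "level \<alpha> \<beta> T k i - level \<alpha> \<beta> T (k - 1) i = card {b \<in> skew \<alpha> \<beta>. T b = k \<and> fst b = i}"
proof -
  let ?A = "\<lambda>k. {j. (i, j) \<in> skew \<alpha> \<beta> \<and> T (i, j) \<le> k}"
  have fin: "finite (?A k)" for k by (rule finite_subset[OF _ finite_skew_row]) auto
  have "level \<alpha> \<beta> T k i - level \<alpha> \<beta> T (k - 1) i = card (?A k) - card (?A (k - 1))" by (simp add: level_def)
  also have "\<dots> = card (?A k - ?A (k - 1))"
    by (rule card_Diff_subset[symmetric]) (use fin in auto)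
  also have "?A k - ?A (k - 1) = {j. (i, j) \<in> skew \<alpha> \<beta> \<and> T (i, j) = k}" using assms by auto
  also have "card \<dots> = card (Pair i ` \<dots>)" by (rule card_image[symmetric]) (simp add: inj_on_def)
  also have "Pair i ` {j. (i, j) \<in> skew \<alpha> \<beta> \<and> T (i, j) = k} = {b \<in> skew \<alpha> \<beta>. T b = k \<and> fst b = i}" by auto
  finally show ?thesis .
qed

lemma level_eq_iff:
  assumes "0 < k"
  shows "level \<alpha> \<beta> T k i = level \<alpha> \<beta> T (k - 1) i \<longleftrightarrow> (\<forall>j. (i, j) \<in> skew \<alpha> \<beta> \<longrightarrow> T (i, j) \<noteq> k)"
proof -
  have "finite {b \<in> skew \<alpha> \<beta>. T b = k \<and> fst b = i}"
    by (rule finite_subset[of _ "Pair i ` {j. (i, j) \<in> skew \<alpha> \<beta>}"]) (auto intro: finite_skew_row)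
  then have "level \<alpha> \<beta> T k i - level \<alpha> \<beta> T (k - 1) i = 0 \<longleftrightarrow> {b \<in> skew \<alpha> \<beta>. T b = k \<and> fst b = i} = {}"
    unfolding level_diff[OF assms] by simp
  moreover have "level \<alpha> \<beta> T (k - 1) i \<le> level \<alpha> \<beta> T k i" by (rule level_mono) simp
  ultimately show ?thesis by auto
qed

lemma vs_levels:
  assumes T: "T \<in> fill n \<alpha> \<beta>" and le: "\<alpha> \<le> \<beta>"
  shows "(\<forall>k\<in>{1..n}. vs (level \<alpha> \<beta> T (k - 1)) (level \<alpha> \<beta> T k)) \<longleftrightarrow>
    (\<forall>i j j'. (i, j) \<in> skew \<alpha> \<beta> \<and> (i, j') \<in> skew \<alpha> \<beta> \<and> j < j' \<longrightarrow> T (i, j) < T (i, j'))"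
    (is "?l \<longleftrightarrow> ?r")
proof
  assume l: ?l
  show ?r
  proof (intro allI impI, elim conjE)
    fix i j j' assume ij: "(i, j) \<in> skew \<alpha> \<beta>" "(i, j') \<in> skew \<alpha> \<beta>" "j < j'"
    define k where "k = T (i, j')"
    have k: "k \<in> {1..n}" using fillD(2)[OF T ij(2)] by (simp add: k_def)
    have "j' \<le> level \<alpha> \<beta> T k i" using level_iff[OF T ij(2), of k] by (simp add: k_def)
    also have "\<dots> \<le> Suc (level \<alpha> \<beta> T (k - 1) i)" using l k by (auto simp: vs_def)
    finally have "T (i, j) \<le> k - 1" using level_iff[OF T ij(1)] ij(3) by simp
    then show "T (i, j) < T (i, j')" using k by (auto simp: k_def)
  qed
next
  assume r: ?r
  show ?l
  proof
    fix k assume k: "k \<in> {1..n}"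
    have "level \<alpha> \<beta> T k i \<le> Suc (level \<alpha> \<beta> T (k - 1) i)" for i
    proof (rule ccontr)
      \<comment> \<open>The first column beyond level \<open>k - 1\<close>. A step with two boxes in
        row \<open>i\<close> would give the label \<open>k\<close> to the columns \<open>j\<close>
        and \<open>Suc j\<close>.\<close>
      define j where "j = Suc (level \<alpha> \<beta> T (k - 1) i)"
      assume "\<not> ?thesis"
      then have j: "Suc j \<le> level \<alpha> \<beta> T k i" by (simp add: j_def)
      then have "Suc j \<le> \<beta> i" using level_le_outer[OF le, of T k i] by simp
      moreover have "\<alpha> i < j" using level_ge[of \<alpha> i \<beta> T "k - 1"] by (simp add: j_def)
      ultimately have ij: "(i, j) \<in> skew \<alpha> \<beta>" "(i, Suc j) \<in> skew \<alpha> \<beta>" by (auto simp: skew_def)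
      have "T (i, Suc j) \<le> k" using level_iff[OF T ij(2)] j by simp
      moreover have "\<not> T (i, j) \<le> k - 1" using level_iff[OF T ij(1)] by (simp add: j_def)
      moreover have "T (i, j) < T (i, Suc j)" using r ij by blast
      ultimately show False by linarith
    qed
    then show "vs (level \<alpha> \<beta> T (k - 1)) (level \<alpha> \<beta> T k)" by (simp add: vs_def level_mono)
  qed
qed

text \<open>\<open>P k i\<close> forbids the label \<open>k\<close> in row \<open>i\<close>.
  Freezing rows during a step thus turns into a bound on labels, which is how both row-bound
  conditions are treated.\<close>

lemma row_levels:
  assumes T: "T \<in> fill n \<alpha> \<beta>"
  shows "(\<forall>k\<in>{1..n}. \<forall>i. P k i \<longrightarrow> level \<alpha> \<beta> T k i = level \<alpha> \<beta> T (k - 1) i) \<longleftrightarrow>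
    (\<forall>i j. (i, j) \<in> skew \<alpha> \<beta> \<longrightarrow> \<not> P (T (i, j)) i)"
proof -
  have "level \<alpha> \<beta> T k i = level \<alpha> \<beta> T (k - 1) i \<longleftrightarrow> (\<forall>j. (i, j) \<in> skew \<alpha> \<beta> \<longrightarrow> T (i, j) \<noteq> k)"
    if "k \<in> {1..n}" for i k using that by (intro level_eq_iff) simp
  then have "(\<forall>k\<in>{1..n}. \<forall>i. P k i \<longrightarrow> level \<alpha> \<beta> T k i = level \<alpha> \<beta> T (k - 1) i) \<longleftrightarrow>
    (\<forall>k\<in>{1..n}. \<forall>i. P k i \<longrightarrow> (\<forall>j. (i, j) \<in> skew \<alpha> \<beta> \<longrightarrow> T (i, j) \<noteq> k))"
    by (simp only: cong: ball_cong)
  also have "\<dots> \<longleftrightarrow> (\<forall>i j. (i, j) \<in> skew \<alpha> \<beta> \<longrightarrow> \<not> P (T (i, j)) i)"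
  proof (intro iffI allI ballI impI)
    fix i j assume "\<forall>k\<in>{1..n}. \<forall>i. P k i \<longrightarrow> (\<forall>j. (i, j) \<in> skew \<alpha> \<beta> \<longrightarrow> T (i, j) \<noteq> k)"
      "(i, j) \<in> skew \<alpha> \<beta>"
    moreover from this have "T (i, j) \<in> {1..n}" using fillD(2)[OF T] by simp
    ultimately show "\<not> P (T (i, j)) i" by blast
  qed blast
  finally show ?thesis .
qed

context frame
begin

lemma skew_row: "\<alpha> \<in> Par L \<Longrightarrow> \<beta> \<in> Par L \<Longrightarrow> (i, j) \<in> skew \<alpha> \<beta> \<Longrightarrow> i \<in> {1..L} \<and> j \<in> {p<..W}"
proof -
  assume a: "\<alpha> \<in> Par L" and b: "\<beta> \<in> Par L" and "(i, j) \<in> skew \<alpha> \<beta>"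
  then have ij: "\<alpha> i < j" "j \<le> \<beta> i" by (auto simp: skew_def)
  have "i \<noteq> 0" using ij Par_0[OF a] Par_0[OF b] by (metis not_le order.strict_trans1 order_refl leD)
  moreover have "i \<le> L" using ij Par_out[OF a, of i] Par_out[OF b, of i] by (cases "i \<le> L") auto
  ultimately show ?thesis using ij Par_ge[OF a, of i] Par_le[OF b, of i] by auto
qed

lemma finite_skew: "\<alpha> \<in> Par L \<Longrightarrow> \<beta> \<in> Par L \<Longrightarrow> finite (skew \<alpha> \<beta>)"
  by (rule finite_subset[of _ "{1..L} \<times> {p<..W}"]) (use skew_row in auto)

lemma finite_fill: "\<alpha> \<in> Par L \<Longrightarrow> \<beta> \<in> Par L \<Longrightarrow> finite (fill n \<alpha> \<beta>)"
  by (rule finite_subset[of _ "skew \<alpha> \<beta> \<rightarrow>\<^sub>E {1..n}"]) (auto simp: fill_def intro!: finite_PiE finite_skew)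

lemma level_Par:
  assumes "T \<in> fill n \<alpha> \<beta>" "\<alpha> \<in> Par L" "\<beta> \<in> Par L" "\<alpha> \<le> \<beta>"
  shows "level \<alpha> \<beta> T k \<in> Par L"
proof -
  have le: "\<alpha> i \<le> \<beta> i" for i using le_funD[OF assms(4)] .
  have b: "\<alpha> i \<le> level \<alpha> \<beta> T k i \<and> level \<alpha> \<beta> T k i \<le> \<beta> i" for i
    using level_ge[of \<alpha> i \<beta> T k] level_le[of \<alpha> i \<beta> T k] le by simp
  have "level \<alpha> \<beta> T k (Suc i) \<le> level \<alpha> \<beta> T k i" for i
  proof (rule level_le_level[OF assms(1)])
    fix j assume "(i, j) \<in> skew \<alpha> \<beta>" "(Suc i, j) \<in> skew \<alpha> \<beta>" "T (Suc i, j) \<le> k"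
    then show "T (i, j) \<le> k" using fillD(4)[OF assms(1), of i j "Suc i"] by simp
  qed (use Par_Suc[OF assms(2)] Par_Suc[OF assms(3)] le in auto)
  moreover have "level \<alpha> \<beta> T k 0 = W" using b[of 0] Par_0[OF assms(2)] Par_0[OF assms(3)] by simp
  moreover have "level \<alpha> \<beta> T k i = p" if "L < i" for i
    using b[of i] Par_out[OF assms(2) that] Par_out[OF assms(3) that] by simp
  ultimately show ?thesis by (auto simp: Par_def)
qed

section \<open>Transfer recursion for fillings\<close>

lemma wt_0: "wt M 0 \<alpha> \<beta> = (if \<alpha> = \<beta> then 1 else 0)"
proof (cases "\<alpha> = \<beta>")
  case True
  then have "skew \<alpha> \<beta> = {}" by (auto simp: skew_def)
  then have "fill 0 \<alpha> \<beta> = {\<lambda>_. undefined}" by (auto simp: fill_def)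
  then show ?thesis using True by (simp add: wt_def)
next
  case False
  show ?thesis
  proof (cases "\<alpha> \<le> \<beta>")
    case True
    then obtain i where "\<alpha> i < \<beta> i" using False by (metis ext le_fun_def le_neq_trans)
    then have "(i, \<beta> i) \<in> skew \<alpha> \<beta>" by (auto simp: skew_def)
    then have "fill 0 \<alpha> \<beta> = {}" by (auto simp: fill_def PiE_eq_empty_iff)
    then show ?thesis using False by (simp add: wt_def)
  qed (use False in \<open>simp add: wt_def\<close>)
qed

definition extend :: "nat \<Rightarrow> rows \<Rightarrow> rows \<Rightarrow> rows \<Rightarrow> (box \<Rightarrow> nat) \<Rightarrow> box \<Rightarrow> nat" where
  "extend n \<alpha> \<gamma> \<beta> T b = (if b \<in> skew \<alpha> \<gamma> then T b else if b \<in> skew \<alpha> \<beta> then Suc n else undefined)"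

lemma extend_fill:
  assumes T: "T \<in> fill n \<alpha> \<gamma>" and le: "\<gamma> \<le> \<beta>" and g: "\<gamma> \<in> Par L"
  shows "extend n \<alpha> \<gamma> \<beta> T \<in> fill (Suc n) \<alpha> \<beta>"
proof -
  have sub: "skew \<alpha> \<gamma> \<subseteq> skew \<alpha> \<beta>" using le by (auto simp: skew_def le_fun_def intro: order_trans)
  have b: "T (i, j) \<le> n" "T (i, j) \<ge> 1" if "(i, j) \<in> skew \<alpha> \<gamma>" for i j
    using fillD(2)[OF T that] by auto
  have "extend n \<alpha> \<gamma> \<beta> T \<in> skew \<alpha> \<beta> \<rightarrow>\<^sub>E {1..Suc n}"
    using sub b by (fastforce simp: extend_def PiE_iff extensional_def)
  moreover have "extend n \<alpha> \<gamma> \<beta> T (i, j) \<le> extend n \<alpha> \<gamma> \<beta> T (i, j')"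
    if "(i, j) \<in> skew \<alpha> \<beta>" "(i, j') \<in> skew \<alpha> \<beta>" "j \<le> j'" for i j j'
  proof (cases "(i, j') \<in> skew \<alpha> \<gamma>")
    case True
    then have "(i, j) \<in> skew \<alpha> \<gamma>" using that by (auto simp: skew_def)
    then show ?thesis using True fillD(3)[OF T] that by (simp add: extend_def)
  next
    case False
    then show ?thesis using that b[of i j] by (simp add: extend_def le_Suc_eq)
  qed
  moreover have "extend n \<alpha> \<gamma> \<beta> T (i, j) \<le> extend n \<alpha> \<gamma> \<beta> T (i', j)"
    if "(i, j) \<in> skew \<alpha> \<beta>" "(i', j) \<in> skew \<alpha> \<beta>" "i \<le> i'" for i i' j
  proof (cases "(i', j) \<in> skew \<alpha> \<gamma>")
    case True
    then have "(i, j) \<in> skew \<alpha> \<gamma>" using that Par_antimono[OF g that(3)] by (auto simp: skew_def)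
    then show ?thesis using True fillD(4)[OF T] that by (simp add: extend_def)
  next
    case False
    then show ?thesis using that b[of i j] by (simp add: extend_def le_Suc_eq)
  qed
  ultimately show ?thesis by (simp add: fill_def)
qed

lemma extend_level:
  assumes T: "T \<in> fill n \<alpha> \<gamma>" and le: "\<gamma> \<le> \<beta>" and k: "k \<le> n"
  shows "level \<alpha> \<beta> (extend n \<alpha> \<gamma> \<beta> T) k = level \<alpha> \<gamma> T k"
proof
  fix i
  have sub: "skew \<alpha> \<gamma> \<subseteq> skew \<alpha> \<beta>" using le by (auto simp: skew_def le_fun_def intro: order_trans)
  have "{j. (i, j) \<in> skew \<alpha> \<beta> \<and> extend n \<alpha> \<gamma> \<beta> T (i, j) \<le> k} = {j. (i, j) \<in> skew \<alpha> \<gamma> \<and> T (i, j) \<le> k}"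
    using sub k by (auto simp: extend_def split: if_splits)
  then show "level \<alpha> \<beta> (extend n \<alpha> \<gamma> \<beta> T) k i = level \<alpha> \<gamma> T k i"
    by (simp add: level_def)
qed

lemma restrict_fill:
  assumes T: "T \<in> fill (Suc n) \<alpha> \<beta>" and le: "\<alpha> \<le> \<beta>"
  defines "\<gamma> \<equiv> level \<alpha> \<beta> T n"
  shows "restrict T (skew \<alpha> \<gamma>) \<in> fill n \<alpha> \<gamma>" "extend n \<alpha> \<gamma> \<beta> (restrict T (skew \<alpha> \<gamma>)) = T"
proof -
  have sub: "skew \<alpha> \<gamma> \<subseteq> skew \<alpha> \<beta>"
  proof
    fix b assume "b \<in> skew \<alpha> \<gamma>"
    then show "b \<in> skew \<alpha> \<beta>"
      using level_le_outer[OF le, of T n "fst b"] by (auto simp: skew_def \<gamma>_def)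
  qed
  have iff: "(i, j) \<in> skew \<alpha> \<gamma> \<longleftrightarrow> T (i, j) \<le> n" if "(i, j) \<in> skew \<alpha> \<beta>" for i j
    using level_iff[OF T that] that by (auto simp: \<gamma>_def skew_def)
  show "restrict T (skew \<alpha> \<gamma>) \<in> fill n \<alpha> \<gamma>"
  proof -
    have "T (i, j) \<in> {1..n}" if "(i, j) \<in> skew \<alpha> \<gamma>" for i j
      using that sub iff[of i j] fillD(2)[OF T, of i j] by auto
    then have "restrict T (skew \<alpha> \<gamma>) \<in> skew \<alpha> \<gamma> \<rightarrow>\<^sub>E {1..n}" by (auto simp: PiE_iff)
    moreover have "T (i, j) \<le> T (i, j')"
      if "(i, j) \<in> skew \<alpha> \<gamma>" "(i, j') \<in> skew \<alpha> \<gamma>" "j \<le> j'" for i j j'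
      using that subsetD[OF sub] by (intro fillD(3)[OF T]) auto
    moreover have "T (i, j) \<le> T (i', j)"
      if "(i, j) \<in> skew \<alpha> \<gamma>" "(i', j) \<in> skew \<alpha> \<gamma>" "i \<le> i'" for i i' j
      using that subsetD[OF sub] by (intro fillD(4)[OF T]) auto
    ultimately show ?thesis by (simp add: fill_def)
  qed
  show "extend n \<alpha> \<gamma> \<beta> (restrict T (skew \<alpha> \<gamma>)) = T"
  proof (rule ext)
    fix b :: box
    obtain i j where b: "b = (i, j)" by (cases b)
    consider "b \<in> skew \<alpha> \<gamma>" | "b \<in> skew \<alpha> \<beta>" "b \<notin> skew \<alpha> \<gamma>" | "b \<notin> skew \<alpha> \<beta>" by blast
    then show "extend n \<alpha> \<gamma> \<beta> (restrict T (skew \<alpha> \<gamma>)) b = T b"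
    proof cases
      case 2
      then show ?thesis using iff[of i j] fillD(2)[OF T, of i j] by (simp add: b extend_def)
    next
      case 3
      then show ?thesis using sub PiE_arb[OF fillD(1)[OF T] 3] by (auto simp: extend_def)
    qed (simp add: extend_def)
  qed
qed

text \<open>A filling with \<open>Suc n\<close> labels consists of the shape \<open>\<gamma>\<close>
  occupied by the labels up to \<open>n\<close>, a filling of it, and the label \<open>Suc n\<close>
  on all remaining boxes.\<close>

lemma wt_Suc:
  fixes M :: "nat \<Rightarrow> rows \<Rightarrow> rows \<Rightarrow> 'a::comm_ring_1"
  assumes a: "\<alpha> \<in> Par L" and b: "\<beta> \<in> Par L" and M: "\<And>\<gamma>. \<not> \<gamma> \<le> \<beta> \<Longrightarrow> M (Suc n) \<gamma> \<beta> = 0"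
  shows "wt M (Suc n) \<alpha> \<beta> = (\<Sum>\<gamma>\<in>Par L. wt M n \<alpha> \<gamma> * M (Suc n) \<gamma> \<beta>)"
proof (cases "\<alpha> \<le> \<beta>")
  case False
  have "wt M n \<alpha> \<gamma> * M (Suc n) \<gamma> \<beta> = 0" for \<gamma>
    using M[of \<gamma>] False order_trans[of \<alpha> \<gamma> \<beta>] by (auto simp: wt_def)
  then show ?thesis using False by (simp add: wt_def)
next
  case le: True
  define G where "G = {\<gamma> \<in> Par L. \<alpha> \<le> \<gamma> \<and> \<gamma> \<le> \<beta>}"
  define P where "P = (\<lambda>\<gamma> T. (\<Prod>k\<in>{1..n}. M k (level \<alpha> \<gamma> T (k - 1)) (level \<alpha> \<gamma> T k)))"
  have "(\<Sum>\<gamma>\<in>Par L. wt M n \<alpha> \<gamma> * M (Suc n) \<gamma> \<beta>) = (\<Sum>\<gamma>\<in>G. wt M n \<alpha> \<gamma> * M (Suc n) \<gamma> \<beta>)"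
  proof (rule sum.mono_neutral_right)
    show "\<forall>\<gamma>\<in>Par L - G. wt M n \<alpha> \<gamma> * M (Suc n) \<gamma> \<beta> = 0"
      using M by (auto simp: G_def wt_def)
  qed (auto simp: G_def)
  also have "\<dots> = (\<Sum>\<gamma>\<in>G. \<Sum>T\<in>fill n \<alpha> \<gamma>. P \<gamma> T * M (Suc n) \<gamma> \<beta>)"
    by (intro sum.cong refl) (simp add: G_def wt_def P_def sum_distrib_right)
  also have "\<dots> = (\<Sum>(\<gamma>, T)\<in>(SIGMA \<gamma>:G. fill n \<alpha> \<gamma>). P \<gamma> T * M (Suc n) \<gamma> \<beta>)"
    by (rule sum.Sigma) (use a in \<open>auto simp: G_def intro: finite_fill\<close>)
  also have "\<dots> = (\<Sum>T\<in>fill (Suc n) \<alpha> \<beta>. \<Prod>k\<in>{1..Suc n}. M k (level \<alpha> \<beta> T (k - 1)) (level \<alpha> \<beta> T k))"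
  proof (rule sum.reindex_bij_witness[where
      i = "\<lambda>T. (level \<alpha> \<beta> T n, restrict T (skew \<alpha> (level \<alpha> \<beta> T n)))" and
      j = "\<lambda>(\<gamma>, T). extend n \<alpha> \<gamma> \<beta> T"], goal_cases)
    case (1 gT)
    then obtain \<gamma> T where gT: "gT = (\<gamma>, T)" "\<gamma> \<in> Par L" "\<alpha> \<le> \<gamma>" "\<gamma> \<le> \<beta>" "T \<in> fill n \<alpha> \<gamma>"
      by (auto simp: G_def)
    have l: "level \<alpha> \<beta> (extend n \<alpha> \<gamma> \<beta> T) n = \<gamma>"
      using extend_level[OF gT(5,4) order_refl] level_last[OF gT(5,3) order_refl] by simp
    moreover have "restrict (extend n \<alpha> \<gamma> \<beta> T) (skew \<alpha> \<gamma>) = T"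
      using fillD(1)[OF gT(5)] by (auto simp: extend_def fun_eq_iff PiE_iff extensional_def restrict_def)
    ultimately show ?case by (simp add: gT(1))
  next
    case (2 gT)
    then show ?case by (auto simp: G_def intro: extend_fill)
  next
    case (3 T)
    then show ?case using restrict_fill(2)[OF _ le] by simp
  next
    case (4 T)
    have "level \<alpha> \<beta> T n \<in> G"
      using level_Par[OF 4 a b le] level_ge level_le le by (auto simp: G_def le_fun_def)
    then show ?case using restrict_fill(1)[OF 4 le] by simp
  next
    case (5 gT)
    then obtain \<gamma> T where gT: "gT = (\<gamma>, T)" "\<gamma> \<in> Par L" "\<alpha> \<le> \<gamma>" "\<gamma> \<le> \<beta>" "T \<in> fill n \<alpha> \<gamma>"
      by (auto simp: G_def)
    have l: "level \<alpha> \<beta> (extend n \<alpha> \<gamma> \<beta> T) n = \<gamma>"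
      using extend_level[OF gT(5,4) order_refl] level_last[OF gT(5,3) order_refl] by simp
    have "level \<alpha> \<beta> (extend n \<alpha> \<gamma> \<beta> T) (Suc n) = \<beta>"
      by (rule level_last[OF extend_fill[OF gT(5,4,2)] le order_refl])
    moreover have "(\<Prod>k\<in>{1..n}. M k (level \<alpha> \<beta> (extend n \<alpha> \<gamma> \<beta> T) (k - 1)) (level \<alpha> \<beta> (extend n \<alpha> \<gamma> \<beta> T) k)) = P \<gamma> T"
      unfolding P_def
    proof (intro prod.cong refl)
      fix k assume "k \<in> {1..n}"
      then have "k \<le> n" "k - 1 \<le> n" by auto
      then show "M k (level \<alpha> \<beta> (extend n \<alpha> \<gamma> \<beta> T) (k - 1)) (level \<alpha> \<beta> (extend n \<alpha> \<gamma> \<beta> T) k) =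
          M k (level \<alpha> \<gamma> T (k - 1)) (level \<alpha> \<gamma> T k)"
        by (simp only: extend_level[OF gT(5,4)])
    qed
    ultimately show ?case by (simp add: gT(1) l)
  qed
  finally show ?thesis using le by (simp add: wt_def)
qed

lemma chain_eq_wt:
  assumes M: "\<And>k \<gamma> \<beta>. \<not> \<gamma> \<le> \<beta> \<Longrightarrow> M k \<gamma> \<beta> = 0" and a: "\<alpha> \<in> Par L"
  shows "chain M n F \<alpha> = (\<Sum>\<beta>\<in>Par L. wt M n \<alpha> \<beta> * F \<beta>)"
proof (induction n arbitrary: F)
  case 0
  then show ?case using a by (simp add: wt_0 if_distrib[of "\<lambda>x. x * _"] cong: if_cong)
next
  case (Suc n)
  have "chain M (Suc n) F \<alpha> = (\<Sum>\<beta>\<in>Par L. wt M n \<alpha> \<beta> * act (M (Suc n)) F \<beta>)" by (simp add: Suc)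
  also have "\<dots> = (\<Sum>\<beta>\<in>Par L. wt M (Suc n) \<alpha> \<beta> * F \<beta>)"
    unfolding act_def sum_sum_assoc by (intro sum.cong refl) (simp add: wt_Suc[OF a] M)
  finally show ?case .
qed

lemma dchain_eq_wt:
  assumes M: "\<And>k \<gamma> \<beta>. \<not> \<gamma> \<le> \<beta> \<Longrightarrow> M k \<gamma> \<beta> = 0"
  shows "\<beta> \<in> Par L \<Longrightarrow> dchain M n F \<beta> = (\<Sum>\<alpha>\<in>Par L. wt M n \<alpha> \<beta> * F \<alpha>)"
proof (induction n arbitrary: \<beta>)
  case 0
  then show ?case by (simp add: wt_0 if_distrib[of "\<lambda>x. x * _"] cong: if_cong)
next
  case (Suc n)
  have "dchain M (Suc n) F \<beta> = (\<Sum>\<gamma>\<in>Par L. M (Suc n) \<gamma> \<beta> * (\<Sum>\<alpha>\<in>Par L. wt M n \<alpha> \<gamma> * F \<alpha>))"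
    by (simp add: dact_def Suc.IH)
  also have "\<dots> = (\<Sum>\<alpha>\<in>Par L. wt M (Suc n) \<alpha> \<beta> * F \<alpha>)"
    unfolding sum_sum_assoc using Suc.prems
    by (intro sum.cong refl) (simp add: wt_Suc M mult.commute)
  finally show ?case .
qed

lemma vchain_Suc_left: "vchain M (Suc n) F = dact (M 1) (vchain (\<lambda>k. M (Suc k)) n F)"
  by (induction n arbitrary: F) simp_all

lemma dchain_cong: "(\<And>k. 1 \<le> k \<Longrightarrow> k \<le> n \<Longrightarrow> M k = M' k) \<Longrightarrow> dchain M n F = dchain M' n F"
  by (induction n) simp_all

text \<open>\<open>V_1\<close> removes the outermost strip, but in a chain of levels the outermost
  strip carries the largest label. The reversal of the indices accounts for the decreasing rows and
  columns of \<open>T''\<close>.\<close>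

lemma vchain_eq_dchain: "vchain M n F = dchain (\<lambda>k. M (Suc n - k)) n F"
proof (induction n arbitrary: M)
  case (Suc n)
  have "vchain M (Suc n) F = dact (M 1) (dchain (\<lambda>k. M (Suc (Suc n - k))) n F)"
    unfolding vchain_Suc_left Suc ..
  also have "dchain (\<lambda>k. M (Suc (Suc n - k))) n F = dchain (\<lambda>k. M (Suc (Suc n) - k)) n F"
    by (rule dchain_cong) (simp add: Suc_diff_le)
  finally show ?case by simp
qed simp

section \<open>Strip weights and tableau conditions\<close>

lemma prod_levels:
  fixes y :: "nat \<Rightarrow> 'a::comm_ring_1"
  assumes T: "T \<in> fill n \<alpha> \<beta>" and a: "\<alpha> \<in> Par L" and b: "\<beta> \<in> Par L"
  shows "(\<Prod>k\<in>{1..n}. \<Prod>i\<le>L. y k ^ (level \<alpha> \<beta> T k i - level \<alpha> \<beta> T (k - 1) i)) = (\<Prod>b\<in>skew \<alpha> \<beta>. y (T b))"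
proof -
  have "(\<Prod>b\<in>skew \<alpha> \<beta>. y (T b)) =
    (\<Prod>ki\<in>{1..n} \<times> {..L}. \<Prod>b\<in>{b \<in> skew \<alpha> \<beta>. (T b, fst b) = ki}. y (T b))"
    by (rule prod.group[symmetric]) (use finite_skew[OF a b] fillD(2)[OF T] skew_row[OF a b] in auto)
  also have "\<dots> = (\<Prod>(k, i)\<in>{1..n} \<times> {..L}. y k ^ (level \<alpha> \<beta> T k i - level \<alpha> \<beta> T (k - 1) i))"
  proof (rule prod.cong[OF refl], clarify)
    fix k i assume "k \<in> {1..n}"
    have "(\<Prod>b\<in>{b \<in> skew \<alpha> \<beta>. (T b, fst b) = (k, i)}. y (T b)) = (\<Prod>b\<in>{b \<in> skew \<alpha> \<beta>. T b = k \<and> fst b = i}. y k)"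
      by (rule prod.cong) auto
    then show "(\<Prod>b\<in>{b \<in> skew \<alpha> \<beta>. (T b, fst b) = (k, i)}. y (T b)) =
        y k ^ (level \<alpha> \<beta> T k i - level \<alpha> \<beta> T (k - 1) i)"
      using \<open>k \<in> {1..n}\<close> by (simp add: level_diff del: One_nat_def)
  qed
  finally show ?thesis by (simp add: prod.cartesian_product)
qed

lemma hs_levels:
  assumes T: "T \<in> fill n \<alpha> \<beta>" and a: "\<alpha> \<in> Par L" and b: "\<beta> \<in> Par L" and le: "\<alpha> \<le> \<beta>"
  shows "(\<forall>k\<in>{1..n}. hs (level \<alpha> \<beta> T (k - 1)) (level \<alpha> \<beta> T k)) \<longleftrightarrow>
    (\<forall>i i' j. (i, j) \<in> skew \<alpha> \<beta> \<and> (i', j) \<in> skew \<alpha> \<beta> \<and> i < i' \<longrightarrow> T (i, j) < T (i', j))"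
    (is "?l \<longleftrightarrow> ?r")
proof
  assume l: ?l
  show ?r
  proof (intro allI impI, elim conjE)
    fix i i' j assume ij: "(i, j) \<in> skew \<alpha> \<beta>" "(i', j) \<in> skew \<alpha> \<beta>" "i < i'"
    define k where "k = T (i', j)"
    have k: "k \<in> {1..n}" using fillD(2)[OF T ij(2)] by (simp add: k_def)
    have "j \<le> level \<alpha> \<beta> T k i'" using level_iff[OF T ij(2), of k] by (simp add: k_def)
    also have "\<dots> \<le> level \<alpha> \<beta> T k (Suc i)"
      using Par_antimono[OF level_Par[OF T a b le]] ij(3) by simp
    also have "\<dots> \<le> level \<alpha> \<beta> T (k - 1) i" using l k by (auto simp: hs_def)
    finally have "T (i, j) \<le> k - 1" using level_iff[OF T ij(1)] by simp
    then show "T (i, j) < T (i', j)" using k by (auto simp: k_def)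
  qed
next
  assume r: ?r
  show ?l
  proof
    fix k assume k: "k \<in> {1..n}"
    have "level \<alpha> \<beta> T k (Suc i) \<le> level \<alpha> \<beta> T (k - 1) i" for i
    proof (rule level_le_level[OF T])
      fix j assume "(i, j) \<in> skew \<alpha> \<beta>" "(Suc i, j) \<in> skew \<alpha> \<beta>" "T (Suc i, j) \<le> k"
      then show "T (i, j) \<le> k - 1" using r[rule_format, of i j "Suc i"] by auto
    qed (use Par_Suc[OF a] Par_Suc[OF b] le_funD[OF le] in auto)
    then show "hs (level \<alpha> \<beta> T (k - 1)) (level \<alpha> \<beta> T k)" by (simp add: hs_def level_mono)
  qed
qed

text \<open>Freezing the rows \<open>i < k\<close> in step \<open>k\<close> is the weak row bound. A
  label is then at most its row, hence at most \<open>L\<close>, so limiting the labels to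
  \<open>{1..L}\<close> loses no tableau.\<close>

lemma wt_hstep:
  fixes y :: "nat \<Rightarrow> 'a::comm_ring_1"
  assumes a: "\<alpha> \<in> Par L" and b: "\<beta> \<in> Par L" and le: "\<alpha> \<le> \<beta>"
  shows "wt (\<lambda>k. hstep k (y k)) L \<alpha> \<beta> =
    (\<Sum>T\<in>{T \<in> tableaux (skew \<alpha> \<beta>). semistandard (skew \<alpha> \<beta>) T \<and> row_weakly_bounded (skew \<alpha> \<beta>) T}.
       \<Prod>b\<in>skew \<alpha> \<beta>. y (T b))"
proof -
  define Q where "Q = (\<lambda>T. (\<forall>i i' j. (i, j) \<in> skew \<alpha> \<beta> \<and> (i', j) \<in> skew \<alpha> \<beta> \<and> i < i' \<longrightarrow> T (i, j) < (T (i', j)::nat)) \<and>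
     row_weakly_bounded (skew \<alpha> \<beta>) T)"
  have "(\<Prod>k\<in>{1..L}. hstep k (y k) (level \<alpha> \<beta> T (k - 1)) (level \<alpha> \<beta> T k)) =
      (if Q T then \<Prod>b\<in>skew \<alpha> \<beta>. y (T b) else 0)" if T: "T \<in> fill L \<alpha> \<beta>" for T
  proof -
    have "(\<forall>k\<in>{1..L}. \<forall>i<k. level \<alpha> \<beta> T k i = level \<alpha> \<beta> T (k - 1) i) \<longleftrightarrow> row_weakly_bounded (skew \<alpha> \<beta>) T"
      unfolding row_levels[OF T, of "\<lambda>k i. i < k"] row_weakly_bounded_def not_less by auto
    then have iff: "(\<forall>k\<in>{1..L}. hs (level \<alpha> \<beta> T (k - 1)) (level \<alpha> \<beta> T k) \<and>
        (\<forall>i<k. level \<alpha> \<beta> T k i = level \<alpha> \<beta> T (k - 1) i)) \<longleftrightarrow> Q T"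
      unfolding Q_def using hs_levels[OF T a b le] by blast
    show ?thesis
      unfolding hstep_def prod_if_zero[OF finite_atLeastAtMost] iff prod_levels[OF T a b] ..
  qed
  then have "wt (\<lambda>k. hstep k (y k)) L \<alpha> \<beta> = (\<Sum>T\<in>fill L \<alpha> \<beta>. if Q T then \<Prod>b\<in>skew \<alpha> \<beta>. y (T b) else 0)"
    using le by (simp add: wt_def)
  also have "\<dots> = (\<Sum>T\<in>{T \<in> fill L \<alpha> \<beta>. Q T}. \<Prod>b\<in>skew \<alpha> \<beta>. y (T b))"
    by (rule sum_if_filter) (rule finite_fill[OF a b])
  also have "{T \<in> fill L \<alpha> \<beta>. Q T} =
      {T \<in> tableaux (skew \<alpha> \<beta>). semistandard (skew \<alpha> \<beta>) T \<and> row_weakly_bounded (skew \<alpha> \<beta>) T}" (is "?A = ?B")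
  proof
    show "?A \<subseteq> ?B"
    proof
      fix T assume T: "T \<in> ?A"
      then have f: "T \<in> fill L \<alpha> \<beta>" and q: "Q T" by auto
      have "T \<in> tableaux (skew \<alpha> \<beta>)"
        unfolding tableaux_def using fillD(1)[OF f] PiE_mono[of _ "\<lambda>_. {1..L}" "\<lambda>_. {1..}"] by auto
      moreover have "semistandard (skew \<alpha> \<beta>) T"
        unfolding semistandard_def using q fillD(3)[OF f] by (simp add: Q_def)
      ultimately show "T \<in> ?B" using q by (simp add: Q_def)
    qed
    show "?B \<subseteq> ?A"
    proof
      fix T assume T: "T \<in> ?B"
      have "T x \<in> {1..L}" if x: "x \<in> skew \<alpha> \<beta>" for x
      proof -
        have "T x \<in> {1..}" using T x by (auto simp: tableaux_def intro: PiE_mem)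
        moreover have "T x \<le> fst x" using T x by (cases x) (auto simp: row_weakly_bounded_def)
        moreover have "fst x \<le> L" using skew_row[OF a b, of "fst x" "snd x"] x by simp
        ultimately show ?thesis by simp
      qed
      moreover have "T (i, j) \<le> T (i, j')" if "(i, j) \<in> skew \<alpha> \<beta>" "(i, j') \<in> skew \<alpha> \<beta>" "j \<le> j'" for i j j'
        using T that by (cases "j = j'") (auto simp: semistandard_def)
      moreover have "T (i, j) \<le> T (i', j)" if "(i, j) \<in> skew \<alpha> \<beta>" "(i', j) \<in> skew \<alpha> \<beta>" "i \<le> i'" for i i' j
        using T that by (cases "i = i'") (auto simp: semistandard_def intro: less_imp_le)
      ultimately show "T \<in> ?A" using T
        by (simp add: fill_def Q_def tableaux_def semistandard_def PiE_iff)
    qed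
  qed
  finally show ?thesis .
qed

text \<open>Step \<open>k\<close> stands for the label \<open>Suc L - k\<close>. Vertical strips
  make the rows strict, and freezing the rows \<open>i \<le> Suc L - k\<close> is the strict row
  bound for that label.\<close>

lemma wt_vstep:
  fixes y :: "nat \<Rightarrow> 'a::comm_ring_1"
  assumes a: "\<alpha> \<in> Par L" and b: "\<beta> \<in> Par L" and le: "\<alpha> \<le> \<beta>"
  shows "wt (\<lambda>k. vstep (Suc L - k) (y (Suc L - k))) L \<alpha> \<beta> =
    (\<Sum>T\<in>{T \<in> tableaux (skew \<alpha> \<beta>). reverse_row_strict (skew \<alpha> \<beta>) T \<and> row_bounded (skew \<alpha> \<beta>) T}.
       \<Prod>b\<in>skew \<alpha> \<beta>. y (T b))"
proof -
  define Q where "Q = (\<lambda>T. (\<forall>i j j'. (i, j) \<in> skew \<alpha> \<beta> \<and> (i, j') \<in> skew \<alpha> \<beta> \<and> j < j' \<longrightarrow> T (i, j) < (T (i, j')::nat)) \<and>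
     (\<forall>i j. (i, j) \<in> skew \<alpha> \<beta> \<longrightarrow> Suc L - T (i, j) < i))"
  have "(\<Prod>k\<in>{1..L}. vstep (Suc L - k) (y (Suc L - k)) (level \<alpha> \<beta> T (k - 1)) (level \<alpha> \<beta> T k)) =
      (if Q T then \<Prod>b\<in>skew \<alpha> \<beta>. y (Suc L - T b) else 0)" if T: "T \<in> fill L \<alpha> \<beta>" for T
  proof -
    have "(\<forall>k\<in>{1..L}. \<forall>i\<le>Suc L - k. level \<alpha> \<beta> T k i = level \<alpha> \<beta> T (k - 1) i) \<longleftrightarrow>
      (\<forall>i j. (i, j) \<in> skew \<alpha> \<beta> \<longrightarrow> Suc L - T (i, j) < i)"
      unfolding row_levels[OF T, of "\<lambda>k i. i \<le> Suc L - k"] not_le ..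
    then have iff: "(\<forall>k\<in>{1..L}. vs (level \<alpha> \<beta> T (k - 1)) (level \<alpha> \<beta> T k) \<and>
        (\<forall>i\<le>Suc L - k. level \<alpha> \<beta> T k i = level \<alpha> \<beta> T (k - 1) i)) \<longleftrightarrow> Q T"
      unfolding Q_def using vs_levels[OF T le] by blast
    show ?thesis
      unfolding vstep_def prod_if_zero[OF finite_atLeastAtMost] iff
        prod_levels[OF T a b, of "\<lambda>k. y (Suc L - k)"] ..
  qed
  then have "wt (\<lambda>k. vstep (Suc L - k) (y (Suc L - k))) L \<alpha> \<beta> =
      (\<Sum>T\<in>fill L \<alpha> \<beta>. if Q T then \<Prod>b\<in>skew \<alpha> \<beta>. y (Suc L - T b) else 0)"
    using le by (simp add: wt_def)
  also have "\<dots> = (\<Sum>T\<in>{T \<in> fill L \<alpha> \<beta>. Q T}. \<Prod>b\<in>skew \<alpha> \<beta>. y (Suc L - T b))"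
    by (rule sum_if_filter) (rule finite_fill[OF a b])
  also have "\<dots> = (\<Sum>T\<in>{T \<in> tableaux (skew \<alpha> \<beta>). reverse_row_strict (skew \<alpha> \<beta>) T \<and> row_bounded (skew \<alpha> \<beta>) T}.
       \<Prod>b\<in>skew \<alpha> \<beta>. y (T b))" (is "sum _ ?A = sum _ ?B")
  proof -
    \<comment> \<open>The reflection of \<open>{1..L}\<close> applied to all labels; it is an
      involution and serves as both directions of the bijection.\<close>
    define r where "r = (\<lambda>T. restrict (\<lambda>b. Suc L - T b) (skew \<alpha> \<beta>))"
    have rA: "r T \<in> ?B" "r (r T) = T" if T: "T \<in> ?A" for T
    proof -
      have f: "T \<in> fill L \<alpha> \<beta>" and q: "Q T" using T by auto
      have lab: "1 \<le> T b \<and> T b \<le> L" if "b \<in> skew \<alpha> \<beta>" for b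
        using fillD(2)[OF f, of "fst b" "snd b"] that by simp
      show "r (r T) = T"
      proof
        fix x show "r (r T) x = T x"
          using lab[of x] PiE_arb[OF fillD(1)[OF f], of x] by (cases "x \<in> skew \<alpha> \<beta>") (simp_all add: r_def)
      qed
      have "Suc L - T x \<in> {1..}" if "x \<in> skew \<alpha> \<beta>" for x using lab[OF that] unfolding atLeast_iff by linarith
      then have "r T \<in> tableaux (skew \<alpha> \<beta>)" by (simp add: tableaux_def r_def)
      moreover have "reverse_row_strict (skew \<alpha> \<beta>) (r T)"
        unfolding reverse_row_strict_def
      proof (intro conjI allI impI; elim conjE)
        fix i j j' assume ij: "(i, j) \<in> skew \<alpha> \<beta>" "(i, j') \<in> skew \<alpha> \<beta>" "j < j'"
        then have "T (i, j) < T (i, j')" using q unfolding Q_def by blast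
        then show "r T (i, j') < r T (i, j)" using lab[OF ij(2)] ij by (simp add: r_def)
      next
        fix i i' j assume ij: "(i, j) \<in> skew \<alpha> \<beta>" "(i', j) \<in> skew \<alpha> \<beta>" "i < i'"
        then show "r T (i', j) \<le> r T (i, j)" using fillD(4)[OF f ij(1,2)] by (simp add: r_def)
      qed
      moreover have "row_bounded (skew \<alpha> \<beta>) (r T)"
        using q by (auto simp: row_bounded_def Q_def r_def)
      ultimately show "r T \<in> ?B" by simp
    qed
    have rB: "r T \<in> ?A" "r (r T) = T" if T: "T \<in> ?B" for T
    proof -
      have lab: "1 \<le> T (i, j) \<and> T (i, j) \<le> L \<and> T (i, j) < i" if "(i, j) \<in> skew \<alpha> \<beta>" for i j
      proof -
        have "T (i, j) \<in> {1..}" using T that by (auto simp: tableaux_def intro: PiE_mem)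
        moreover have "T (i, j) < i" using T that by (auto simp: row_bounded_def)
        ultimately show ?thesis using skew_row[OF a b that] by simp
      qed
      have tE: "T \<in> skew \<alpha> \<beta> \<rightarrow>\<^sub>E {1..}" using T by (simp add: tableaux_def)
      show "r (r T) = T"
      proof
        fix x show "r (r T) x = T x"
          using lab[of "fst x" "snd x"] PiE_arb[OF tE, of x]
          by (cases "x \<in> skew \<alpha> \<beta>") (simp_all add: r_def)
      qed
      have rr: "T (i, j') < T (i, j)" if "(i, j) \<in> skew \<alpha> \<beta>" "(i, j') \<in> skew \<alpha> \<beta>" "j < j'" for i j j'
        using T that by (auto simp: reverse_row_strict_def)
      have rc: "T (i', j) \<le> T (i, j)" if "(i, j) \<in> skew \<alpha> \<beta>" "(i', j) \<in> skew \<alpha> \<beta>" "i \<le> i'" for i i' j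
        using T that by (cases "i = i'") (auto simp: reverse_row_strict_def)
      have "r T \<in> fill L \<alpha> \<beta>"
      proof -
        have "Suc L - T x \<in> {1..L}" if "x \<in> skew \<alpha> \<beta>" for x
          using lab[of "fst x" "snd x"] that by auto
        then have "r T \<in> skew \<alpha> \<beta> \<rightarrow>\<^sub>E {1..L}" by (simp add: r_def)
        moreover have "r T (i, j) \<le> r T (i, j')"
          if "(i, j) \<in> skew \<alpha> \<beta>" "(i, j') \<in> skew \<alpha> \<beta>" "j \<le> j'" for i j j'
          using rr[of i j j'] that by (cases "j = j'") (auto simp: r_def)
        moreover have "r T (i, j) \<le> r T (i', j)"
          if "(i, j) \<in> skew \<alpha> \<beta>" "(i', j) \<in> skew \<alpha> \<beta>" "i \<le> i'" for i i' j
          using rc[of i j i'] that by (auto simp: r_def)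
        ultimately show ?thesis by (simp add: fill_def)
      qed
      moreover have "Q (r T)"
        unfolding Q_def
      proof (intro conjI allI impI; (elim conjE)?)
        fix i j j' assume ij: "(i, j) \<in> skew \<alpha> \<beta>" "(i, j') \<in> skew \<alpha> \<beta>" "j < j'"
        show "r T (i, j) < r T (i, j')"
          using rr[OF ij] lab[OF ij(1)] lab[OF ij(2)] ij by (simp add: r_def diff_less_mono2)
      next
        fix i j assume ij: "(i, j) \<in> skew \<alpha> \<beta>"
        show "Suc L - r T (i, j) < i" using lab[OF ij] ij by (simp add: r_def)
      qed
      ultimately show "r T \<in> ?A" by simp
    qed
    show ?thesis
      by (rule sum.reindex_bij_witness[where i = r and j = r])
         (use rA rB in \<open>auto simp: r_def intro!: prod.cong\<close>)
  qed
  finally show ?thesis .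
qed

end

section \<open>Set-valued tableaux\<close>

text \<open>Bounding the labels makes the set finite without fixing a content, so that all contents
  can be summed at once.\<close>

definition svn :: "nat \<Rightarrow> box set \<Rightarrow> (box \<Rightarrow> nat set) set" where
  "svn n S = {T \<in> sv_tableaux S. sv_semistandard S T \<and> (\<forall>b\<in>S. T b \<subseteq> {..n})}"

text \<open>With \<open>T\<close> as the tableau of minima, these are the labels that box
  \<open>b\<close> can take in addition. The set-valued conditions compare the maximum of a box with
  the minimum of its neighbour, so the boxes can be enlarged independently of each other.\<close>

definition room :: "nat \<Rightarrow> box set \<Rightarrow> (box \<Rightarrow> nat) \<Rightarrow> box \<Rightarrow> nat set" where
  "room n S T b = {k \<in> {T b<..n}. (case b of (i, j) \<Rightarrow>
     ((i, Suc j) \<in> S \<longrightarrow> k \<le> T (i, Suc j)) \<and> ((Suc i, j) \<in> S \<longrightarrow> k < T (Suc i, j)))}"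

definition column_strict :: "box set \<Rightarrow> (box \<Rightarrow> nat) \<Rightarrow> bool" where
  "column_strict S T \<longleftrightarrow> (\<forall>i i' j. (i, j) \<in> S \<and> (i', j) \<in> S \<and> i < i' \<longrightarrow> T (i, j) < T (i', j))"

lemma finite_room [simp]: "finite (room n S T b)"
  by (simp add: room_def)

lemma skew_row_mono:
  fixes f :: "box \<Rightarrow> nat"
  assumes "\<And>j. (i, j) \<in> skew \<alpha> \<beta> \<Longrightarrow> (i, Suc j) \<in> skew \<alpha> \<beta> \<Longrightarrow> f (i, j) \<le> f (i, Suc j)"
    and "(i, j) \<in> skew \<alpha> \<beta>"
  shows "j \<le> j' \<Longrightarrow> (i, j') \<in> skew \<alpha> \<beta> \<Longrightarrow> f (i, j) \<le> f (i, j')"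
proof (induction j' rule: dec_induct)
  case (step m)
  then have "(i, m) \<in> skew \<alpha> \<beta>" using assms(2) by (auto simp: skew_def)
  then show ?case using step assms(1)[of m] by auto
qed simp

definition sv_gf :: "(nat \<Rightarrow> 'a::comm_ring_1) \<Rightarrow> (nat \<Rightarrow> 'a) \<Rightarrow> nat \<Rightarrow> box set \<Rightarrow> 'a" where
  "sv_gf x t n S = (\<Sum>T\<in>svn n S. \<Prod>b\<in>S. (\<Prod>k\<in>T b. x k) * t (fst b) ^ (card (T b) - 1))"

definition above_tab :: "box set \<Rightarrow> (box \<Rightarrow> nat) set" where
  "above_tab S = {T \<in> tableaux S. semistandard S T \<and> row_weakly_bounded S T}"

definition below_tab :: "box set \<Rightarrow> (box \<Rightarrow> nat) set" where
  "below_tab S = {T \<in> tableaux S. reverse_row_strict S T \<and> row_bounded S T}"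

context frame
begin

lemma skew_column_convex:
  assumes "\<alpha> \<in> Par L" "\<beta> \<in> Par L" "(i, j) \<in> skew \<alpha> \<beta>" "(i', j) \<in> skew \<alpha> \<beta>" "i \<le> m" "m \<le> i'"
  shows "(m, j) \<in> skew \<alpha> \<beta>"
  using assms(3,4) Par_antimono[OF assms(1,5)] Par_antimono[OF assms(2,6)] by (auto simp: skew_def)

lemma skew_column_mono:
  fixes f :: "box \<Rightarrow> nat"
  assumes a: "\<alpha> \<in> Par L" and b: "\<beta> \<in> Par L"
    and f: "\<And>i. (i, j) \<in> skew \<alpha> \<beta> \<Longrightarrow> (Suc i, j) \<in> skew \<alpha> \<beta> \<Longrightarrow> f (i, j) < f (Suc i, j)"
    and i: "(i, j) \<in> skew \<alpha> \<beta>"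
  shows "Suc i \<le> i' \<Longrightarrow> (i', j) \<in> skew \<alpha> \<beta> \<Longrightarrow> f (i, j) < f (i', j)"
proof (induction i' rule: dec_induct)
  case base
  then show ?case using f[OF i] by simp
next
  case (step m)
  then have "(m, j) \<in> skew \<alpha> \<beta>" by (intro skew_column_convex[OF a b i, of "Suc m" m]) auto
  then show ?case using step f[of m] by auto
qed

text \<open>The box has to be the last one of level \<open>k - 1\<close> in its row, with nothing of
  level \<open>k\<close> below it. These are the corners that \<open>up_sv\<close> weights in step
  \<open>k\<close>.\<close>

lemma room_iff:
  assumes T: "T \<in> fill n \<alpha> \<beta>" and a: "\<alpha> \<in> Par L" and b: "\<beta> \<in> Par L" and le: "\<alpha> \<le> \<beta>"
    and ij: "(i, j) \<in> skew \<alpha> \<beta>" and k: "k \<in> {1..n}"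
  shows "k \<in> room n (skew \<alpha> \<beta>) T (i, j) \<longleftrightarrow>
    j = level \<alpha> \<beta> T (k - 1) i \<and> level \<alpha> \<beta> T k (Suc i) < j"
proof -
  have "T (i, j) < k \<longleftrightarrow> j \<le> level \<alpha> \<beta> T (k - 1) i"
    using level_iff[OF T ij, of "k - 1"] k by auto
  moreover have "((i, Suc j) \<in> skew \<alpha> \<beta> \<longrightarrow> k \<le> T (i, Suc j)) \<longleftrightarrow> \<not> Suc j \<le> level \<alpha> \<beta> T (k - 1) i"
  proof (cases "(i, Suc j) \<in> skew \<alpha> \<beta>")
    case True
    then show ?thesis using level_iff[OF T True, of "k - 1"] k by auto
  next
    case False
    then have "\<beta> i < Suc j" using ij by (auto simp: skew_def)
    then show ?thesis using level_le_outer[OF le, of T "k - 1" i] False by simp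
  qed
  moreover have "((Suc i, j) \<in> skew \<alpha> \<beta> \<longrightarrow> k < T (Suc i, j)) \<longleftrightarrow> \<not> j \<le> level \<alpha> \<beta> T k (Suc i)"
  proof (cases "(Suc i, j) \<in> skew \<alpha> \<beta>")
    case True
    then show ?thesis using level_iff[OF T True, of k] by auto
  next
    case False
    then have "\<beta> (Suc i) < j" using ij Par_Suc[OF a, of i] by (auto simp: skew_def)
    then show ?thesis using level_le_outer[OF le, of T k "Suc i"] False by simp
  qed
  ultimately show ?thesis using k by (auto simp: room_def)
qed

lemma prod_room:
  fixes g :: "nat \<Rightarrow> nat \<Rightarrow> 'a::comm_ring_1"
  assumes T: "T \<in> fill n \<alpha> \<beta>" and a: "\<alpha> \<in> Par L" and b: "\<beta> \<in> Par L" and le: "\<alpha> \<le> \<beta>"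
  shows "(\<Prod>k\<in>{1..n}. \<Prod>i\<in>{1..L}.
      if level \<alpha> \<beta> T k (Suc i) < level \<alpha> \<beta> T (k - 1) i \<and> \<alpha> i < level \<alpha> \<beta> T (k - 1) i then g k i else 1) =
    (\<Prod>b\<in>skew \<alpha> \<beta>. \<Prod>k\<in>room n (skew \<alpha> \<beta>) T b. g k (fst b))"
proof -
  define C where "C = (\<lambda>(k, i). level \<alpha> \<beta> T k (Suc i) < level \<alpha> \<beta> T (k - 1) i \<and> \<alpha> i < level \<alpha> \<beta> T (k - 1) i)"
  have "(\<Prod>k\<in>{1..n}. \<Prod>i\<in>{1..L}.
      if level \<alpha> \<beta> T k (Suc i) < level \<alpha> \<beta> T (k - 1) i \<and> \<alpha> i < level \<alpha> \<beta> T (k - 1) i then g k i else 1) =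
    (\<Prod>ki\<in>{1..n} \<times> {1..L}. if C ki then g (fst ki) (snd ki) else 1)"
    unfolding C_def prod.cartesian_product by (rule prod.cong) (auto split: if_splits)
  also have "\<dots> = (\<Prod>ki\<in>{ki \<in> {1..n} \<times> {1..L}. C ki}. g (fst ki) (snd ki))"
    by (simp add: prod.If_cases Int_def)
  \<comment> \<open>In a given row at most one box can absorb the label \<open>k\<close>, so a pair
    of label and row with a corner determines the box.\<close>
  also have "\<dots> = (\<Prod>bk\<in>(SIGMA b:skew \<alpha> \<beta>. room n (skew \<alpha> \<beta>) T b). g (snd bk) (fst (fst bk)))"
  proof (rule prod.reindex_bij_witness[where
      i = "\<lambda>(b, k). (k, fst b)" and j = "\<lambda>(k, i). ((i, level \<alpha> \<beta> T (k - 1) i), k)"], goal_cases)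
    case (2 ki)
    then obtain k i where ki: "ki = (k, i)" "k \<in> {1..n}" "C (k, i)" by auto
    have s: "(i, level \<alpha> \<beta> T (k - 1) i) \<in> skew \<alpha> \<beta>"
      using ki(3) level_le_outer[OF le] by (auto simp: C_def skew_def)
    then show ?case using room_iff[OF T a b le s ki(2)] ki by (simp add: C_def)
  next
    case (3 bk)
    then obtain i j k where bk: "bk = ((i, j), k)" "(i, j) \<in> skew \<alpha> \<beta>" "k \<in> room n (skew \<alpha> \<beta>) T (i, j)" by auto
    then have "k \<in> {1..n}" by (auto simp: room_def)
    then show ?case using room_iff[OF T a b le bk(2)] bk by simp
  next
    case (4 bk)
    then obtain i j k where bk: "bk = ((i, j), k)" "(i, j) \<in> skew \<alpha> \<beta>" "k \<in> room n (skew \<alpha> \<beta>) T (i, j)" by auto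
    then have k: "k \<in> {1..n}" by (auto simp: room_def)
    have "j = level \<alpha> \<beta> T (k - 1) i" "level \<alpha> \<beta> T k (Suc i) < j"
      using room_iff[OF T a b le bk(2) k] bk by auto
    moreover have "\<alpha> i < j" using bk(2) by (auto simp: skew_def)
    ultimately show ?case using bk k skew_row[OF a b bk(2)] by (simp add: C_def)
  qed auto
  also have "\<dots> = (\<Prod>b\<in>skew \<alpha> \<beta>. \<Prod>k\<in>room n (skew \<alpha> \<beta>) T b. g k (fst b))"
    by (subst prod.Sigma) (auto simp: finite_skew[OF a b] split_beta)
  finally show ?thesis .
qed

text \<open>A set-valued tableau is the semistandard tableau of its minima together with an
  arbitrary subset of \<open>room\<close> in each box. Expanding the product of the factors
  \<open>1 + x k * t (fst b)\<close> runs over these subsets.\<close>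

lemma svn_weight:
  fixes x t :: "nat \<Rightarrow> 'a::comm_ring_1"
  assumes a: "\<alpha> \<in> Par L" and b: "\<beta> \<in> Par L"
  shows "(\<Sum>T\<in>{T \<in> fill n \<alpha> \<beta>. column_strict (skew \<alpha> \<beta>) T}.
      (\<Prod>b\<in>skew \<alpha> \<beta>. x (T b)) * (\<Prod>b\<in>skew \<alpha> \<beta>. \<Prod>k\<in>room n (skew \<alpha> \<beta>) T b. 1 + x k * t (fst b))) =
    (\<Sum>T\<in>svn n (skew \<alpha> \<beta>). \<Prod>b\<in>skew \<alpha> \<beta>. (\<Prod>k\<in>T b. x k) * t (fst b) ^ (card (T b) - 1))"
proof -
  define S where "S = skew \<alpha> \<beta>"
  define A where "A = {T \<in> fill n \<alpha> \<beta>. column_strict S T}"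
  define P where "P = (\<lambda>T E. \<Prod>b\<in>S. x (T b) * (\<Prod>k\<in>E b. x k * t (fst b)))"
  have finS: "finite S" unfolding S_def by (rule finite_skew[OF a b])
  have "(\<Sum>T\<in>A. (\<Prod>b\<in>S. x (T b)) * (\<Prod>b\<in>S. \<Prod>k\<in>room n S T b. 1 + x k * t (fst b))) =
    (\<Sum>T\<in>A. \<Sum>E\<in>PiE S (\<lambda>b. Pow (room n S T b)). P T E)"
  proof (rule sum.cong[OF refl])
    fix T assume "T \<in> A"
    have "(\<Prod>k\<in>room n S T b. 1 + x k * t (fst b)) = (\<Sum>X\<in>Pow (room n S T b). \<Prod>k\<in>X. x k * t (fst b))" for b
      using prod_add[OF finite_room, of "\<lambda>k. x k * t (fst b)" "\<lambda>_. 1" n S T b] by (simp add: add.commute)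
    then have "(\<Prod>b\<in>S. \<Prod>k\<in>room n S T b. 1 + x k * t (fst b)) =
      (\<Sum>E\<in>PiE S (\<lambda>b. Pow (room n S T b)). \<Prod>b\<in>S. \<Prod>k\<in>E b. x k * t (fst b))"
      by (simp add: prod_sum_PiE finS)
    then show "(\<Prod>b\<in>S. x (T b)) * (\<Prod>b\<in>S. \<Prod>k\<in>room n S T b. 1 + x k * t (fst b)) =
      (\<Sum>E\<in>PiE S (\<lambda>b. Pow (room n S T b)). P T E)"
      by (simp add: sum_distrib_left P_def prod.distrib)
  qed
  also have "\<dots> = (\<Sum>(T, E)\<in>(SIGMA T:A. PiE S (\<lambda>b. Pow (room n S T b))). P T E)"
    by (rule sum.Sigma) (auto simp: A_def finite_fill[OF a b] finS intro!: finite_PiE)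
  also have "\<dots> = (\<Sum>T\<in>svn n S. \<Prod>b\<in>S. (\<Prod>k\<in>T b. x k) * t (fst b) ^ (card (T b) - 1))"
  proof (rule sum.reindex_bij_witness[where
      i = "\<lambda>T. (restrict (\<lambda>b. Min (T b)) S, restrict (\<lambda>b. T b - {Min (T b)}) S)" and
      j = "\<lambda>(T, E). restrict (\<lambda>b. insert (T b) (E b)) S"])
    fix p assume p: "p \<in> (SIGMA T:A. PiE S (\<lambda>b. Pow (room n S T b)))"
    obtain T E where TE: "p = (T, E)" by (cases p)
    define U where "U = restrict (\<lambda>b. insert (T b) (E b)) S"
    have f: "T \<in> fill n \<alpha> \<beta>" and cs: "column_strict S T"
      and E: "E \<in> PiE S (\<lambda>b. Pow (room n S T b))" using p by (auto simp: TE A_def)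
    have Tr: "1 \<le> T b \<and> T b \<le> n" if "b \<in> S" for b
      using fillD(2)[OF f, of "fst b" "snd b"] that by (simp add: S_def)
    have Er: "E b \<subseteq> room n S T b" if "b \<in> S" for b using E that by auto
    have finE: "finite (E b)" if "b \<in> S" for b using finite_subset[OF Er[OF that]] by simp
    have gt: "T b < k" if "b \<in> S" "k \<in> E b" for b k
      using Er[OF that(1)] that(2) by (auto simp: room_def)
    have nin: "T b \<notin> E b" if "b \<in> S" for b using gt[OF that] by blast
    have U: "U b = insert (T b) (E b)" if "b \<in> S" for b using that by (simp add: U_def)
    have minU: "Min (U b) = T b" if "b \<in> S" for b
      unfolding U[OF that] using finE[OF that] gt[OF that]
      by (intro Min_eqI) (auto intro: less_imp_le)
    have "restrict (\<lambda>b. Min (U b)) S = T"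
      using minU PiE_arb[OF fillD(1)[OF f]] by (auto simp: fun_eq_iff S_def restrict_def)
    moreover have "restrict (\<lambda>b. U b - {Min (U b)}) S = E"
    proof
      fix b show "restrict (\<lambda>b. U b - {Min (U b)}) S b = E b"
        using minU[of b] U[of b] nin[of b] PiE_arb[OF E, of b] by (cases "b \<in> S") auto
    qed
    ultimately show "(\<lambda>T. (restrict (\<lambda>b. Min (T b)) S, restrict (\<lambda>b. T b - {Min (T b)}) S))
        ((\<lambda>(T, E). restrict (\<lambda>b. insert (T b) (E b)) S) p) = p"
      by (simp add: TE U_def)
    show "(\<lambda>(T, E). restrict (\<lambda>b. insert (T b) (E b)) S) p \<in> svn n S"
    proof -
      have "U b \<noteq> {} \<and> finite (U b) \<and> U b \<subseteq> {1..} \<and> U b \<subseteq> {..n}" if "b \<in> S" for b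
      proof -
        have "k \<in> {1..n}" if "k \<in> E b" for k
          using gt[OF \<open>b \<in> S\<close> that] Tr[OF \<open>b \<in> S\<close>] subsetD[OF Er[OF \<open>b \<in> S\<close>] that] by (simp add: room_def)
        then show ?thesis using U[OF that] finE[OF that] Tr[OF that] by auto
      qed
      then have "U \<in> sv_tableaux S" "\<forall>b\<in>S. U b \<subseteq> {..n}"
        unfolding sv_tableaux_def by (auto simp: U_def)
      moreover have "sv_semistandard S U"
        unfolding sv_semistandard_def
      proof (intro conjI allI impI; elim conjE)
        fix i j assume ij: "(i, j) \<in> S" "(i, Suc j) \<in> S"
        have "k \<le> T (i, Suc j)" if "k \<in> U (i, j)" for k
          using that U[OF ij(1)] Er[OF ij(1)] ij fillD(3)[OF f, of i j "Suc j"]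
          by (auto simp: room_def S_def)
        then show "Max (U (i, j)) \<le> Min (U (i, Suc j))"
          unfolding minU[OF ij(2)] using U[OF ij(1)] finE[OF ij(1)] by (intro Max.boundedI) auto
      next
        fix i j assume ij: "(i, j) \<in> S" "(Suc i, j) \<in> S"
        have "T (i, j) < T (Suc i, j)" using cs ij unfolding column_strict_def by blast
        then have "k < T (Suc i, j)" if "k \<in> U (i, j)" for k
          using that U[OF ij(1)] Er[OF ij(1)] ij by (auto simp: room_def)
        moreover have "Max (U (i, j)) \<in> U (i, j)" using U[OF ij(1)] finE[OF ij(1)] by (intro Max_in) auto
        ultimately show "Max (U (i, j)) < Min (U (Suc i, j))" unfolding minU[OF ij(2)] by blast
      qed
      ultimately show ?thesis by (simp add: svn_def TE U_def)
    qed
    show "(\<Prod>b\<in>S. (\<Prod>k\<in>(\<lambda>(T, E). restrict (\<lambda>b. insert (T b) (E b)) S) p b. x k) *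
       t (fst b) ^ (card ((\<lambda>(T, E). restrict (\<lambda>b. insert (T b) (E b)) S) p b) - 1)) = (\<lambda>(T, E). P T E) p"
      unfolding TE prod.case P_def
      by (intro prod.cong refl) (simp add: finE nin prod.distrib ac_simps)
  next
    fix T assume T: "T \<in> svn n S"
    define T0 where "T0 = restrict (\<lambda>b. Min (T b)) S"
    define E where "E = restrict (\<lambda>b. T b - {Min (T b)}) S"
    have Tb: "T b \<noteq> {}" "finite (T b)" "T b \<subseteq> {1..}" "T b \<subseteq> {..n}" if "b \<in> S" for b
      using T that by (auto simp: svn_def sv_tableaux_def PiE_iff)
    have Tarb: "T b = undefined" if "b \<notin> S" for b
      using T that unfolding svn_def sv_tableaux_def by (blast intro: PiE_arb)
    have min: "Min (T b) \<in> T b" if "b \<in> S" for b using Tb[OF that] by simp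
    have "restrict (\<lambda>b. insert (T0 b) (E b)) S = T"
    proof
      fix b show "restrict (\<lambda>b. insert (T0 b) (E b)) S b = T b"
        using min[of b] Tarb[of b] by (cases "b \<in> S") (auto simp: T0_def E_def)
    qed
    then show "(\<lambda>(T, E). restrict (\<lambda>b. insert (T b) (E b)) S)
      ((\<lambda>T. (restrict (\<lambda>b. Min (T b)) S, restrict (\<lambda>b. T b - {Min (T b)}) S)) T) = T"
      by (simp add: T0_def E_def)
    have r: "k \<le> Min (T (i, Suc j))" if "(i, j) \<in> S" "(i, Suc j) \<in> S" "k \<in> T (i, j)" for i j k
    proof -
      have "k \<le> Max (T (i, j))" using Tb[OF that(1)] that(3) by simp
      also have "\<dots> \<le> Min (T (i, Suc j))" using T that by (auto simp: svn_def sv_semistandard_def)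
      finally show ?thesis .
    qed
    have c: "k < Min (T (Suc i, j))" if "(i, j) \<in> S" "(Suc i, j) \<in> S" "k \<in> T (i, j)" for i j k
    proof -
      have "k \<le> Max (T (i, j))" using Tb[OF that(1)] that(3) by simp
      also have "\<dots> < Min (T (Suc i, j))" using T that by (auto simp: svn_def sv_semistandard_def)
      finally show ?thesis .
    qed
    \<comment> \<open>\<open>sv_semistandard\<close> speaks of adjacent boxes only; convexity of the
      rows and columns of a skew shape extends the comparison to all pairs.\<close>
    have rT: "T0 (i, j) \<le> T0 (i, j')" if "(i, j) \<in> S" "(i, j') \<in> S" "j \<le> j'" for i j j'
    proof (rule skew_row_mono[where \<alpha> = \<alpha> and \<beta> = \<beta> and f = T0])
      fix j assume "(i, j) \<in> skew \<alpha> \<beta>" "(i, Suc j) \<in> skew \<alpha> \<beta>"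
      then show "T0 (i, j) \<le> T0 (i, Suc j)" using r[OF _ _ min] by (simp add: T0_def S_def)
    qed (use that in \<open>simp_all add: S_def\<close>)
    have cT: "T0 (i, j) < T0 (i', j)" if "(i, j) \<in> S" "(i', j) \<in> S" "i < i'" for i i' j
    proof (rule skew_column_mono[OF a b, where f = T0])
      fix i assume "(i, j) \<in> skew \<alpha> \<beta>" "(Suc i, j) \<in> skew \<alpha> \<beta>"
      then show "T0 (i, j) < T0 (Suc i, j)" using c[OF _ _ min] by (simp add: T0_def S_def)
    qed (use that in \<open>simp_all add: S_def\<close>)
    have lab: "T0 b \<in> {1..n}" if "b \<in> S" for b
      using subsetD[OF Tb(3) min, OF that that] subsetD[OF Tb(4) min, OF that that] that by (simp add: T0_def)
    have "T0 \<in> S \<rightarrow>\<^sub>E {1..n}" using lab by (auto simp: PiE_iff T0_def)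
    moreover have "T0 (i, j) \<le> T0 (i', j)" if "(i, j) \<in> S" "(i', j) \<in> S" "i \<le> i'" for i i' j
      using cT[OF that(1,2)] that(3) by (cases "i = i'") auto
    ultimately have "T0 \<in> A" using rT cT by (simp add: A_def fill_def column_strict_def S_def)
    moreover have "E b \<subseteq> room n S T0 b" if bS: "b \<in> S" for b
    proof
      fix k assume k: "k \<in> E b"
      obtain i j where ij: "b = (i, j)" by (cases b)
      have k': "k \<in> T b" "k \<noteq> Min (T b)" using k bS by (auto simp: E_def)
      then have "Min (T b) < k" using Tb[OF bS] by (simp add: le_neq_trans)
      moreover have "k \<le> n" using Tb(4)[OF bS] k' by auto
      ultimately show "k \<in> room n S T0 b"
        using r[of i j k] c[of i j k] k'(1) bS by (auto simp: room_def ij T0_def)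
    qed
    ultimately show "(\<lambda>T. (restrict (\<lambda>b. Min (T b)) S, restrict (\<lambda>b. T b - {Min (T b)}) S)) T
        \<in> (SIGMA T:A. PiE S (\<lambda>b. Pow (room n S T b)))"
      by (auto simp: T0_def[symmetric] E_def[symmetric] PiE_iff) (auto simp: E_def)
  qed
  finally show ?thesis unfolding A_def S_def .
qed

lemma wt_up_sv:
  fixes x t :: "nat \<Rightarrow> 'a::comm_ring_1"
  assumes a: "\<alpha> \<in> Par L" and b: "\<beta> \<in> Par L" and le: "\<alpha> \<le> \<beta>"
  shows "wt (\<lambda>k. up_sv t \<alpha> (x k)) n \<alpha> \<beta> =
    (\<Sum>T\<in>svn n (skew \<alpha> \<beta>). \<Prod>b\<in>skew \<alpha> \<beta>. (\<Prod>k\<in>T b. x k) * t (fst b) ^ (card (T b) - 1))"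
proof -
  have "(\<Prod>k\<in>{1..n}. up_sv t \<alpha> (x k) (level \<alpha> \<beta> T (k - 1)) (level \<alpha> \<beta> T k)) =
    (if column_strict (skew \<alpha> \<beta>) T then
     (\<Prod>b\<in>skew \<alpha> \<beta>. x (T b)) * (\<Prod>b\<in>skew \<alpha> \<beta>. \<Prod>k\<in>room n (skew \<alpha> \<beta>) T b. 1 + x k * t (fst b)) else 0)"
    if T: "T \<in> fill n \<alpha> \<beta>" for T
    unfolding up_sv_def up_def prod.distrib prod_room[OF T a b le] prod_if_zero[OF finite_atLeastAtMost]
      hs_levels[OF T a b le] prod_levels[OF T a b] column_strict_def[symmetric]
    by (simp add: if_distrib[of "\<lambda>z. z * _"] cong: if_cong)
  then have "wt (\<lambda>k. up_sv t \<alpha> (x k)) n \<alpha> \<beta> = (\<Sum>T\<in>fill n \<alpha> \<beta>. if column_strict (skew \<alpha> \<beta>) T then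
     (\<Prod>b\<in>skew \<alpha> \<beta>. x (T b)) * (\<Prod>b\<in>skew \<alpha> \<beta>. \<Prod>k\<in>room n (skew \<alpha> \<beta>) T b. 1 + x k * t (fst b)) else 0)"
    using le by (simp add: wt_def)
  also have "\<dots> = (\<Sum>T\<in>{T \<in> fill n \<alpha> \<beta>. column_strict (skew \<alpha> \<beta>) T}.
     (\<Prod>b\<in>skew \<alpha> \<beta>. x (T b)) * (\<Prod>b\<in>skew \<alpha> \<beta>. \<Prod>k\<in>room n (skew \<alpha> \<beta>) T b. 1 + x k * t (fst b)))"
    by (rule sum_if_filter) (rule finite_fill[OF a b])
  finally show ?thesis unfolding svn_weight[OF a b] .
qed

text \<open>Since \<open>0 ^ 0 = 1\<close>, setting \<open>t = 0\<close> leaves exactly the tableaux with one label per box.\<close>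

lemma wt_up:
  fixes x :: "nat \<Rightarrow> 'a::comm_ring_1"
  assumes "\<alpha> \<in> Par L" "\<beta> \<in> Par L" "\<alpha> \<le> \<beta>"
  shows "wt (\<lambda>k. up (x k)) n \<alpha> \<beta> =
    (\<Sum>T\<in>svn n (skew \<alpha> \<beta>). \<Prod>b\<in>skew \<alpha> \<beta>. (\<Prod>k\<in>T b. x k) * 0 ^ (card (T b) - 1))"
proof -
  have "up_sv (\<lambda>_. 0) \<alpha> y = up y" for y :: 'a by (simp add: up_sv_def fun_eq_iff cong: if_cong)
  then show ?thesis using wt_up_sv[OF assms, of "\<lambda>_. 0" x n] by simp
qed

text \<open>This is \<open>operator_identity\<close> with each chain read as a sum over fillings:
  the \<open>H\<close> chain fills \<open>skew \<mu>' \<mu>\<close>, the strips fill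
  \<open>skew \<mu>' \<kappa>'\<close>, and the \<open>V\<close> chain fills
  \<open>skew \<kappa> \<kappa>'\<close>. Ordinary tableaux appear as set-valued ones with
  \<open>t = 0\<close>.\<close>

theorem gf_expansion:
  fixes x t :: "nat \<Rightarrow> 'a::comm_ring_1"
  assumes m: "\<mu> \<in> Par l" and k: "\<kappa> \<in> Par L" "\<mu> \<le> \<kappa>" and l: "l + n \<le> L"
  shows "sv_gf x t n (skew \<mu> \<kappa>) =
    (\<Sum>(\<mu>', \<kappa>')\<in>{\<mu>' \<in> Par L. \<mu>' \<le> \<mu>} \<times> {\<kappa>' \<in> Par L. \<kappa> \<le> \<kappa>'}.
      (\<Sum>T\<in>above_tab (skew \<mu>' \<mu>). \<Prod>b\<in>skew \<mu>' \<mu>. - t (T b)) *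
      sv_gf x (\<lambda>_. 0) n (skew \<mu>' \<kappa>') *
      (\<Sum>T\<in>below_tab (skew \<kappa> \<kappa>'). \<Prod>b\<in>skew \<kappa> \<kappa>'. t (T b)))"
proof -
  define \<delta> where "\<delta> = (\<lambda>\<beta>. if \<beta> = \<kappa> then 1 else (0::'a))"
  define A where "A = wt (\<lambda>i. hstep i (- t i)) L"
  define B where "B = wt (\<lambda>i. vstep (Suc L - i) (t (Suc L - i))) L"
  define U where "U = wt (\<lambda>j. up (x j)) n"
  have mL: "\<mu> \<in> Par L" by (rule subsetD[OF Par_mono m]) (use l in linarith)
  have up0: "up y \<alpha> \<beta> = 0" if "\<not> \<alpha> \<le> \<beta>" for y :: 'a and \<alpha> \<beta> using that hs_imp_le by (auto simp: up_def)
  have sv0: "up_sv t \<mu> y \<alpha> \<beta> = 0" if "\<not> \<alpha> \<le> \<beta>" for y :: 'a and \<alpha> \<beta> using up0[OF that] by (simp add: up_sv_def)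
  have "sv_gf x t n (skew \<mu> \<kappa>) = wt (\<lambda>j. up_sv t \<mu> (x j)) n \<mu> \<kappa>"
    unfolding sv_gf_def by (rule wt_up_sv[OF mL k, symmetric])
  also have "\<dots> = chain (\<lambda>j. up_sv t \<mu> (x j)) n \<delta> \<mu>"
  proof -
    have "chain (\<lambda>j. up_sv t \<mu> (x j)) n \<delta> \<mu> =
        (\<Sum>\<beta>\<in>Par L. wt (\<lambda>j. up_sv t \<mu> (x j)) n \<mu> \<beta> * \<delta> \<beta>)"
      by (rule chain_eq_wt[OF _ mL]) (rule sv0)
    then show ?thesis
      using k(1) by (simp add: \<delta>_def if_distrib[of "\<lambda>z. _ * z"] cong: if_cong)
  qed
  also have "\<dots> = dchain (\<lambda>i. hstep i (- t i)) L (chain (\<lambda>j. up (x j)) n (vchain (\<lambda>i. vstep i (t i)) L \<delta>)) \<mu>"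
    unfolding \<delta>_def by (rule operator_identity[OF m k l, symmetric])
  also have "\<dots> = (\<Sum>\<mu>'\<in>Par L. A \<mu>' \<mu> * (\<Sum>\<kappa>'\<in>Par L. U \<mu>' \<kappa>' * B \<kappa> \<kappa>'))"
  proof -
    have v: "vchain (\<lambda>i. vstep i (t i)) L \<delta> \<kappa>' = B \<kappa> \<kappa>'" if "\<kappa>' \<in> Par L" for \<kappa>'
    proof -
      have "vchain (\<lambda>i. vstep i (t i)) L \<delta> \<kappa>' = (\<Sum>\<beta>\<in>Par L. B \<beta> \<kappa>' * \<delta> \<beta>)"
        unfolding vchain_eq_dchain B_def by (rule dchain_eq_wt[OF _ that]) (rule vstep_eq_0)
      then show ?thesis
        using k(1) by (simp add: \<delta>_def if_distrib[of "\<lambda>z. _ * z"] cong: if_cong)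
    qed
    have c: "chain (\<lambda>j. up (x j)) n (vchain (\<lambda>i. vstep i (t i)) L \<delta>) \<mu>' = (\<Sum>\<kappa>'\<in>Par L. U \<mu>' \<kappa>' * B \<kappa> \<kappa>')"
      if "\<mu>' \<in> Par L" for \<mu>'
    proof -
      have "chain (\<lambda>j. up (x j)) n (vchain (\<lambda>i. vstep i (t i)) L \<delta>) \<mu>' =
          (\<Sum>\<kappa>'\<in>Par L. U \<mu>' \<kappa>' * vchain (\<lambda>i. vstep i (t i)) L \<delta> \<kappa>')"
        unfolding U_def by (rule chain_eq_wt[OF _ that]) (rule up0)
      then show ?thesis by (simp add: v cong: sum.cong)
    qed
    have "dchain (\<lambda>i. hstep i (- t i)) L (chain (\<lambda>j. up (x j)) n (vchain (\<lambda>i. vstep i (t i)) L \<delta>)) \<mu> =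
        (\<Sum>\<mu>'\<in>Par L. A \<mu>' \<mu> * chain (\<lambda>j. up (x j)) n (vchain (\<lambda>i. vstep i (t i)) L \<delta>) \<mu>')"
      unfolding A_def by (rule dchain_eq_wt[OF _ mL]) (rule hstep_eq_0)
    then show ?thesis by (simp add: c cong: sum.cong)
  qed
  also have "\<dots> = (\<Sum>(\<mu>', \<kappa>')\<in>Par L \<times> Par L. A \<mu>' \<mu> * U \<mu>' \<kappa>' * B \<kappa> \<kappa>')"
    by (simp add: sum_distrib_left sum.cartesian_product mult.assoc)
  also have "\<dots> = (\<Sum>(\<mu>', \<kappa>')\<in>{\<mu>' \<in> Par L. \<mu>' \<le> \<mu>} \<times> {\<kappa>' \<in> Par L. \<kappa> \<le> \<kappa>'}. A \<mu>' \<mu> * U \<mu>' \<kappa>' * B \<kappa> \<kappa>')"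
  proof (rule sum.mono_neutral_right)
    show "\<forall>z\<in>Par L \<times> Par L - {\<mu>' \<in> Par L. \<mu>' \<le> \<mu>} \<times> {\<kappa>' \<in> Par L. \<kappa> \<le> \<kappa>'}.
       (case z of (\<mu>', \<kappa>') \<Rightarrow> A \<mu>' \<mu> * U \<mu>' \<kappa>' * B \<kappa> \<kappa>') = 0"
      by (auto simp: A_def B_def wt_def split: if_splits)
  qed auto
  also have "\<dots> = (\<Sum>(\<mu>', \<kappa>')\<in>{\<mu>' \<in> Par L. \<mu>' \<le> \<mu>} \<times> {\<kappa>' \<in> Par L. \<kappa> \<le> \<kappa>'}.
      (\<Sum>T\<in>above_tab (skew \<mu>' \<mu>). \<Prod>b\<in>skew \<mu>' \<mu>. - t (T b)) *
      sv_gf x (\<lambda>_. 0) n (skew \<mu>' \<kappa>') *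
      (\<Sum>T\<in>below_tab (skew \<kappa> \<kappa>'). \<Prod>b\<in>skew \<kappa> \<kappa>'. t (T b)))"
  proof (intro sum.cong refl, clarify)
    fix \<mu>' \<kappa>' assume "\<mu>' \<in> Par L" "\<mu>' \<le> \<mu>" "\<kappa>' \<in> Par L" "\<kappa> \<le> \<kappa>'"
    moreover from this have "\<mu>' \<le> \<kappa>'" using k(2) by (meson order_trans)
    ultimately show "A \<mu>' \<mu> * U \<mu>' \<kappa>' * B \<kappa> \<kappa>' =
      (\<Sum>T\<in>above_tab (skew \<mu>' \<mu>). \<Prod>b\<in>skew \<mu>' \<mu>. - t (T b)) *
      sv_gf x (\<lambda>_. 0) n (skew \<mu>' \<kappa>') *
      (\<Sum>T\<in>below_tab (skew \<kappa> \<kappa>'). \<Prod>b\<in>skew \<kappa> \<kappa>'. t (T b))"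
      unfolding A_def B_def U_def above_tab_def below_tab_def sv_gf_def
      using wt_hstep[of \<mu>' \<mu> "\<lambda>i. - t i"] wt_vstep[of \<kappa> \<kappa>' t] wt_up[of \<mu>' \<kappa>' x n] mL k(1) by simp
  qed
  finally show ?thesis .
qed

end

section \<open>Shapes containing a given shape\<close>

lemma skew_shapeD:
  assumes "skew_shape S" "(a, j') \<in> S" "(b, j) \<in> S" "a \<le> i" "i \<le> b" "j' \<le> k" "k \<le> j"
  shows "(i, k) \<in> S"
proof -
  have "(i, k) \<in> {(a, j')..(b, j)}" using assms by (simp add: less_eq_prod_def)
  then show ?thesis using assms(1-3) unfolding skew_shape_def by blast
qed

text \<open>An edge of the Hasse diagram joins comparable boxes, so if it passed over a column
  \<open>j\<close>, the interval between its ends would contain a box of that column. A path from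
  the first to the last column can therefore miss none; in the proof it stays to the left of a
  supposedly missing column.\<close>

lemma connected_columns:
  assumes sk: "skew_shape S" and co: "connected_shape S" and ne: "S \<noteq> {}"
  obtains p W where "snd ` S = {p<..W}"
proof -
  have fin: "finite (snd ` S)" and pos: "\<And>i j. (i, j) \<in> S \<Longrightarrow> 1 \<le> j"
    using sk by (auto simp: skew_shape_def)
  define u where "u = Min (snd ` S)"
  define W where "W = Max (snd ` S)"
  have uS: "u \<in> snd ` S" and WS: "W \<in> snd ` S" unfolding u_def W_def using fin ne by auto
  have "j \<in> snd ` S" if j: "u \<le> j" "j \<le> W" for j
  proof (rule ccontr)
    assume nj: "j \<notin> snd ` S"
    obtain b b' where b: "b \<in> S" "snd b = u" and b': "b' \<in> S" "snd b' = W" using uS WS by auto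
    have "(b, b') \<in> (hasse S \<union> (hasse S)\<inverse>)\<^sup>*" using co b b' by (simp add: connected_shape_def)
    then have "snd b' < j"
    proof (induction rule: rtrancl_induct)
      case base
      then show ?case using b uS j nj by (metis le_neq_implies_less)
    next
      case (step x y)
      have xy: "x \<in> S" "y \<in> S" "x \<le> y \<or> y \<le> x" using step(2) by (auto simp: hasse_def)
      show ?case
      proof (rule ccontr)
        assume "\<not> ?case"
        then have y: "j \<le> snd y" by simp
        then have "\<not> y \<le> x" using step.IH by (auto simp: less_eq_prod_def)
        then have "x \<le> y" using xy by blast
        then have "(fst x, j) \<in> S"
          using skew_shapeD[OF sk, of "fst x" "snd x" "fst y" "snd y" "fst x" j] xy y step.IH
          by (simp add: less_eq_prod_def)
        then show False using nj by force
      qed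
    qed
    then show False using b' j by simp
  qed
  moreover have "u \<le> j \<and> j \<le> W" if "j \<in> snd ` S" for j
    unfolding u_def W_def using fin that by simp
  moreover have "1 \<le> u" using uS pos by force
  moreover have "j \<in> {u - 1<..W} \<longleftrightarrow> u \<le> j \<and> j \<le> W" if "1 \<le> u" for j using that by auto
  ultimately have "snd ` S = {u - 1<..W}" by blast
  then show ?thesis by (rule that)
qed

context frame
begin

text \<open>Counting the columns that lie entirely below row \<open>i\<close>, instead of inspecting
  row \<open>i\<close>, also assigns an end to rows without boxes and makes the result antitone in
  \<open>S\<close>. \<open>outer\<close> is built in the same way from columns reaching row
  \<open>i\<close> or below.\<close>

definition inner :: "box set \<Rightarrow> rows" where
  "inner S i = p + card {j \<in> {p<..W}. \<forall>i'\<le>i. (i', j) \<notin> S}"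

definition outer :: "box set \<Rightarrow> rows" where
  "outer S i = p + card {j \<in> {p<..W}. \<exists>i'\<ge>i. (i', j) \<in> S}"

lemma inner_antimono: "S \<subseteq> S' \<Longrightarrow> inner S' \<le> inner S"
  unfolding inner_def le_fun_def by (intro allI add_left_mono card_mono) auto

lemma outer_mono: "S \<subseteq> S' \<Longrightarrow> outer S \<le> outer S'"
  unfolding outer_def le_fun_def by (intro allI add_left_mono card_mono) auto

text \<open>The counted columns form initial segments of \<open>{p<..W}\<close>. If column
  \<open>j\<close> begins below row \<open>i\<close> and a column further left had a box in row
  \<open>i\<close> or above, the interval to a box of column \<open>j\<close> would put a box of
  column \<open>j\<close> into that same row; for \<open>outer\<close> one argues likewise with the
  lower box.\<close>

lemma shape_rows:
  assumes sk: "skew_shape S" and cols: "snd ` S = {p<..W}" and rows: "\<And>i j. (i, j) \<in> S \<Longrightarrow> i \<le> l"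
    and ne: "p \<le> W"
  shows "inner S \<in> Par l" "outer S \<in> Par l" "inner S \<le> outer S" "skew (inner S) (outer S) = S"
proof -
  have col: "\<exists>i. (i, j) \<in> S" if "j \<in> {p<..W}" for j using that unfolding cols[symmetric] by auto
  have jW: "j \<in> {p<..W}" if "(i, j) \<in> S" for i j using that unfolding cols[symmetric] by force
  have pos: "1 \<le> i" if "(i, j) \<in> S" for i j using sk that by (auto simp: skew_shape_def)
  have I: "{j \<in> {p<..W}. \<forall>i'\<le>i. (i', j) \<notin> S} = {p<..inner S i}" for i
    unfolding inner_def
  proof (rule initial_interval)
    fix j j' assume j: "j \<in> {j \<in> {p<..W}. \<forall>i'\<le>i. (i', j) \<notin> S}" and j': "p < j'" "j' \<le> j"
    obtain a where a: "(a, j) \<in> S" using col j by auto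
    then have "i < a" using j by (metis (mono_tags, lifting) mem_Collect_eq not_le)
    then have "(i', j') \<notin> S" if "i' \<le> i" for i'
      using skew_shapeD[OF sk _ a, of i' j' i' j] j j' that by auto
    then show "j' \<in> {j \<in> {p<..W}. \<forall>i'\<le>i. (i', j) \<notin> S}" using j j' by auto
  qed auto
  have O: "{j \<in> {p<..W}. \<exists>i'\<ge>i. (i', j) \<in> S} = {p<..outer S i}" for i
    unfolding outer_def
  proof (rule initial_interval)
    fix j j' assume j: "j \<in> {j \<in> {p<..W}. \<exists>i'\<ge>i. (i', j) \<in> S}" and j': "p < j'" "j' \<le> j"
    then obtain b where b: "i \<le> b" "(b, j) \<in> S" by auto
    have j'W: "j' \<in> {p<..W}" using j j' by auto
    then obtain a where a: "(a, j') \<in> S" using col by auto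
    have "\<exists>i'\<ge>i. (i', j') \<in> S"
    proof (cases "i \<le> a")
      case False
      then have "(b, j') \<in> S" using skew_shapeD[OF sk a b(2), of b j'] b(1) j' by auto
      then show ?thesis using b(1) by blast
    qed (use a in blast)
    then show "j' \<in> {j \<in> {p<..W}. \<exists>i'\<ge>i. (i', j) \<in> S}" using j'W by auto
  qed auto
  have I0: "inner S 0 = W"
  proof -
    have "{j \<in> {p<..W}. \<forall>i'\<le>0. (i', j) \<notin> S} = {p<..W}" using pos by fastforce
    then show ?thesis using ne by (simp add: inner_def)
  qed
  have O0: "outer S 0 = W"
  proof -
    have "{j \<in> {p<..W}. \<exists>i'\<ge>0. (i', j) \<in> S} = {p<..W}" using col by auto
    then show ?thesis using ne by (simp add: outer_def)
  qed
  have IS: "inner S (Suc i) \<le> inner S i" for i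
    unfolding inner_def by (intro add_left_mono card_mono) auto
  have OS: "outer S (Suc i) \<le> outer S i" for i
    unfolding outer_def by (intro add_left_mono card_mono) (auto dest: Suc_leD)
  have Il: "inner S i = p" if "l < i" for i
  proof -
    have "{j \<in> {p<..W}. \<forall>i'\<le>i. (i', j) \<notin> S} = {}"
    proof (rule equals0I)
      fix j assume j: "j \<in> {j \<in> {p<..W}. \<forall>i'\<le>i. (i', j) \<notin> S}"
      then obtain a where "(a, j) \<in> S" using col by auto
      then show False using j rows[of a j] that by force
    qed
    then show ?thesis by (simp add: inner_def)
  qed
  have Ol: "outer S i = p" if "l < i" for i
  proof -
    have "{j \<in> {p<..W}. \<exists>i'\<ge>i. (i', j) \<in> S} = {}" using rows that by force
    then show ?thesis by (simp add: outer_def)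
  qed
  show "inner S \<in> Par l" "outer S \<in> Par l"
    using I0 O0 IS OS Il Ol by (auto simp: Par_def)
  show "inner S \<le> outer S"
    unfolding le_fun_def
  proof
    fix i
    have "{j \<in> {p<..W}. \<forall>i'\<le>i. (i', j) \<notin> S} \<subseteq> {j \<in> {p<..W}. \<exists>i'\<ge>i. (i', j) \<in> S}"
      using col nat_le_linear by blast
    then show "inner S i \<le> outer S i"
      unfolding inner_def outer_def by (intro add_left_mono card_mono) auto
  qed
  show "skew (inner S) (outer S) = S"
  proof (rule set_eqI, clarify)
    fix i j
    show "(i, j) \<in> skew (inner S) (outer S) \<longleftrightarrow> (i, j) \<in> S"
    proof
      assume s: "(i, j) \<in> S"
      have "j \<in> {p<..outer S i}" unfolding O[symmetric] using s jW[OF s] by auto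
      moreover have "j \<notin> {p<..inner S i}" unfolding I[symmetric] using s by auto
      ultimately show "(i, j) \<in> skew (inner S) (outer S)" by (auto simp: skew_def)
    next
      assume s: "(i, j) \<in> skew (inner S) (outer S)"
      then have ij: "inner S i < j" "j \<le> outer S i" by (auto simp: skew_def)
      have "p < j" using ij by (simp add: inner_def)
      then have "j \<in> {p<..outer S i}" "j \<notin> {p<..inner S i}" using ij by auto
      then have "\<exists>b\<ge>i. (b, j) \<in> S" "\<exists>a\<le>i. (a, j) \<in> S"
        unfolding O[symmetric] I[symmetric] by simp_all
      then obtain a b where "i \<le> b" "(b, j) \<in> S" "a \<le> i" "(a, j) \<in> S" by auto
      then show "(i, j) \<in> S" using skew_shapeD[OF sk, of a j b j i j] by simp
    qed
  qed
qed

lemma skew_shape_skew: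
  assumes a: "\<alpha> \<in> Par L" and b: "\<beta> \<in> Par L"
  shows "skew_shape (skew \<alpha> \<beta>)"
  unfolding skew_shape_def
proof (intro conjI ballI subsetI)
  show "finite (skew \<alpha> \<beta>)" by (rule finite_skew[OF a b])
  show "x \<in> {1..} \<times> {1..}" if "x \<in> skew \<alpha> \<beta>" for x
    using skew_row[OF a b, of "fst x" "snd x"] that by (cases x) auto
  fix x y z assume x: "x \<in> skew \<alpha> \<beta>" and y: "y \<in> skew \<alpha> \<beta>" and z: "z \<in> {x..y}"
  obtain i j where ij: "z = (i, j)" by (cases z)
  have "\<alpha> i \<le> \<alpha> (fst x)" "\<beta> (fst y) \<le> \<beta> i" "snd x \<le> j" "j \<le> snd y"
    using z Par_antimono[OF a, of "fst x" i] Par_antimono[OF b, of i "fst y"] by (auto simp: ij less_eq_prod_def)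
  then show "z \<in> skew \<alpha> \<beta>" using x y by (auto simp: ij skew_def)
qed

text \<open>Every column of the frame meets \<open>skew \<mu> \<kappa>\<close>, so a box at or left
  of the end of \<open>\<mu>\<close> lies above a box of that shape in its column, and a box beyond
  the end of \<open>\<kappa>\<close> lies below one.\<close>

lemma containing_shapes:
  assumes m: "\<mu> \<in> Par L" and k: "\<kappa> \<in> Par L" and cols: "snd ` skew \<mu> \<kappa> = {p<..W}"
    and m': "\<mu>' \<in> Par L" "\<mu>' \<le> \<mu>" and k': "\<kappa>' \<in> Par L" "\<kappa> \<le> \<kappa>'" and le: "\<mu> \<le> \<kappa>"
  shows "shape_contains (skew \<mu>' \<kappa>') (skew \<mu> \<kappa>)"
    and "boxes_above (skew \<mu>' \<kappa>') (skew \<mu> \<kappa>) = skew \<mu>' \<mu>"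
    and "boxes_below (skew \<mu>' \<kappa>') (skew \<mu> \<kappa>) = skew \<kappa> \<kappa>'"
proof -
  have l1: "\<mu>' i \<le> \<mu> i" "\<mu> i \<le> \<kappa> i" "\<kappa> i \<le> \<kappa>' i" for i
    using m'(2) k'(2) le by (auto simp: le_fun_def)
  have sub: "skew \<mu> \<kappa> \<subseteq> skew \<mu>' \<kappa>'"
    using l1(1,3) by (auto simp: skew_def intro: le_less_trans order_trans)
  show "shape_contains (skew \<mu>' \<kappa>') (skew \<mu> \<kappa>)"
    unfolding shape_contains_def cols using sub skew_row[OF m'(1) k'(1)] by auto
  have col: "\<exists>i. (i, j) \<in> skew \<mu> \<kappa>" if "(i, j) \<in> skew \<mu>' \<kappa>'" for i j
  proof -
    have "j \<in> {p<..W}" using skew_row[OF m'(1) k'(1) that] by simp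
    then show ?thesis unfolding cols[symmetric] by auto
  qed
  show "boxes_above (skew \<mu>' \<kappa>') (skew \<mu> \<kappa>) = skew \<mu>' \<mu>"
  proof (rule set_eqI, clarify)
    fix i j
    show "(i, j) \<in> boxes_above (skew \<mu>' \<kappa>') (skew \<mu> \<kappa>) \<longleftrightarrow> (i, j) \<in> skew \<mu>' \<mu>"
    proof
      assume "(i, j) \<in> boxes_above (skew \<mu>' \<kappa>') (skew \<mu> \<kappa>)"
      then obtain i' where i: "\<mu>' i < j" "(i, j) \<notin> skew \<mu> \<kappa>" "(i', j) \<in> skew \<mu> \<kappa>" "i < i'"
        by (auto simp: boxes_above_def skew_def)
      then have "j \<le> \<kappa> i" using Par_antimono[OF k, of i i'] by (auto simp: skew_def)
      then show "(i, j) \<in> skew \<mu>' \<mu>" using i by (auto simp: skew_def)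
    next
      assume "(i, j) \<in> skew \<mu>' \<mu>"
      then have i: "\<mu>' i < j" "j \<le> \<mu> i" by (auto simp: skew_def)
      then have M: "(i, j) \<in> skew \<mu>' \<kappa>'" using l1[of i] by (auto simp: skew_def)
      then obtain i' where i': "(i', j) \<in> skew \<mu> \<kappa>" using col by blast
      then have "i < i'" using i Par_antimono[OF m, of i' i] by (cases "i < i'") (auto simp: skew_def)
      then show "(i, j) \<in> boxes_above (skew \<mu>' \<kappa>') (skew \<mu> \<kappa>)"
        using M i i' by (auto simp: boxes_above_def skew_def)
    qed
  qed
  show "boxes_below (skew \<mu>' \<kappa>') (skew \<mu> \<kappa>) = skew \<kappa> \<kappa>'"
  proof (rule set_eqI, clarify)
    fix i j
    show "(i, j) \<in> boxes_below (skew \<mu>' \<kappa>') (skew \<mu> \<kappa>) \<longleftrightarrow> (i, j) \<in> skew \<kappa> \<kappa>'"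
    proof
      assume "(i, j) \<in> boxes_below (skew \<mu>' \<kappa>') (skew \<mu> \<kappa>)"
      then obtain i' where i: "j \<le> \<kappa>' i" "(i, j) \<notin> skew \<mu> \<kappa>" "(i', j) \<in> skew \<mu> \<kappa>" "i' < i"
        by (auto simp: boxes_below_def skew_def)
      then have "\<mu> i < j" using Par_antimono[OF m, of i' i] by (auto simp: skew_def)
      then show "(i, j) \<in> skew \<kappa> \<kappa>'" using i by (auto simp: skew_def)
    next
      assume "(i, j) \<in> skew \<kappa> \<kappa>'"
      then have i: "\<kappa> i < j" "j \<le> \<kappa>' i" by (auto simp: skew_def)
      then have M: "(i, j) \<in> skew \<mu>' \<kappa>'" using l1[of i] by (auto simp: skew_def)
      then obtain i' where i': "(i', j) \<in> skew \<mu> \<kappa>" using col by blast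
      then have "i' < i" using i Par_antimono[OF k, of i i'] by (cases "i' < i") (auto simp: skew_def)
      then show "(i, j) \<in> boxes_below (skew \<mu>' \<kappa>') (skew \<mu> \<kappa>)"
        using M i i' by (auto simp: boxes_below_def skew_def)
    qed
  qed
qed

text \<open>A row without boxes hides where its two ends are, so a row sequence is recovered from
  \<open>skew\<close> only when the opposite boundary is known. The boxes above and below provide
  such a known boundary.\<close>

lemma skew_inj:
  assumes "skew \<alpha> \<beta> = skew \<alpha>' \<beta>'"
  shows "\<alpha> \<le> \<beta> \<Longrightarrow> \<alpha>' \<le> \<beta> \<Longrightarrow> \<beta> = \<beta>' \<Longrightarrow> \<alpha> = \<alpha>'" "\<alpha> \<le> \<beta> \<Longrightarrow> \<alpha> \<le> \<beta>' \<Longrightarrow> \<alpha> = \<alpha>' \<Longrightarrow> \<beta> = \<beta>'"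
proof -
  have e: "\<alpha> i < j \<and> j \<le> \<beta> i \<longleftrightarrow> \<alpha>' i < j \<and> j \<le> \<beta>' i" for i j
    using assms by (auto simp: skew_def set_eq_iff)
  show "\<alpha> = \<alpha>'" if "\<alpha> \<le> \<beta>" "\<alpha>' \<le> \<beta>" "\<beta> = \<beta>'"
  proof
    fix i show "\<alpha> i = \<alpha>' i"
      using e[of i "\<alpha> i"] e[of i "\<alpha>' i"] le_funD[OF that(1), of i] le_funD[OF that(2), of i] that(3) by force
  qed
  show "\<beta> = \<beta>'" if "\<alpha> \<le> \<beta>" "\<alpha> \<le> \<beta>'" "\<alpha> = \<alpha>'"
  proof
    fix i show "\<beta> i = \<beta>' i"
      using e[of i "\<beta> i"] e[of i "\<beta>' i"] le_funD[OF that(1), of i] le_funD[OF that(2), of i] that(3) by force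
  qed
qed

text \<open>The assumptions on \<open>inner\<close> and \<open>outer\<close> select the canonical
  pair for the contained shape; then monotonicity of both in the shape places every containing shape
  between the required bounds.\<close>

lemma bij_containing_shapes:
  assumes m: "\<mu> \<in> Par L" and k: "\<kappa> \<in> Par L" and le: "\<mu> \<le> \<kappa>"
    and cols: "snd ` skew \<mu> \<kappa> = {p<..W}" and ne: "p \<le> W"
    and inn: "inner (skew \<mu> \<kappa>) = \<mu>" and out: "outer (skew \<mu> \<kappa>) = \<kappa>"
  shows "bij_betw (\<lambda>(\<mu>', \<kappa>'). skew \<mu>' \<kappa>')
     ({\<mu>' \<in> Par L. \<mu>' \<le> \<mu>} \<times> {\<kappa>' \<in> Par L. \<kappa> \<le> \<kappa>'})
     {M. skew_shape M \<and> shape_contains M (skew \<mu> \<kappa>) \<and> (\<forall>(i, j)\<in>M. i \<le> L)}" (is "bij_betw ?f ?X ?Y")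
  unfolding bij_betw_def
proof
  note cs = containing_shapes[OF m k cols _ _ _ _ le]
  show "inj_on ?f ?X"
  proof (rule inj_onI, clarify)
    fix \<mu>' \<kappa>' \<mu>'' \<kappa>''
    assume 1: "\<mu>' \<in> Par L" "\<mu>' \<le> \<mu>" "\<kappa>' \<in> Par L" "\<kappa> \<le> \<kappa>'"
      and 2: "\<mu>'' \<in> Par L" "\<mu>'' \<le> \<mu>" "\<kappa>'' \<in> Par L" "\<kappa> \<le> \<kappa>''" and e: "skew \<mu>' \<kappa>' = skew \<mu>'' \<kappa>''"
    have "skew \<mu>' \<mu> = skew \<mu>'' \<mu>" "skew \<kappa> \<kappa>' = skew \<kappa> \<kappa>''"
      using cs(2,3)[OF 1] cs(2,3)[OF 2] e by simp_all
    then show "\<mu>' = \<mu>'' \<and> \<kappa>' = \<kappa>''" using skew_inj 1 2 by blast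
  qed
  show "?f ` ?X = ?Y"
  proof
    show "?f ` ?X \<subseteq> ?Y"
      using cs(1) skew_shape_skew skew_row by fastforce
    show "?Y \<subseteq> ?f ` ?X"
    proof
      fix M assume M: "M \<in> ?Y"
      then have sk: "skew_shape M" and co: "shape_contains M (skew \<mu> \<kappa>)" and L: "\<And>i j. (i, j) \<in> M \<Longrightarrow> i \<le> L" by auto
      have cM: "snd ` M = {p<..W}" using co cols unfolding shape_contains_def by blast
      have sub: "skew \<mu> \<kappa> \<subseteq> M" using co by (simp add: shape_contains_def)
      note r = shape_rows[OF sk cM L ne]
      have "inner M \<le> \<mu>" "\<kappa> \<le> outer M" using inner_antimono[OF sub] outer_mono[OF sub] inn out by auto
      then have "(inner M, outer M) \<in> ?X" using r by auto
      moreover have "M = ?f (inner M, outer M)" using r(4) by simp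
      ultimately show "M \<in> ?f ` ?X" by blast
    qed
  qed
qed

end

section \<open>Extraction of coefficients\<close>

text \<open>
  Coefficients are extracted in the monoid algebra of the exponent functions: \<open>Inl k\<close> stands
  for the variable of the label \<open>k\<close> and \<open>Inr i\<close> for that of the row \<open>i\<close>.
\<close>

type_synonym monomial = "nat + nat \<Rightarrow> nat"

definition unit_exp :: "nat + nat \<Rightarrow> monomial" where
  "unit_exp z = (\<lambda>w. if w = z then 1 else 0)"

definition gen :: "'b set \<Rightarrow> ('b \<Rightarrow> monomial) \<Rightarrow> monomial \<Rightarrow>\<^sub>0 int" where
  "gen A f = (\<Sum>a\<in>A. Poly_Mapping.single (f a) 1)"

lemma lookup_gen: "finite A \<Longrightarrow> Poly_Mapping.lookup (gen A f) z = int (card {a \<in> A. f a = z})"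
proof -
  assume "finite A"
  have "Poly_Mapping.lookup (gen A f) z = (\<Sum>a\<in>A. if f a = z then 1 else 0)"
    unfolding gen_def lookup_sum by (intro sum.cong) (auto simp: lookup_single when_def)
  also have "\<dots> = (\<Sum>a\<in>{a \<in> A. f a = z}. 1)" by (rule sum_if_filter) fact
  finally show ?thesis by simp
qed

lemma gen_mult: "gen A f * gen B g = gen (A \<times> B) (\<lambda>(a, b). f a + g b)"
  unfolding gen_def sum_product by (simp add: sum.cartesian_product mult_single split_beta)

lemma gen_cong: "A = B \<Longrightarrow> (\<And>a. a \<in> B \<Longrightarrow> f a = g a) \<Longrightarrow> gen A f = gen B g"
  by (simp add: gen_def)

lemma prod_single:
  "(\<Prod>i\<in>A. Poly_Mapping.single (f i :: monomial) (1::int)) = Poly_Mapping.single (\<Sum>i\<in>A. f i) 1"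
  by (induction A rule: infinite_finite_induct)
    (simp_all add: mult_single plus_fun_def zero_fun_def flip: single_one)

lemma sum_monomial_apply: "(\<Sum>i\<in>A. (f i :: monomial)) w = (\<Sum>i\<in>A. f i w)"
  by (induction A rule: infinite_finite_induct) simp_all

lemma single_power:
  "Poly_Mapping.single (f :: monomial) (1::int) ^ m = Poly_Mapping.single (\<lambda>w. m * f w) 1"
  by (induction m) (simp_all add: mult_single plus_fun_def zero_fun_def flip: single_one)

lemma lookup_sign_mult: "Poly_Mapping.lookup ((- 1) ^ m * (q :: monomial \<Rightarrow>\<^sub>0 int)) z = (- 1) ^ m * Poly_Mapping.lookup q z"
  by (cases "even m") simp_all

abbreviation xvar :: "nat \<Rightarrow> monomial \<Rightarrow>\<^sub>0 int" where "xvar k \<equiv> Poly_Mapping.single (unit_exp (Inl k)) 1"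
abbreviation tvar :: "nat \<Rightarrow> monomial \<Rightarrow>\<^sub>0 int" where "tvar i \<equiv> Poly_Mapping.single (unit_exp (Inr i)) 1"

lemma card_filter_sum: "finite A \<Longrightarrow> (\<Sum>a\<in>A. if P a then 1 else (0::nat)) = card {a \<in> A. P a}"
  by (simp add: sum.If_cases Int_def)

section \<open>Monomials of contents and excesses\<close>

lemma label_monomial:
  assumes "finite S"
  shows "(\<Prod>b\<in>S. tvar (T b)) = Poly_Mapping.single (case_sum (\<lambda>_. 0) (content S T)) 1"
proof -
  have "(\<Sum>b\<in>S. unit_exp (Inr (T b))) = case_sum (\<lambda>_. 0) (content S T)"
  proof
    fix w show "(\<Sum>b\<in>S. unit_exp (Inr (T b))) w = case_sum (\<lambda>_. 0) (content S T) w"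
      using assms by (cases w) (auto simp: sum_monomial_apply unit_exp_def content_def sum.If_cases Int_def eq_commute)
  qed
  then show ?thesis unfolding prod_single by simp
qed

lemma svnD:
  assumes "T \<in> svn n S" "b \<in> S"
  shows "T b \<noteq> {}" "finite (T b)" "T b \<subseteq> {1..n}" "1 \<le> card (T b)"
proof -
  show 1: "T b \<noteq> {}" "finite (T b)" using assms by (auto simp: svn_def sv_tableaux_def PiE_iff)
  show "T b \<subseteq> {1..n}" using assms by (fastforce simp: svn_def sv_tableaux_def PiE_iff)
  show "1 \<le> card (T b)" using 1 by (simp add: Suc_le_eq card_gt_0_iff)
qed

lemma excess_eq:
  assumes "finite S" "T \<in> svn n S"
  shows "excess S T i = (\<Sum>b\<in>S. if fst b = i then card (T b) - 1 else 0)"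
proof -
  let ?R = "{b \<in> S. fst b = i}"
  have "(\<Sum>b\<in>S. if fst b = i then card (T b) - 1 else 0) = (\<Sum>b\<in>?R. card (T b) - 1)"
    by (rule sum_if_filter) (rule assms(1))
  also have "\<dots> = (\<Sum>b\<in>?R. card (T b)) - (\<Sum>b\<in>?R. 1)"
    by (rule sum_subtractf_nat) (use svnD(4)[OF assms(2)] in auto)
  finally show ?thesis by (simp add: excess_def)
qed

lemma excess_0_iff:
  assumes "finite S" "T \<in> svn n S"
  shows "excess S T = (\<lambda>_. 0) \<longleftrightarrow> (\<forall>b\<in>S. card (T b) = 1)"
proof -
  have "excess S T = (\<lambda>_. 0) \<longleftrightarrow> (\<forall>i. \<forall>b\<in>S. fst b = i \<longrightarrow> card (T b) - 1 = 0)"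
    unfolding fun_eq_iff excess_eq[OF assms] using assms(1) by (auto simp: sum_eq_0_iff)
  also have "\<dots> \<longleftrightarrow> (\<forall>b\<in>S. card (T b) = 1)"
    using svnD(4)[OF assms(2)] by (metis diff_is_0_eq diff_self_eq_0 le_antisym)
  finally show ?thesis .
qed

lemma content_monomial:
  assumes "finite S" "T \<in> svn n S"
  shows "(\<Prod>b\<in>S. \<Prod>k\<in>T b. xvar k) = Poly_Mapping.single (case_sum (sv_content S T) (\<lambda>_. 0)) 1"
proof -
  have "(\<Sum>b\<in>S. \<Sum>k\<in>T b. unit_exp (Inl k)) w = case_sum (sv_content S T) (\<lambda>_. 0) w" for w
  proof (cases w)
    case (Inl c)
    have "(\<Sum>b\<in>S. \<Sum>k\<in>T b. unit_exp (Inl k)) w = (\<Sum>b\<in>S. if c \<in> T b then 1 else 0)"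
      unfolding sum_monomial_apply
      by (intro sum.cong refl) (use svnD(2)[OF assms(2)] in \<open>simp add: unit_exp_def Inl\<close>)
    then show ?thesis using assms(1) by (simp add: Inl sv_content_def card_filter_sum)
  qed (simp add: sum_monomial_apply unit_exp_def)
  then have "(\<Sum>b\<in>S. \<Sum>k\<in>T b. unit_exp (Inl k)) = case_sum (sv_content S T) (\<lambda>_. 0)" by (rule ext)
  then show ?thesis by (simp add: prod_single)
qed

lemma excess_monomial:
  assumes "finite S" "T \<in> svn n S"
  shows "(\<Prod>b\<in>S. tvar (fst b) ^ (card (T b) - 1)) = Poly_Mapping.single (case_sum (\<lambda>_. 0) (excess S T)) 1"
proof -
  have "(\<Sum>b\<in>S. (\<lambda>w. (card (T b) - 1) * unit_exp (Inr (fst b)) w)) w = case_sum (\<lambda>_. 0) (excess S T) w" for w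
  proof (cases w)
    case (Inr i)
    have "(\<Sum>b\<in>S. (\<lambda>w. (card (T b) - 1) * unit_exp (Inr (fst b)) w)) w =
        (\<Sum>b\<in>S. if fst b = i then card (T b) - 1 else 0)"
      unfolding sum_monomial_apply by (intro sum.cong refl) (auto simp: unit_exp_def Inr)
    then show ?thesis by (simp add: Inr excess_eq[OF assms])
  qed (simp add: sum_monomial_apply unit_exp_def)
  then have "(\<Sum>b\<in>S. (\<lambda>w. (card (T b) - 1) * unit_exp (Inr (fst b)) w)) = case_sum (\<lambda>_. 0) (excess S T)" by (rule ext)
  then show ?thesis by (simp add: prod_single single_power)
qed

lemma case_sum_add:
  "case_sum (f :: nat \<Rightarrow> nat) (\<lambda>_. 0) + case_sum (\<lambda>_. 0) g = (case_sum f g :: monomial)"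
  "case_sum (\<lambda>_. 0) g + case_sum f (\<lambda>_. 0) = (case_sum f g :: monomial)"
  "case_sum f g + case_sum (\<lambda>_. 0) (h :: nat \<Rightarrow> nat) = (case_sum f (\<lambda>k. g k + h k) :: monomial)"
  by (auto simp: fun_eq_iff split: sum.splits)

lemma sv_gf_xt:
  assumes "finite S"
  shows "sv_gf xvar tvar n S = gen (svn n S) (\<lambda>T. case_sum (sv_content S T) (excess S T))"
  unfolding sv_gf_def gen_def
proof (intro sum.cong refl)
  fix T assume T: "T \<in> svn n S"
  show "(\<Prod>b\<in>S. (\<Prod>k\<in>T b. xvar k) * tvar (fst b) ^ (card (T b) - 1)) =
      Poly_Mapping.single (case_sum (sv_content S T) (excess S T)) 1"
    unfolding prod.distrib content_monomial[OF assms T] excess_monomial[OF assms T]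
    by (simp add: mult_single case_sum_add)
qed

lemma finite_svn: "finite S \<Longrightarrow> finite (svn n S)"
proof (rule finite_subset)
  assume "finite S"
  then show "finite (S \<rightarrow>\<^sub>E Pow {1..n})" by (intro finite_PiE) auto
  show "svn n S \<subseteq> S \<rightarrow>\<^sub>E Pow {1..n}"
  proof (intro subsetI PiE_I)
    fix T b assume T: "T \<in> svn n S"
    show "T b \<in> Pow {1..n}" if "b \<in> S" using svnD(3)[OF T that] by simp
    show "T b = undefined" if "b \<notin> S"
      using T that unfolding svn_def sv_tableaux_def by (blast intro: PiE_arb)
  qed
qed

lemma sv_gf_x0:
  assumes "finite S"
  shows "sv_gf xvar (\<lambda>_. 0) n S =
    gen {T \<in> svn n S. excess S T = (\<lambda>_. 0)} (\<lambda>T. case_sum (sv_content S T) (\<lambda>_. 0))"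
proof -
  have "sv_gf xvar (\<lambda>_. 0) n S =
    (\<Sum>T\<in>svn n S. if excess S T = (\<lambda>_. 0) then Poly_Mapping.single (case_sum (sv_content S T) (\<lambda>_. 0)) 1 else 0)"
    unfolding sv_gf_def
  proof (intro sum.cong refl)
    fix T assume T: "T \<in> svn n S"
    have "(\<Prod>b\<in>S. (0 :: monomial \<Rightarrow>\<^sub>0 int) ^ (card (T b) - 1)) = (if excess S T = (\<lambda>_. 0) then 1 else 0)"
    proof (cases "\<forall>b\<in>S. card (T b) = 1")
      case False
      then obtain b where "b \<in> S" "card (T b) \<noteq> 1" by auto
      then have "card (T b) - 1 \<noteq> 0" using svnD(4)[OF T, of b] by linarith
      then have "(0 :: monomial \<Rightarrow>\<^sub>0 int) ^ (card (T b) - 1) = 0" by (simp add: power_0_left)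
      then show ?thesis using False assms \<open>b \<in> S\<close> unfolding excess_0_iff[OF assms T]
        by (simp only: if_False) (rule prod_zero, auto)
    qed (simp add: excess_0_iff[OF assms T])
    then show "(\<Prod>b\<in>S. (\<Prod>k\<in>T b. xvar k) * 0 ^ (card (T b) - 1)) =
      (if excess S T = (\<lambda>_. 0) then Poly_Mapping.single (case_sum (sv_content S T) (\<lambda>_. 0)) 1 else 0)"
      unfolding prod.distrib content_monomial[OF assms T] by simp
  qed
  also have "\<dots> = (\<Sum>T\<in>{T \<in> svn n S. excess S T = (\<lambda>_. 0)}. Poly_Mapping.single (case_sum (sv_content S T) (\<lambda>_. 0)) 1)"
    by (rule sum_if_filter) (rule finite_svn[OF assms])
  finally show ?thesis by (simp add: gen_def)
qed

lemma finite_label_tab: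
  assumes "finite S"
  shows "finite (above_tab S)" "finite (below_tab S)"
proof -
  have "above_tab S \<subseteq> (PiE S (\<lambda>b. {..fst b}))" "below_tab S \<subseteq> (PiE S (\<lambda>b. {..fst b}))"
    by (auto simp: above_tab_def below_tab_def tableaux_def PiE_iff row_weakly_bounded_def row_bounded_def
        extensional_def intro: less_imp_le)
  moreover have "finite (PiE S (\<lambda>b. {..fst b}))" using assms by (intro finite_PiE) auto
  ultimately show "finite (above_tab S)" "finite (below_tab S)" by (auto intro: finite_subset)
qed

text \<open>A label above \<open>n\<close> in any box would have positive content, so the content
  already forces the bound of \<open>svn\<close>.\<close>

lemma SS_eq_svn:
  assumes "finite S" "\<And>k. n < k \<Longrightarrow> c k = 0"
  shows "SS c e S = {T \<in> svn n S. sv_content S T = c \<and> excess S T = e}"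
proof -
  have "T b \<subseteq> {..n}" if T: "T \<in> SS c e S" and b: "b \<in> S" for T b
  proof
    fix k assume k: "k \<in> T b"
    have "{b \<in> S. k \<in> T b} \<noteq> {}" using k b by blast
    then have "sv_content S T k \<noteq> 0" unfolding sv_content_def using assms(1) by simp
    then show "k \<in> {..n}" using T assms(2)[of k] by (cases "n < k") (auto simp: SS_def)
  qed
  then show ?thesis by (auto simp: SS_def svn_def)
qed

context frame
begin

lemma coefficient_expansion:
  assumes m: "\<mu> \<in> Par l" and k: "\<kappa> \<in> Par L" "\<mu> \<le> \<kappa>" and l: "l + n \<le> L"
    and cols: "snd ` skew \<mu> \<kappa> = {p<..W}" and c: "\<And>i. n < i \<Longrightarrow> c i = 0"
  shows "int (card (SS c e (skew \<mu> \<kappa>))) =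
    (\<Sum>(\<mu>', \<kappa>')\<in>{\<mu>' \<in> Par L. \<mu>' \<le> \<mu>} \<times> {\<kappa>' \<in> Par L. \<kappa> \<le> \<kappa>'}.
      (- 1) ^ card (boxes_above (skew \<mu>' \<kappa>') (skew \<mu> \<kappa>)) * int (a_coeff (skew \<mu> \<kappa>) (skew \<mu>' \<kappa>') e) *
      int (card (SS c (\<lambda>_. 0) (skew \<mu>' \<kappa>'))))"
proof -
  define z where "z = case_sum c e"
  have mL: "\<mu> \<in> Par L" by (rule subsetD[OF Par_mono m]) (use l in linarith)
  have fin: "finite (skew \<mu> \<kappa>)" by (rule finite_skew[OF mL k(1)])
  have z_iff: "case_sum f g = z \<longleftrightarrow> f = c \<and> g = e" for f g :: "nat \<Rightarrow> nat"
    unfolding z_def by (metis (no_types, lifting) ext old.sum.simps(5,6))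
  have "int (card (SS c e (skew \<mu> \<kappa>))) = Poly_Mapping.lookup (sv_gf xvar tvar n (skew \<mu> \<kappa>)) z"
  proof -
    have "SS c e (skew \<mu> \<kappa>) = {T \<in> svn n (skew \<mu> \<kappa>). sv_content (skew \<mu> \<kappa>) T = c \<and> excess (skew \<mu> \<kappa>) T = e}"
      by (rule SS_eq_svn[OF fin]) (rule c)
    then show ?thesis unfolding sv_gf_xt[OF fin] lookup_gen[OF finite_svn[OF fin]] z_iff by simp
  qed
  also have "\<dots> = (\<Sum>(\<mu>', \<kappa>')\<in>{\<mu>' \<in> Par L. \<mu>' \<le> \<mu>} \<times> {\<kappa>' \<in> Par L. \<kappa> \<le> \<kappa>'}.
      Poly_Mapping.lookup ((\<Sum>T\<in>above_tab (skew \<mu>' \<mu>). \<Prod>b\<in>skew \<mu>' \<mu>. - tvar (T b)) *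
      sv_gf xvar (\<lambda>_. 0) n (skew \<mu>' \<kappa>') *
      (\<Sum>T\<in>below_tab (skew \<kappa> \<kappa>'). \<Prod>b\<in>skew \<kappa> \<kappa>'. tvar (T b))) z)"
    unfolding gf_expansion[OF m k l] lookup_sum split_beta ..
  also have "\<dots> = (\<Sum>(\<mu>', \<kappa>')\<in>{\<mu>' \<in> Par L. \<mu>' \<le> \<mu>} \<times> {\<kappa>' \<in> Par L. \<kappa> \<le> \<kappa>'}.
      (- 1) ^ card (boxes_above (skew \<mu>' \<kappa>') (skew \<mu> \<kappa>)) * int (a_coeff (skew \<mu> \<kappa>) (skew \<mu>' \<kappa>') e) *
      int (card (SS c (\<lambda>_. 0) (skew \<mu>' \<kappa>'))))"
  proof (intro sum.cong refl, clarify)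
    fix \<mu>' \<kappa>' assume m': "\<mu>' \<in> Par L" "\<mu>' \<le> \<mu>" and k': "\<kappa>' \<in> Par L" "\<kappa> \<le> \<kappa>'"
    define M A B where "M = skew \<mu>' \<kappa>'" and "A = skew \<mu>' \<mu>" and "B = skew \<kappa> \<kappa>'"
    have AB: "boxes_above M (skew \<mu> \<kappa>) = A" "boxes_below M (skew \<mu> \<kappa>) = B"
      unfolding A_def B_def M_def using containing_shapes(2,3)[OF mL k(1) cols m' k' k(2)] .
    have finA: "finite A" and finB: "finite B" and finM: "finite M"
      unfolding A_def B_def M_def using finite_skew m' k' mL k by auto
    \<comment> \<open>Each box contributes one sign whatever its label, which yields the sign of the
      expansion.\<close>
    have above: "(\<Sum>T\<in>above_tab A. \<Prod>b\<in>A. - tvar (T b)) =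
        (- 1) ^ card A * gen (above_tab A) (\<lambda>T. case_sum (\<lambda>_. 0) (content A T))"
      unfolding gen_def sum_distrib_left
    proof (intro sum.cong refl)
      fix T
      have "(\<Prod>b\<in>A. - tvar (T b)) = (\<Prod>b\<in>A. (- 1) * tvar (T b))" by simp
      also have "\<dots> = (- 1) ^ card A * Poly_Mapping.single (case_sum (\<lambda>_. 0) (content A T)) 1"
        unfolding prod.distrib label_monomial[OF finA] by simp
      finally show "(\<Prod>b\<in>A. - tvar (T b)) = (- 1) ^ card A * Poly_Mapping.single (case_sum (\<lambda>_. 0) (content A T)) 1" .
    qed
    have below: "(\<Sum>T\<in>below_tab B. \<Prod>b\<in>B. tvar (T b)) = gen (below_tab B) (\<lambda>T. case_sum (\<lambda>_. 0) (content B T))"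
      by (simp add: gen_def label_monomial[OF finB])
    have SS0: "SS c (\<lambda>_. 0) M = {T \<in> svn n M. sv_content M T = c \<and> excess M T = (\<lambda>_. 0)}"
      by (rule SS_eq_svn[OF finM]) (rule c)
    let ?E = "{T \<in> svn n M. excess M T = (\<lambda>_. 0)}"
    define Z where "Z = {((T', T), T'') \<in> (above_tab A \<times> ?E) \<times> below_tab B.
        sv_content M T = c \<and> (\<lambda>i. content A T' i + content B T'' i) = e}"
    have finX: "finite ((above_tab A \<times> ?E) \<times> below_tab B)"
      by (simp add: finite_label_tab finA finB finite_svn[OF finM])
    have product: "(\<Sum>T\<in>above_tab A. \<Prod>b\<in>A. - tvar (T b)) * sv_gf xvar (\<lambda>_. 0) n M * (\<Sum>T\<in>below_tab B. \<Prod>b\<in>B. tvar (T b)) =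
      (- 1) ^ card A * gen ((above_tab A \<times> ?E) \<times> below_tab B)
        (\<lambda>((T', T), T''). case_sum (sv_content M T) (\<lambda>i. content A T' i + content B T'' i))"
    proof -
      have "gen (above_tab A) (\<lambda>T. case_sum (\<lambda>_. 0) (content A T)) * gen ?E (\<lambda>T. case_sum (sv_content M T) (\<lambda>_. 0)) *
          gen (below_tab B) (\<lambda>T. case_sum (\<lambda>_. 0) (content B T)) = gen ((above_tab A \<times> ?E) \<times> below_tab B)
        (\<lambda>((T', T), T''). case_sum (sv_content M T) (\<lambda>i. content A T' i + content B T'' i))"
        unfolding gen_mult by (rule gen_cong) (auto simp: case_sum_add)
      then show ?thesis unfolding above below sv_gf_x0[OF finM] by (simp add: mult.assoc)
    qed
    have "Poly_Mapping.lookup ((\<Sum>T\<in>above_tab A. \<Prod>b\<in>A. - tvar (T b)) * sv_gf xvar (\<lambda>_. 0) n M *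
       (\<Sum>T\<in>below_tab B. \<Prod>b\<in>B. tvar (T b))) z = (- 1) ^ card A *
       int (card {a \<in> (above_tab A \<times> ?E) \<times> below_tab B.
         (\<lambda>((T', T), T''). case_sum (sv_content M T) (\<lambda>i. content A T' i + content B T'' i)) a = z})"
      unfolding product lookup_sign_mult lookup_gen[OF finX] ..
    also have "{a \<in> (above_tab A \<times> ?E) \<times> below_tab B.
         (\<lambda>((T', T), T''). case_sum (sv_content M T) (\<lambda>i. content A T' i + content B T'' i)) a = z} = Z"
      unfolding Z_def by (auto simp: z_iff eq_commute[of z])
    \<comment> \<open>The conditions separate after regrouping: \<open>(T', T'')\<close> is subject
      to the content condition with \<open>e\<close>, and \<open>T\<close> to the one with
      \<open>c\<close>.\<close>
    also have "card Z = card (coeff_pairs (skew \<mu> \<kappa>) M e \<times> SS c (\<lambda>_. 0) M)"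
    proof (rule bij_betw_same_card)
      show "bij_betw (\<lambda>((T', T), T''). ((T', T''), T)) Z (coeff_pairs (skew \<mu> \<kappa>) M e \<times> SS c (\<lambda>_. 0) M)"
        by (rule bij_betw_byWitness[where f' = "\<lambda>((T', T''), T). ((T', T), T'')"])
          (auto simp: Z_def coeff_pairs_def AB SS0 above_tab_def below_tab_def)
    qed
    finally show "Poly_Mapping.lookup ((\<Sum>T\<in>above_tab (skew \<mu>' \<mu>). \<Prod>b\<in>skew \<mu>' \<mu>. - tvar (T b)) *
      sv_gf xvar (\<lambda>_. 0) n (skew \<mu>' \<kappa>') *
      (\<Sum>T\<in>below_tab (skew \<kappa> \<kappa>'). \<Prod>b\<in>skew \<kappa> \<kappa>'. tvar (T b))) z =
      (- 1) ^ card (boxes_above (skew \<mu>' \<kappa>') (skew \<mu> \<kappa>)) * int (a_coeff (skew \<mu> \<kappa>) (skew \<mu>' \<kappa>') e) *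
      int (card (SS c (\<lambda>_. 0) (skew \<mu>' \<kappa>')))"
      unfolding M_def[symmetric] A_def[symmetric] B_def[symmetric] AB(1)
      by (simp add: card_cartesian_product a_coeff_def)
  qed
  finally show ?thesis .
qed

end

text \<open>The minima increase strictly down a column and start at 1 or more, so
  \<open>n + 1\<close> consecutive boxes need a label above \<open>n\<close>.\<close>

lemma SS_long_column:
  assumes sk: "skew_shape M" and c: "\<And>k. n < k \<Longrightarrow> c k = 0"
    and ij: "(i0, j) \<in> M" "(i, j) \<in> M" "i0 + n \<le> i"
  shows "SS c e M = {}"
proof (rule equals0I)
  fix T assume T: "T \<in> SS c e M"
  have fin: "finite M" using sk by (simp add: skew_shape_def)
  have T': "T \<in> svn n M" using T SS_eq_svn[where c = c and n = n, OF fin] c by blast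
  have "d < Min (T (i0 + d, j))" if "d \<le> n" for d using that
  proof (induction d)
    case 0
    show ?case using svnD[OF T' ij(1)] by (simp add: Suc_le_eq subset_iff)
  next
    case (Suc d)
    have b: "(i0 + d, j) \<in> M" "(Suc (i0 + d), j) \<in> M"
      using skew_shapeD[OF sk ij(1,2)] Suc.prems ij(3) by auto
    have "Min (T (i0 + d, j)) \<le> Max (T (i0 + d, j))" using svnD[OF T' b(1)] by simp
    also have "\<dots> < Min (T (Suc (i0 + d), j))"
      using T' b by (auto simp: svn_def sv_semistandard_def)
    finally show ?case using Suc by simp
  qed
  moreover have "(i0 + n, j) \<in> M" using skew_shapeD[OF sk ij(1,2)] ij(3) by auto
  then have "Min (T (i0 + n, j)) \<in> {1..n}" using svnD[OF T'] by (meson Min_in subsetD)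
  ultimately show False using le_refl by fastforce
qed

theorem theorem3p5:
  fixes \<sigma> :: "box set" and c e :: "nat \<Rightarrow> nat"
  assumes "skew_shape \<sigma>" and "connected_shape \<sigma>" and "\<exists>j. (1, j) \<in> \<sigma>"
    and "eventually_zero_seq c" and "eventually_zero_seq e"
  shows "int (card (SS c e \<sigma>)) =
    (\<Sum>\<mu>\<in>supp_shapes \<sigma> e.
       (- 1) ^ card (boxes_above \<mu> \<sigma>) * int (a_coeff \<sigma> \<mu> e) * int (card (SS c (\<lambda>_. 0) \<mu>)))"
proof -
  obtain n where "\<forall>k\<ge>n. c k = 0"
    using assms(4) by (auto simp: eventually_zero_seq_def eventually_sequentially)
  then have c: "c k = 0" if "n < k" for k using that by simp
  obtain p W where cols: "snd ` \<sigma> = {p<..W}" using connected_columns[OF assms(1,2)] assms(3) by auto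
  then have pW: "p \<le> W" using assms(3) by (metis empty_iff greaterThanAtMost_empty image_is_empty nat_le_linear)
  define l where "l = Max (fst ` \<sigma>)"
  have rows: "i \<le> l" if "(i, j) \<in> \<sigma>" for i j
    unfolding l_def using that assms(1) by (intro Max_ge) (auto simp: skew_shape_def image_iff intro!: bexI[of _ "(i, j)"])
  \<comment> \<open>The \<open>n\<close> additional rows hold all strips of the labels
    \<open>1\<close>, ..., \<open>n\<close> started in \<open>Par l\<close>, and a shape reaching
    further down falls under \<open>SS_long_column\<close>.\<close>
  interpret frame p W "l + n" .
  define \<mu> \<kappa> where "\<mu> = inner \<sigma>" and "\<kappa> = outer \<sigma>"
  have sh: "\<mu> \<in> Par l" "\<kappa> \<in> Par l" "\<mu> \<le> \<kappa>" "skew \<mu> \<kappa> = \<sigma>"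
    unfolding \<mu>_def \<kappa>_def by (rule shape_rows[OF assms(1) cols _ pW], erule rows)+
  have L: "\<mu> \<in> Par (l + n)" "\<kappa> \<in> Par (l + n)" using sh(1,2) Par_mono[of l "l + n"] by auto
  have cols': "snd ` skew \<mu> \<kappa> = {p<..W}" using cols sh(4) by simp
  define F where "F = (\<lambda>M. (- 1) ^ card (boxes_above M \<sigma>) * int (a_coeff \<sigma> M e) * int (card (SS c (\<lambda>_. 0) M)))"
  \<comment> \<open>The operators see only the shapes inside the frame. \<open>Y\<close> and the
    support differ by zero terms on both sides: shapes in the frame but off the support have
    coefficient 0, and shapes of the support that leave the frame have no tableaux of content
    \<open>c\<close>.\<close>
  define Y where "Y = {M. skew_shape M \<and> shape_contains M \<sigma> \<and> (\<forall>(i, j)\<in>M. i \<le> l + n)}"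
  let ?X = "{\<mu>' \<in> Par (l + n). \<mu>' \<le> \<mu>} \<times> {\<kappa>' \<in> Par (l + n). \<kappa> \<le> \<kappa>'}"
  have bij: "bij_betw (\<lambda>(\<mu>', \<kappa>'). skew \<mu>' \<kappa>') ?X Y"
    using bij_containing_shapes[OF L sh(3) cols' pW] sh(4) unfolding Y_def \<mu>_def \<kappa>_def by simp
  have "int (card (SS c e \<sigma>)) = (\<Sum>(\<mu>', \<kappa>')\<in>?X. F (skew \<mu>' \<kappa>'))"
    unfolding F_def sh(4)[symmetric]
    by (rule coefficient_expansion[OF sh(1) L(2) sh(3) order_refl cols']) (rule c)
  also have "\<dots> = sum F Y"
    using sum.reindex_bij_betw[OF bij, of F] by (simp add: split_beta)
  also have "\<dots> = sum F (Y \<inter> supp_shapes \<sigma> e)"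
  proof (rule sum.mono_neutral_right)
    show "finite Y" using bij_betw_finite[OF bij] by auto
    show "\<forall>M\<in>Y - Y \<inter> supp_shapes \<sigma> e. F M = 0" by (auto simp: Y_def supp_shapes_def F_def)
  qed auto
  also have "\<dots> = sum F (supp_shapes \<sigma> e)"
  proof (rule sum.mono_neutral_left)
    show "finite (supp_shapes \<sigma> e)" by (rule finite_supp_shapes[OF assms(1,5)])
    show "\<forall>M\<in>supp_shapes \<sigma> e - Y \<inter> supp_shapes \<sigma> e. F M = 0"
    proof
      fix M assume M: "M \<in> supp_shapes \<sigma> e - Y \<inter> supp_shapes \<sigma> e"
      then have sk: "skew_shape M" and co: "shape_contains M \<sigma>" by (auto simp: supp_shapes_def)
      obtain i j where ij: "(i, j) \<in> M" "l + n < i" using M sk co by (force simp: Y_def not_le)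
      then have "j \<in> snd ` \<sigma>" using co by (force simp: shape_contains_def)
      then obtain i0 where i0: "(i0, j) \<in> \<sigma>" by auto
      then have "(i0, j) \<in> M" "i0 + n \<le> i" using co ij(2) rows[OF i0] by (auto simp: shape_contains_def)
      then have "SS c (\<lambda>_. 0) M = {}"
        by (intro SS_long_column[OF sk _ _ ij(1), of n]) (auto intro: c)
      then show "F M = 0" by (simp add: F_def)
    qed
  qed auto
  finally show ?thesis by (simp add: F_def)
qed

end
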